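(* Let $n\ge1$ and let $\lambda,\mu$ be partitions with $\lambda_1\le n$, $\mu_1\le n$. Let $v_{\widetilde\mu}$ be a highest weight vector of the irreducible $gl(n)$-module $Schur_\mu(n)$ of highest weight $\widetilde\mu$. Then: (i) if $\lambda\nsubseteq\mu$ (containment of Ferrers diagrams), then $\mathbf{S}_\lambda(n)(v_{\widetilde\mu})=0$; (ii) if $\mu=\lambda$, then $\mathbf{S}_\lambda(n)(v_{\widetilde\lambda})=H(\lambda)\cdot v_{\widetilde\lambda}$, where $H(\lambda)$ is the product of the hook lengths of the cells of the Ferrers diagram of $\lambda$.
   Context: Virtual method. $gl(m_0|m_1+n)$ ($m_0,m_1$ sufficiently large) is the complex general linear Lie superalgebra with basis $e_{a,b}$, $a,b\in A_0\cup A_1\cup L$, $A_0=\{\alpha_1,\dots,\alpha_{m_0}\}$ (parity $0$), $A_1=\{\beta_1,\dots,\beta_{m_1}\}$ (parity $1$), $L=\{1,\dots,n\}$ (parity $1$), $|e_{a,b}|=|a|+|b|$, and $[e_{a,b},e_{c,d}]=\delta_{bc}e_{a,d}-(-1)^{(|a|+|b|)(|c|+|d|)}\delta_{ad}e_{c,b}$. Symbols in $A_0\cup A_1$ are virtual. $gl(n)$ is the subalgebra spanned by $e_{i,j}$, $i,j\in L$, so $\mathbf{U}(gl(n))\subset\mathbf{U}(gl(m_0|m_1+n))$. A product $e_{a_M,b_M}\cdots e_{a_1,b_1}$ is irregular if there are $i\le M$ and a virtual symbol $\gamma$ with $\#\{j\le i: b_j=\gamma\}>\#\{j<i: a_j=\gamma\}$.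 Let $\mathbf{Irr}$ be the left ideal of $\mathbf{U}(gl(m_0|m_1+n))$ generated by irregular products. The sum $Virt(m_0+m_1,n)=\mathbf{U}(gl(n))\oplus\mathbf{Irr}$ is direct and is a subalgebra in which $\mathbf{Irr}$ is a two-sided ideal; $\mathfrak p:Virt(m_0+m_1,n)\to\mathbf{U}(gl(n))$ is the projection with kernel $\mathbf{Irr}$ (an algebra epimorphism). All monomials to which $\mathfrak p$ is applied here lie in $Virt(m_0+m_1,n)$. Tableaux. For two Young tableaux $S,T$ of the same shape $\lambda$ (row $i$ has $\lambda_i$ cells), $e_{S,T}$ is the product of the $e_{s,t}$, $s,t$ being the entries of $S,T$ in the same cell, the cells being read row by row from top to bottom and from left to right in each row. $C^*_\lambda$ is the tableau of shape $\lambda$ whose entries in row $i$ all equal $\alpha_i$; $D^*_\lambda$ is the tableau of shape $\lambda$ whose entries in column $j$ all equal $\beta_j$ ($m_0\ge\widetilde\lambda_1$, $m_1\ge\lambda_1$). For $\lambda_1\le n$, $$\mathbf{S}_\lambda(n)=\frac1{H(\lambda)}\sum_S\mathfrak p\big(e_{S,C^*_\lambda}\cdot e_{C^*_\lambda,D^*_\lambda}\cdot e_{D^*_\lambda,C^*_\lambda}\cdot e_{C^*_\lambda,S}\big)\in\mathbf{U}(gl(n)),$$ the sum being over all tableaux $S$ of shape $\lambda$ with entries in $\{1,\dots,n\}$ whose rows are strictly increasing; $\mathbf{S}_\emptyset(n)=1$. These elements are central in $\mathbf{U}(gl(n))$. For a partition $\mu$ with $\mu_1\le n$, $Schur_\mu(n)$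 is the irreducible $gl(n)$-module of highest weight $\widetilde\mu$ (the conjugate partition, padded by zeros to length $n$). *)

theory Defs
  imports
    Complex_Main
    "HOL-Library.Poly_Mapping"
    "HOL-Library.FuncSet"
    "HOL-Algebra.QuotRing"
begin

section \<open>Partitions\<close>

definition is_partition :: "nat list \<Rightarrow> bool" where
  "is_partition lam \<longleftrightarrow> sorted_wrt (\<ge>) lam \<and> (\<forall>k\<in>set lam. 0 < k)"

text \<open>Parts are numbered from 1 and vanish beyond the length.\<close>

definition part :: "nat list \<Rightarrow> nat \<Rightarrow> nat" where
  "part lam i = (if 1 \<le> i \<and> i \<le> length lam then lam ! (i - 1) else 0)"

definition diagram :: "nat list \<Rightarrow> (nat \<times> nat) set" where
  "diagram lam = {(i, j). 1 \<le> i \<and> 1 \<le> j \<and> j \<le> part lam i}"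

definition conj_part :: "nat list \<Rightarrow> nat \<Rightarrow> nat" where
  "conj_part lam j = card {i. (i, j) \<in> diagram lam}"

definition hook_length :: "nat list \<Rightarrow> nat \<times> nat \<Rightarrow> nat" where
  "hook_length lam = (\<lambda>(i, j).
     card {j'. j < j' \<and> (i, j') \<in> diagram lam} + card {i'. i < i' \<and> (i', j) \<in> diagram lam} + 1)"

definition hook_product :: "nat list \<Rightarrow> nat" where
  "hook_product lam = (\<Prod>c\<in>diagram lam. hook_length lam c)"

text \<open>The cells of the diagram in reading order.\<close>

definition cells :: "nat list \<Rightarrow> (nat \<times> nat) list" where
  "cells lam = concat (map (\<lambda>i. map (\<lambda>j. (i, j)) [1..<Suc (part lam i)]) [1..<Suc (length lam)])"


section \<open>Enveloping algebras of general linear Lie superalgebras\<close>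

datatype sym = Alpha nat | Beta nat | Prop (index: nat)

primrec parity :: "sym \<Rightarrow> nat" where
  "parity (Alpha i) = 0"
| "parity (Beta i) = 1"
| "parity (Prop i) = 1"

primrec virtual :: "sym \<Rightarrow> bool" where
  "virtual (Alpha i) \<longleftrightarrow> True"
| "virtual (Beta i) \<longleftrightarrow> True"
| "virtual (Prop i) \<longleftrightarrow> False"

definition proper_symbols :: "nat \<Rightarrow> sym set" where
  "proper_symbols n = Prop ` {1..n}"

definition symbols :: "nat \<Rightarrow> nat \<Rightarrow> nat \<Rightarrow> sym set" where
  "symbols m0 m1 n = Alpha ` {1..m0} \<union> Beta ` {1..m1} \<union> proper_symbols n"

text \<open>
  Words in the letters \<open>(a, b)\<close>, which stand for the \<open>e\<^sub>a\<^sub>b\<close>. The additive monoid structure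
  is concatenation, so that \<open>word \<Rightarrow>\<^sub>0 complex\<close> with the library's convolution
  product is the free associative complex algebra on these letters.
\<close>

datatype word = Word (letters: "(sym \<times> sym) list")

instantiation word :: monoid_add
begin

definition zero_word :: word where
  "zero_word = Word []"

definition plus_word :: "word \<Rightarrow> word \<Rightarrow> word" where
  "plus_word u v = Word (letters u @ letters v)"

instance
  by standard (auto simp: zero_word_def plus_word_def)

end

type_synonym free_alg = "word \<Rightarrow>\<^sub>0 complex"

definition gen :: "sym \<Rightarrow> sym \<Rightarrow> free_alg" where
  "gen a b = Poly_Mapping.single (Word [(a, b)]) 1"

text \<open>The free algebra on the letters with both symbols in \<open>A\<close>.\<close>

definition free_ring :: "sym set \<Rightarrow> free_alg ring" where
  "free_ring A =
     \<lparr>carrier = {p. \<forall>w\<in>Poly_Mapping.keys p. set (letters w) \<subseteq> A \<times> A},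
      mult = (*), one = 1, zero = 0, add = (+)\<rparr>"

definition gl_sign :: "sym \<Rightarrow> sym \<Rightarrow> sym \<Rightarrow> sym \<Rightarrow> free_alg" where
  "gl_sign a b c d = (- 1) ^ ((parity a + parity b) * (parity c + parity d))"

definition gl_bracket :: "sym \<Rightarrow> sym \<Rightarrow> sym \<Rightarrow> sym \<Rightarrow> free_alg" where
  "gl_bracket a b c d =
     (if b = c then gen a d else 0) - gl_sign a b c d * (if a = d then gen c b else 0)"

definition gl_relations :: "sym set \<Rightarrow> free_alg set" where
  "gl_relations A =
     {gen a b * gen c d - gl_sign a b c d * (gen c d * gen a b) - gl_bracket a b c d
      | a b c d. a \<in> A \<and> b \<in> A \<and> c \<in> A \<and> d \<in> A}"

definition env_ideal :: "sym set \<Rightarrow> free_alg set" where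
  "env_ideal A = Idl\<^bsub>free_ring A\<^esub> (gl_relations A)"

text \<open>
  The enveloping algebra of the general linear Lie superalgebra with basis \<open>e\<^sub>a\<^sub>b\<close>,
  \<open>a, b \<in> A\<close>: the tensor algebra is the free algebra on the basis. Its elements are cosets.
\<close>

definition env :: "sym set \<Rightarrow> free_alg set ring" where
  "env A = free_ring A Quot env_ideal A"

abbreviation U_super :: "nat \<Rightarrow> nat \<Rightarrow> nat \<Rightarrow> free_alg set ring" where
  "U_super m0 m1 n \<equiv> env (symbols m0 m1 n)"

abbreviation U_gl :: "nat \<Rightarrow> free_alg set ring" where
  "U_gl n \<equiv> env (proper_symbols n)"

definition env_monomial :: "sym set \<Rightarrow> (sym \<times> sym) list \<Rightarrow> free_alg set" where
  "env_monomial A w = env_ideal A +>\<^bsub>free_ring A\<^esub> Poly_Mapping.single (Word w) 1"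

definition env_scalar :: "sym set \<Rightarrow> complex \<Rightarrow> free_alg set" where
  "env_scalar A c = env_ideal A +>\<^bsub>free_ring A\<^esub> Poly_Mapping.single 0 c"

text \<open>
  The canonical map from the enveloping algebra of \<open>gl(n)\<close> to that of \<open>gl(m\<^sub>0|m\<^sub>1+n)\<close>: the coset
  of a polynomial \<open>p\<close> in the proper letters goes to the coset of the same \<open>p\<close>.
\<close>

definition env_incl :: "nat \<Rightarrow> nat \<Rightarrow> nat \<Rightarrow> free_alg set \<Rightarrow> free_alg set" where
  "env_incl m0 m1 n x =
     env_ideal (symbols m0 m1 n) <+>\<^bsub>free_ring (symbols m0 m1 n)\<^esub> x"


section \<open>The virtual projection\<close>

text \<open>
  A product \<open>e\<^sub>a\<^sub>M\<^sub>b\<^sub>M \<dots> e\<^sub>a\<^sub>1\<^sub>b\<^sub>1\<close> is a list starting with the letter of index \<open>M\<close>; after reversal,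
  position \<open>i\<close> (from 0) holds the letter of index \<open>i + 1\<close>.
\<close>

definition irregular :: "(sym \<times> sym) list \<Rightarrow> bool" where
  "irregular w \<longleftrightarrow>
     (\<exists>i<length w. \<exists>g. virtual g \<and>
        card {j. j \<le> i \<and> snd (rev w ! j) = g} > card {j. j < i \<and> fst (rev w ! j) = g})"

definition left_ideal_gen :: "('a, 'b) ring_scheme \<Rightarrow> 'a set \<Rightarrow> 'a set" where
  "left_ideal_gen R S =
     \<Inter>{I. additive_subgroup I R \<and> (\<forall>x\<in>carrier R. \<forall>a\<in>I. x \<otimes>\<^bsub>R\<^esub> a \<in> I) \<and> S \<subseteq> I}"

definition Irr :: "nat \<Rightarrow> nat \<Rightarrow> nat \<Rightarrow> free_alg set set" where
  "Irr m0 m1 n =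
     left_ideal_gen (U_super m0 m1 n)
       {env_monomial (symbols m0 m1 n) w
        | w. set w \<subseteq> symbols m0 m1 n \<times> symbols m0 m1 n \<and> irregular w}"

text \<open>
  The projection onto the first summand of \<open>Virt(m\<^sub>0+m\<^sub>1,n) = U(gl(n)) \<oplus> Irr\<close>. The component
  \<open>y\<close> of an element \<open>x\<close> of this sum is unique because the sum is direct; outside the sum the
  value is unspecified.
\<close>

definition virt_proj :: "nat \<Rightarrow> nat \<Rightarrow> nat \<Rightarrow> free_alg set \<Rightarrow> free_alg set" where
  "virt_proj m0 m1 n x =
     (SOME y. y \<in> carrier (U_gl n) \<and>
        x \<ominus>\<^bsub>U_super m0 m1 n\<^esub> env_incl m0 m1 n y \<in> Irr m0 m1 n)"


section \<open>Tableaux and the central elements\<close>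

type_synonym 'a tableau = "nat \<times> nat \<Rightarrow> 'a"

definition row_strict_tableaux :: "nat \<Rightarrow> nat list \<Rightarrow> nat tableau set" where
  "row_strict_tableaux n lam =
     {S \<in> diagram lam \<rightarrow>\<^sub>E {1..n}.
        \<forall>i j j'. (i, j) \<in> diagram lam \<and> (i, j') \<in> diagram lam \<and> j < j' \<longrightarrow> S (i, j) < S (i, j')}"

definition Cstar :: "sym tableau" where
  "Cstar = (\<lambda>(i, j). Alpha i)"

definition Dstar :: "sym tableau" where
  "Dstar = (\<lambda>(i, j). Beta j)"

definition e_tab :: "sym set \<Rightarrow> nat list \<Rightarrow> sym tableau \<Rightarrow> sym tableau \<Rightarrow> free_alg set" where
  "e_tab A lam S T = env_monomial A (map (\<lambda>c. (S c, T c)) (cells lam))"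

definition schur_summand :: "nat \<Rightarrow> nat \<Rightarrow> nat \<Rightarrow> nat list \<Rightarrow> nat tableau \<Rightarrow> free_alg set" where
  "schur_summand m0 m1 n lam S =
     (let A = symbols m0 m1 n; S' = (\<lambda>c. Prop (S c)) in
      e_tab A lam S' Cstar \<otimes>\<^bsub>env A\<^esub> e_tab A lam Cstar Dstar
        \<otimes>\<^bsub>env A\<^esub> e_tab A lam Dstar Cstar \<otimes>\<^bsub>env A\<^esub> e_tab A lam Cstar S')"

definition schur_elem :: "nat \<Rightarrow> nat \<Rightarrow> nat \<Rightarrow> nat list \<Rightarrow> free_alg set" where
  "schur_elem m0 m1 n lam =
     env_scalar (proper_symbols n) (1 / of_nat (hook_product lam)) \<otimes>\<^bsub>U_gl n\<^esub>
     finsum (U_gl n) (\<lambda>S. virt_proj m0 m1 n (schur_summand m0 m1 n lam S))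
       (row_strict_tableaux n lam)"


section \<open>Modules over the general linear Lie algebra\<close>

text \<open>
  A \<open>gl(n)\<close>-module is a complex vector space (the type \<open>'v\<close> with scalar multiplication
  \<open>scale\<close>) and the operators \<open>\<rho> i j\<close> by which the basis elements \<open>e\<^sub>i\<^sub>j\<close>, \<open>1 \<le> i, j \<le> n\<close>, act.
\<close>

definition gl_module ::
  "nat \<Rightarrow> (complex \<Rightarrow> 'v \<Rightarrow> 'v) \<Rightarrow> (nat \<Rightarrow> nat \<Rightarrow> 'v \<Rightarrow> 'v::ab_group_add) \<Rightarrow> bool" where
  "gl_module n scale \<rho> \<longleftrightarrow>
     vector_space scale \<and>
     (\<forall>i\<in>{1..n}. \<forall>j\<in>{1..n}. Vector_Spaces.linear scale scale (\<rho> i j)) \<and>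
     (\<forall>i\<in>{1..n}. \<forall>j\<in>{1..n}. \<forall>k\<in>{1..n}. \<forall>l\<in>{1..n}. \<forall>x.
        \<rho> i j (\<rho> k l x) - \<rho> k l (\<rho> i j x) =
        (if j = k then \<rho> i l x else 0) - (if i = l then \<rho> k j x else 0))"

definition irreducible_gl_module ::
  "nat \<Rightarrow> (complex \<Rightarrow> 'v \<Rightarrow> 'v) \<Rightarrow> (nat \<Rightarrow> nat \<Rightarrow> 'v \<Rightarrow> 'v::ab_group_add) \<Rightarrow> bool" where
  "irreducible_gl_module n scale \<rho> \<longleftrightarrow>
     gl_module n scale \<rho> \<and> (UNIV :: 'v set) \<noteq> {0} \<and>
     (\<forall>W. module.subspace scale W \<and> (\<forall>i\<in>{1..n}. \<forall>j\<in>{1..n}. \<rho> i j ` W \<subseteq> W) \<longrightarrow>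
        W = {0} \<or> W = UNIV)"

definition highest_weight_vector ::
  "nat \<Rightarrow> (complex \<Rightarrow> 'v \<Rightarrow> 'v) \<Rightarrow> (nat \<Rightarrow> nat \<Rightarrow> 'v \<Rightarrow> 'v::ab_group_add) \<Rightarrow> (nat \<Rightarrow> nat) \<Rightarrow> 'v \<Rightarrow> bool"
where
  "highest_weight_vector n scale \<rho> wt v \<longleftrightarrow>
     v \<noteq> 0 \<and>
     (\<forall>i\<in>{1..n}. \<forall>j\<in>{1..n}. i < j \<longrightarrow> \<rho> i j v = 0) \<and>
     (\<forall>i\<in>{1..n}. \<rho> i i v = scale (of_nat (wt i)) v)"

definition free_action ::
  "(complex \<Rightarrow> 'v \<Rightarrow> 'v) \<Rightarrow> (nat \<Rightarrow> nat \<Rightarrow> 'v \<Rightarrow> 'v::ab_group_add) \<Rightarrow> free_alg \<Rightarrow> 'v \<Rightarrow> 'v" where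
  "free_action scale \<rho> p v =
     (\<Sum>w\<in>Poly_Mapping.keys p.
        scale (Poly_Mapping.lookup p w)
          (foldr (\<lambda>(a, b). \<rho> (index a) (index b)) (letters w) v))"

text \<open>
  The action of the enveloping algebra of \<open>gl(n)\<close>: all representatives \<open>p\<close> of the coset \<open>x\<close>
  send \<open>v\<close> to the same vector.
\<close>

definition U_action ::
  "(complex \<Rightarrow> 'v \<Rightarrow> 'v) \<Rightarrow> (nat \<Rightarrow> nat \<Rightarrow> 'v \<Rightarrow> 'v::ab_group_add) \<Rightarrow> free_alg set \<Rightarrow> 'v \<Rightarrow> 'v" where
  "U_action scale \<rho> x v = the_elem ((\<lambda>p. free_action scale \<rho> p v) ` x)"

end

theory Submission
  imports Defs "HOL-Library.Product_Plus" "HOL-Library.Function_Algebras" "HOL-Library.Countable"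
    "HOL-Library.Multiset"
begin

text \<open>
  Let $V$ be the algebra of polynomials in even variables $x_{\alpha,j}$ and odd variables
  $x_{\beta,j}$, $x_{i,j}$, where $j$ runs through finitely many places, and let $e_{a,b}$ act on it as
  $\sum_j x_{a,j} \partial_{b,j}$. The monomial $v$ in the variables $x_{i,j}$ with $(j,i)$ a cell of
  $\mu$ is a highest weight vector for $gl(n)$ of weight $\widetilde\mu$. It contains no virtual symbol,
  so it is killed by the irregular products, and $\mathfrak p(x) v = x v$.
  Modulo vectors of lower weight, an element of $U(gl(n))$ multiplies a highest weight vector by a scalar.
  Applied to the pair $(v, v_{\widetilde\mu})$ in the product of the two modules, this shows that an element
  that acts on $v$ by a scalar acts on $v_{\widetilde\mu}$ by the same scalar, since the given module is irreducible.

  The operators replacing place $k$ by an earlier place $j$ commute with the action of $gl(m_0|m_1+n)$ and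
  kill $v$, so they kill $f = e_{C^*,D^*} e_{D^*,C^*} e_{C^*,S} v$. If $f \ne 0$, some monomial of $f$ contains
  $x_{\alpha_i,j}$ only for $j \le i$, so the place content $\nu$ of its even part satisfies
  $\lambda_1+\dots+\lambda_r \le \nu_1+\dots+\nu_r$ for all $r$. The opposite inequalities hold because $f$ comes from
  a polynomial with odd variables $x_{\beta_j,\cdot}$, each of which occurs at most once. Therefore
  $\lambda = \nu$, and $\nu_j \le \mu_j$.

  If $\mu = \lambda$, then by weights only the tableau $S$ whose columns are constant contributes. Reading the
  cells column by column, one removes one pair $e_{b_k,\alpha_i} e_{\alpha_i,b_k}$ at a time: $e_{b_k,\alpha_i}$ kills the
  vector on its right, so the pair acts as $e_{b_k,b_k} + e_{\alpha_i,\alpha_i}$, which is the hook length of the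
  cell $(i,k)$. This happens once for $b_k = k$ and once for $b_k = \beta_k$, each time with the same sign.
\<close>

section \<open>The enveloping algebra and its representations\<close>

text \<open>The given module carries no virtual operators, so virtual products cannot be evaluated
  on it; the Fock space supplies them on a vector of the same weight. \<open>virt_proj\<close>
  selects its value by \<open>SOME\<close>, so the proof relies on two facts: a word of weight zero
  in every virtual symbol has some component in U(gl(n)), found by straightening, and every
  admissible choice acts on the highest weight monomial as the word itself. To compare the two
  modules, one grading operator, the sum of all \<open>i e_{i,i}\<close>, separates the highest
  weight line: each lowering letter adds a positive integer to its eigenvalue. The second hook
  product meets an obstacle: the beta letters act on a vector made from proper symbols. The remedy
  is a twin of the monomial, with each column symbol \<open>k\<close> turned into
  \<open>beta_k\<close>. Raising the betas of the twin to alphas gives a nonzero multiple of the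
  vector obtained by raising the proper symbols, so the eigenvalue found on the twin can be used.
  The two hook products and the factor \<open>1 / H\<close> then leave one \<open>H\<close>.\<close>

abbreviation words_over :: "sym set \<Rightarrow> free_alg set" where
  "words_over A \<equiv> carrier (free_ring A)"

abbreviation word_poly :: "(sym \<times> sym) list \<Rightarrow> free_alg" where
  "word_poly w \<equiv> Poly_Mapping.single (Word w) 1"

lemma words_over_iff:
  "p \<in> words_over A \<longleftrightarrow> (\<forall>w\<in>Poly_Mapping.keys p. set (letters w) \<subseteq> A \<times> A)"
  by (simp add: free_ring_def)

lemma free_ring_simps [simp]:
  "p \<otimes>\<^bsub>free_ring A\<^esub> q = p * q" "p \<oplus>\<^bsub>free_ring A\<^esub> q = p + q"
  "\<one>\<^bsub>free_ring A\<^esub> = 1" "\<zero>\<^bsub>free_ring A\<^esub> = 0"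
  by (simp_all add: free_ring_def)

lemma letters_plus [simp]: "letters (u + v) = letters u @ letters v"
  by (simp add: plus_word_def)

lemma letters_zero [simp]: "letters 0 = []"
  by (simp add: zero_word_def)

lemma words_over_mono: "A \<subseteq> B \<Longrightarrow> words_over A \<subseteq> words_over B"
  unfolding words_over_iff subset_iff by blast

lemma words_over_zero [simp]: "0 \<in> words_over A"
  by (simp add: words_over_iff)

lemma words_over_single:
  "set (letters w) \<subseteq> A \<times> A \<Longrightarrow> Poly_Mapping.single w c \<in> words_over A"
  by (simp add: words_over_iff)

lemma words_over_one [simp]: "1 \<in> words_over A"
  using words_over_single[of 0 A 1] by simp

lemma words_over_add: "p \<in> words_over A \<Longrightarrow> q \<in> words_over A \<Longrightarrow> p + q \<in> words_over A"
  using Poly_Mapping.keys_add[of p q] unfolding words_over_iff by blast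

lemma words_over_uminus: "p \<in> words_over A \<Longrightarrow> - p \<in> words_over A"
  unfolding words_over_iff by simp

lemma words_over_diff: "p \<in> words_over A \<Longrightarrow> q \<in> words_over A \<Longrightarrow> p - q \<in> words_over A"
  using words_over_add[of p A "- q"] words_over_uminus[of q A] by simp

lemma words_over_mult:
  assumes "p \<in> words_over A" "q \<in> words_over A"
  shows "p * q \<in> words_over A"
  unfolding words_over_iff
proof
  fix w assume "w \<in> Poly_Mapping.keys (p * q)"
  then obtain u v where "w = u + v" "u \<in> Poly_Mapping.keys p" "v \<in> Poly_Mapping.keys q"
    using keys_mult[of p q] by blast
  then show "set (letters w) \<subseteq> A \<times> A"
    using assms unfolding words_over_iff by auto
qed

lemma ring_free_ring: "ring (free_ring A)"
proof (rule ringI)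
  show "abelian_group (free_ring A)"
  proof (rule abelian_groupI)
    fix x assume "x \<in> words_over A"
    then show "\<exists>y\<in>words_over A. y \<oplus>\<^bsub>free_ring A\<^esub> x = \<zero>\<^bsub>free_ring A\<^esub>"
      by (intro bexI[of _ "- x"]) (auto intro: words_over_uminus)
  qed (auto intro: words_over_add simp: algebra_simps)
  show "Group.monoid (free_ring A)"
    by (rule monoidI) (auto intro: words_over_mult simp: algebra_simps)
qed (auto simp: algebra_simps)

lemma free_ring_minus: 
  assumes "p \<in> words_over A" shows "\<ominus>\<^bsub>free_ring A\<^esub> p = - p"
proof -
  interpret ring "free_ring A" by (rule ring_free_ring)
  show ?thesis
    using minus_equality[of "- p" p] assms by (auto intro: words_over_uminus)
qed

lemma gl_sign_single: "gl_sign a b c d = Poly_Mapping.single 0 ((-1) ^ ((parity a + parity b) * (parity c + parity d)))"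
  unfolding gl_sign_def minus_one_power_iff by (simp add: single_uminus)

lemma words_over_gl_sign [simp]: "gl_sign a b c d \<in> words_over A"
  unfolding gl_sign_single by (rule words_over_single) simp

lemma words_over_gen: "a \<in> A \<Longrightarrow> b \<in> A \<Longrightarrow> gen a b \<in> words_over A"
  unfolding gen_def by (rule words_over_single) simp

lemma gl_relations_words_over: "gl_relations A \<subseteq> words_over A"
  unfolding gl_relations_def gl_bracket_def
  by (auto simp del: diff_diff_eq2 diff_minus_eq_add
      intro!: words_over_diff words_over_uminus words_over_mult words_over_gen)

lemma env_ideal_ideal: "ideal (env_ideal A) (free_ring A)"
  unfolding env_ideal_def by (rule ring.genideal_ideal[OF ring_free_ring gl_relations_words_over])

lemma ring_env: "ring (env A)"
  unfolding env_def by (rule ideal.quotient_is_ring[OF env_ideal_ideal])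

definition coset :: "sym set \<Rightarrow> free_alg \<Rightarrow> free_alg set" where
  "coset A p = env_ideal A +>\<^bsub>free_ring A\<^esub> p"

lemma coset_ring_hom: "ring_hom_ring (free_ring A) (env A) (coset A)"
  using ideal.rcos_ring_hom_ring[OF env_ideal_ideal, of A] unfolding env_def coset_def by (simp add: fun_eq_iff)

lemma carrier_env_coset:
  assumes "X \<in> carrier (env A)"
  obtains p where "p \<in> words_over A" "X = coset A p"
  using assms unfolding env_def coset_def FactRing_def A_RCOSETS_defs a_r_coset_def
  by auto

lemma coset_carrier: "p \<in> words_over A \<Longrightarrow> coset A p \<in> carrier (env A)"
  using ring_hom_ring.homh[OF coset_ring_hom] by (rule ring_hom_closed)

lemma coset_add: "p \<in> words_over A \<Longrightarrow> q \<in> words_over A \<Longrightarrow> coset A p \<oplus>\<^bsub>env A\<^esub> coset A q = coset A (p + q)"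
  using ring_hom_add[OF ring_hom_ring.homh[OF coset_ring_hom], of p A q] by simp

lemma coset_mult: "p \<in> words_over A \<Longrightarrow> q \<in> words_over A \<Longrightarrow> coset A p \<otimes>\<^bsub>env A\<^esub> coset A q = coset A (p * q)"
  using ring_hom_mult[OF ring_hom_ring.homh[OF coset_ring_hom], of p A q] by simp

lemma coset_zero: "coset A 0 = \<zero>\<^bsub>env A\<^esub>"
  using ring_hom_zero[OF ring_hom_ring.homh[OF coset_ring_hom] ring_free_ring ring_env] by simp

lemma coset_diff:
  assumes "p \<in> words_over A" "q \<in> words_over A"
  shows "coset A p \<ominus>\<^bsub>env A\<^esub> coset A q = coset A (p - q)"
proof -
  interpret hom: ring_hom_ring "free_ring A" "env A" "coset A" by (rule coset_ring_hom)
  show ?thesis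
    using assms coset_add[of p A "- q"] hom.hom_a_inv[of q]
    by (simp add: a_minus_def free_ring_minus words_over_uminus)
qed

lemma mem_coset: "q \<in> coset A p \<longleftrightarrow> (\<exists>i\<in>env_ideal A. q = i + p)"
  unfolding coset_def a_r_coset_def r_coset_def by simp

lemma coset_self: "p \<in> coset A p"
proof -
  have "0 \<in> env_ideal A"
    using additive_subgroup.zero_closed[OF ideal.axioms(1)[OF env_ideal_ideal], of A] by simp
  then show ?thesis unfolding mem_coset by force
qed

lemma coset_eqI:
  assumes "p \<in> words_over A" "q \<in> words_over A" "p - q \<in> env_ideal A"
  shows "coset A p = coset A q"
proof -
  have "p \<in> coset A q" unfolding mem_coset using assms(3) by force
  then show ?thesis
    using abelian_subgroup.a_repr_independence'[of "env_ideal A" "free_ring A" p q] assms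
    unfolding coset_def
    using ideal.axioms(1)[OF env_ideal_ideal] ring_free_ring
    by (metis abelian_subgroupI3 ring.is_abelian_group)
qed

lemma gl_relation_in_env_ideal:
  assumes "a \<in> A" "b \<in> A" "c \<in> A" "d \<in> A"
  shows "gen a b * gen c d - gl_sign a b c d * (gen c d * gen a b) - gl_bracket a b c d \<in> env_ideal A"
  using ring.genideal_self[OF ring_free_ring gl_relations_words_over, of A] assms
  unfolding env_ideal_def gl_relations_def by blast

lemma word_poly_mult: "word_poly u * word_poly v = word_poly (u @ v)"
  by (simp add: mult_single plus_word_def)

lemma poly_mapping_sum_singles: "(p :: free_alg) = (\<Sum>w\<in>Poly_Mapping.keys p. Poly_Mapping.single w (Poly_Mapping.lookup p w))"
  by (rule poly_mapping_eqI) (auto simp: lookup_sum lookup_single when_def in_keys_iff)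

section \<open>Words, polynomials and cosets acting on a module\<close>

definition word_act :: "(sym \<Rightarrow> sym \<Rightarrow> 'v \<Rightarrow> 'v) \<Rightarrow> (sym \<times> sym) list \<Rightarrow> 'v \<Rightarrow> 'v" where
  "word_act E w = foldr (\<lambda>(a, b). E a b) w"

lemma word_act_simps [simp]:
  "word_act E [] v = v" "word_act E ((a, b) # w) v = E a b (word_act E w v)"
  "word_act E (u @ w) v = word_act E u (word_act E w v)"
  by (simp_all add: word_act_def)

definition poly_act ::
  "(complex \<Rightarrow> 'v \<Rightarrow> 'v) \<Rightarrow> (sym \<Rightarrow> sym \<Rightarrow> 'v \<Rightarrow> 'v::ab_group_add) \<Rightarrow> free_alg \<Rightarrow> 'v \<Rightarrow> 'v" where
  "poly_act scale E p v =
     (\<Sum>w\<in>Poly_Mapping.keys p. scale (Poly_Mapping.lookup p w) (word_act E (letters w) v))"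

text \<open>The same recipe as \<open>U_action\<close>, with operators indexed by symbols instead of
  numbers, so that virtual letters can act too.\<close>

definition env_act ::
  "(complex \<Rightarrow> 'v \<Rightarrow> 'v) \<Rightarrow> (sym \<Rightarrow> sym \<Rightarrow> 'v \<Rightarrow> 'v::ab_group_add) \<Rightarrow> free_alg set \<Rightarrow> 'v \<Rightarrow> 'v" where
  "env_act scale E X v = the_elem ((\<lambda>p. poly_act scale E p v) ` X)"

lemma U_action_env_act: "U_action scale \<rho> = env_act scale (\<lambda>a b. \<rho> (index a) (index b))"
  unfolding U_action_def env_act_def free_action_def poly_act_def word_act_def fun_eq_iff by simp

definition sgn_gl :: "sym \<Rightarrow> sym \<Rightarrow> sym \<Rightarrow> sym \<Rightarrow> complex" where
  "sgn_gl a b c d = (-1) ^ ((parity a + parity b) * (parity c + parity d))"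

text \<open>\<open>E_rel\<close> is the superbracket relation solved for the left product. The
  symbol set is a parameter because one Fock space serves as a module for the proper symbols, for
  \<open>symbols m0 m1 n\<close> and for all symbols.\<close>

locale gl_rep = vector_space scale
  for scale :: "complex \<Rightarrow> 'v::ab_group_add \<Rightarrow> 'v" +
  fixes A :: "sym set" and E :: "sym \<Rightarrow> sym \<Rightarrow> 'v \<Rightarrow> 'v"
  assumes E_add: "a \<in> A \<Longrightarrow> b \<in> A \<Longrightarrow> E a b (x + y) = E a b x + E a b y"
    and E_scale: "a \<in> A \<Longrightarrow> b \<in> A \<Longrightarrow> E a b (scale k x) = scale k (E a b x)"
    and E_rel: "a \<in> A \<Longrightarrow> b \<in> A \<Longrightarrow> c \<in> A \<Longrightarrow> d \<in> A \<Longrightarrow>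
      E a b (E c d x) = scale (sgn_gl a b c d) (E c d (E a b x))
        + (if b = c then E a d x else 0) - scale (sgn_gl a b c d) (if a = d then E c b x else 0)"
begin

lemma E_zero [simp]: "a \<in> A \<Longrightarrow> b \<in> A \<Longrightarrow> E a b 0 = 0"
  using E_scale[of a b 0 0] by simp

lemma word_act_add: "set w \<subseteq> A \<times> A \<Longrightarrow> word_act E w (x + y) = word_act E w x + word_act E w y"
  by (induction w) (auto simp: E_add)

lemma word_act_scale: "set w \<subseteq> A \<times> A \<Longrightarrow> word_act E w (scale k x) = scale k (word_act E w x)"
  by (induction w) (auto simp: E_scale)

lemma word_act_zero: "set w \<subseteq> A \<times> A \<Longrightarrow> word_act E w 0 = 0"
  using word_act_scale[of w 0 0] by simp

lemma poly_act_superset: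
  assumes "finite K" "Poly_Mapping.keys p \<subseteq> K"
  shows "poly_act scale E p v = (\<Sum>w\<in>K. scale (Poly_Mapping.lookup p w) (word_act E (letters w) v))"
  unfolding poly_act_def using assms
  by (intro sum.mono_neutral_left) (auto simp: in_keys_iff)

lemma poly_act_0 [simp]: "poly_act scale E 0 v = 0"
  by (simp add: poly_act_def)

lemma poly_act_add: "poly_act scale E (p + q) v = poly_act scale E p v + poly_act scale E q v"
  using poly_act_superset[of "Poly_Mapping.keys p \<union> Poly_Mapping.keys q" p v]
    poly_act_superset[of "Poly_Mapping.keys p \<union> Poly_Mapping.keys q" q v]
    poly_act_superset[of "Poly_Mapping.keys p \<union> Poly_Mapping.keys q" "p + q" v]
    Poly_Mapping.keys_add[of p q]
  by (simp add: lookup_add scale_left_distrib sum.distrib)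

lemma poly_act_uminus: "poly_act scale E (- p) v = - poly_act scale E p v"
  using poly_act_add[of p "- p" v] by (simp add: eq_neg_iff_add_eq_0 add.commute)

lemma poly_act_diff: "poly_act scale E (p - q) v = poly_act scale E p v - poly_act scale E q v"
  using poly_act_add[of p "- q" v] by (simp add: poly_act_uminus)

lemma poly_act_sum: "poly_act scale E (sum f I) v = (\<Sum>i\<in>I. poly_act scale E (f i) v)"
  by (induction I rule: infinite_finite_induct) (auto simp: poly_act_add)

lemma poly_act_single:
  "poly_act scale E (Poly_Mapping.single w k) v = scale k (word_act E (letters w) v)"
  by (simp add: poly_act_def)

lemma poly_act_add_right:
  "p \<in> words_over A \<Longrightarrow> poly_act scale E p (x + y) = poly_act scale E p x + poly_act scale E p y"
  unfolding poly_act_def words_over_iff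
  by (simp add: word_act_add scale_right_distrib sum.distrib)

lemma poly_act_scale_right:
  "p \<in> words_over A \<Longrightarrow> poly_act scale E p (scale k x) = scale k (poly_act scale E p x)"
  unfolding poly_act_def words_over_iff
  by (simp add: word_act_scale scale_sum_right mult.commute)

lemma poly_act_zero_right: "p \<in> words_over A \<Longrightarrow> poly_act scale E p 0 = 0"
  using poly_act_scale_right[of p 0 0] by simp

lemma poly_act_sum_right:
  "p \<in> words_over A \<Longrightarrow> poly_act scale E p (sum f I) = (\<Sum>i\<in>I. poly_act scale E p (f i))"
  by (induction I rule: infinite_finite_induct) (auto simp: poly_act_add_right poly_act_zero_right)

lemma poly_act_mult:
  assumes "p \<in> words_over A" "q \<in> words_over A"
  shows "poly_act scale E (p * q) v = poly_act scale E p (poly_act scale E q v)"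
proof -
  have "poly_act scale E (Poly_Mapping.single u c * Poly_Mapping.single w k) v =
      poly_act scale E (Poly_Mapping.single u c) (poly_act scale E (Poly_Mapping.single w k) v)"
    if "set (letters u) \<subseteq> A \<times> A" for u w c k
    using that by (simp add: mult_single poly_act_single word_act_scale)
  then have 1: "poly_act scale E (Poly_Mapping.single u c * q) v =
      poly_act scale E (Poly_Mapping.single u c) (poly_act scale E q v)"
    if "set (letters u) \<subseteq> A \<times> A" for u c
    using that words_over_single[OF that, of c]
    by (subst (1 2) poly_mapping_sum_singles[of q])
      (simp add: sum_distrib_left poly_act_sum poly_act_sum_right)
  have "poly_act scale E (p * q) v = (\<Sum>w\<in>Poly_Mapping.keys p. poly_act scale E (Poly_Mapping.single w (Poly_Mapping.lookup p w)) (poly_act scale E q v))"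
    using assms(1) 1 unfolding words_over_iff
    by (subst poly_mapping_sum_singles[of p]) (simp add: sum_distrib_right poly_act_sum)
  also have "\<dots> = poly_act scale E p (poly_act scale E q v)"
    by (subst (3) poly_mapping_sum_singles[of p]) (simp add: poly_act_sum)
  finally show ?thesis .
qed

lemma poly_act_gen: "poly_act scale E (gen a b) v = E a b v"
  by (simp add: gen_def poly_act_single)

lemma poly_act_gl_sign: "poly_act scale E (gl_sign a b c d) v = scale (sgn_gl a b c d) v"
  by (simp add: gl_sign_single poly_act_single sgn_gl_def)

lemma poly_act_gl_relations:
  assumes "r \<in> gl_relations A"
  shows "poly_act scale E r v = 0"
proof -
  obtain a b c d where r: "r = gen a b * gen c d - gl_sign a b c d * (gen c d * gen a b) - gl_bracket a b c d"
    and abcd: "a \<in> A" "b \<in> A" "c \<in> A" "d \<in> A"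
    using assms unfolding gl_relations_def by blast
  show ?thesis
    using abcd unfolding r gl_bracket_def
    by (simp add: poly_act_diff poly_act_mult words_over_gen words_over_mult poly_act_gen
        poly_act_gl_sign E_rel[of a b c d])
qed

text \<open>The polynomials that annihilate every vector form a two-sided ideal containing the
  relations. Quantifying over all vectors is what gives closure under multiplication on the
  right.\<close>

lemma poly_act_env_ideal:
  assumes "r \<in> env_ideal A"
  shows "poly_act scale E r v = 0"
proof -
  let ?I = "{p \<in> words_over A. \<forall>v. poly_act scale E p v = 0}"
  have "ideal ?I (free_ring A)"
  proof (rule idealI[OF ring_free_ring])
    show "subgroup ?I (add_monoid (free_ring A))"
    proof
      fix x assume "x \<in> ?I"
      then show "inv\<^bsub>add_monoid (free_ring A)\<^esub> x \<in> ?I"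
        using free_ring_minus[of x A] words_over_uminus[of x A]
        unfolding a_inv_def by (auto simp: poly_act_uminus)
    qed (auto simp: poly_act_add intro: words_over_add)
  qed (auto simp: poly_act_mult poly_act_zero_right intro: words_over_mult)
  then have "env_ideal A \<subseteq> ?I"
    unfolding env_ideal_def using gl_relations_words_over poly_act_gl_relations
    by (intro ring.genideal_minimal[OF ring_free_ring]) auto
  then show ?thesis using assms by blast
qed

lemma poly_act_coset: "q \<in> coset A p \<Longrightarrow> poly_act scale E q v = poly_act scale E p v"
  unfolding mem_coset by (auto simp: poly_act_add poly_act_env_ideal)

text \<open>All representatives act alike, so \<open>the_elem\<close> meets a singleton. Every later
  computation with cosets passes through this equation.\<close>

lemma env_act_coset: "env_act scale E (coset A p) v = poly_act scale E p v"
proof -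
  have "(\<lambda>q. poly_act scale E q v) ` coset A p = {poly_act scale E p v}"
  proof (intro equalityI subsetI)
    fix x assume "x \<in> (\<lambda>q. poly_act scale E q v) ` coset A p"
    then obtain q where "q \<in> coset A p" "x = poly_act scale E q v" by blast
    then show "x \<in> {poly_act scale E p v}" using poly_act_coset by blast
  next
    fix x assume "x \<in> {poly_act scale E p v}"
    then show "x \<in> (\<lambda>q. poly_act scale E q v) ` coset A p"
      using coset_self by blast
  qed
  then show ?thesis unfolding env_act_def by simp
qed

lemma env_act_add:
  assumes "X \<in> carrier (env A)" "Y \<in> carrier (env A)"
  shows "env_act scale E (X \<oplus>\<^bsub>env A\<^esub> Y) v = env_act scale E X v + env_act scale E Y v"
proof -
  obtain p q where "p \<in> words_over A" "X = coset A p" "q \<in> words_over A" "Y = coset A q"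
    using assms carrier_env_coset by metis
  then show ?thesis by (simp add: coset_add env_act_coset poly_act_add)
qed

lemma env_act_mult:
  assumes "X \<in> carrier (env A)" "Y \<in> carrier (env A)"
  shows "env_act scale E (X \<otimes>\<^bsub>env A\<^esub> Y) v = env_act scale E X (env_act scale E Y v)"
proof -
  obtain p q where "p \<in> words_over A" "X = coset A p" "q \<in> words_over A" "Y = coset A q"
    using assms carrier_env_coset by metis
  then show ?thesis by (simp add: coset_mult env_act_coset poly_act_mult)
qed

lemma env_act_finsum:
  assumes "finite I" "\<And>i. i \<in> I \<Longrightarrow> f i \<in> carrier (env A)"
  shows "env_act scale E (finsum (env A) f I) v = (\<Sum>i\<in>I. env_act scale E (f i) v)"
  using assms
proof (induction I rule: finite_induct)
  case empty
  have "env_act scale E \<zero>\<^bsub>env A\<^esub> v = 0"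
    using env_act_coset[of 0 v] by (simp add: coset_zero)
  then show ?case
    by (simp add: abelian_monoid.finsum_empty[OF abelian_group.axioms(1)[OF ring.is_abelian_group[OF ring_env]]])
next
  case (insert i I)
  note mon = abelian_group.axioms(1)[OF ring.is_abelian_group[OF ring_env[of A]]]
  have "finsum (env A) f (insert i I) = f i \<oplus>\<^bsub>env A\<^esub> finsum (env A) f I"
    using insert by (intro abelian_monoid.finsum_insert[OF mon]) auto
  moreover have "finsum (env A) f I \<in> carrier (env A)"
    using insert by (intro abelian_monoid.finsum_closed[OF mon]) auto
  ultimately show ?case using insert by (simp add: env_act_add)
qed

end


section \<open>Elements of weight zero modulo irregular products\<close>

text \<open>The eigenvalue of the adjoint action of \<open>e_{g,g}\<close> on the word: creations of
  \<open>g\<close> minus annihilations of \<open>g\<close>.\<close>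

definition wt :: "(sym \<times> sym) list \<Rightarrow> sym \<Rightarrow> int" where
  "wt w g = (\<Sum>x\<leftarrow>w. of_bool (fst x = g) - of_bool (snd x = g))"

lemma wt_Nil [simp]: "wt [] g = 0"
  and wt_Cons [simp]: "wt (x # w) g = of_bool (fst x = g) - of_bool (snd x = g) + wt w g"
  and wt_append [simp]: "wt (u @ w) g = wt u g + wt w g"
  by (simp_all add: wt_def)

lemma wt_nonneg: "(\<And>x. x \<in> set w \<Longrightarrow> snd x \<noteq> g) \<Longrightarrow> 0 \<le> wt w g"
  by (induction w) auto

lemma wt_zero_fst: "(\<And>x. x \<in> set w \<Longrightarrow> snd x \<noteq> g) \<Longrightarrow> wt w g = 0 \<Longrightarrow> x \<in> set w \<Longrightarrow> fst x \<noteq> g"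
proof (induction w)
  case (Cons y w)
  then have "0 \<le> wt w g" by (intro wt_nonneg) auto
  with Cons.prems have "wt w g = 0" "fst y \<noteq> g"
    by (auto simp: of_bool_def split: if_splits)
  with Cons show ?case by auto
qed simp

lemma proper_subset_symbols: "proper_symbols n \<subseteq> symbols m0 m1 n"
  by (auto simp: symbols_def)

lemma virtual_iff_not_proper: "a \<in> symbols m0 m1 n \<Longrightarrow> virtual a \<longleftrightarrow> a \<notin> proper_symbols n"
  by (auto simp: symbols_def proper_symbols_def)

lemma env_monomial_coset: "env_monomial A w = coset A (word_poly w)"
  by (simp add: env_monomial_def coset_def)

lemma env_scalar_coset: "env_scalar A c = coset A (Poly_Mapping.single 0 c)"
  by (simp add: env_scalar_def coset_def)

text \<open>The larger ideal, intersected with the smaller free ring, is an ideal there and contains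
  the relations over \<open>A\<close>.\<close>

lemma env_ideal_mono:
  assumes "A \<subseteq> B"
  shows "env_ideal A \<subseteq> env_ideal B"
proof -
  interpret I: ideal "env_ideal B" "free_ring B" by (rule env_ideal_ideal)
  let ?I = "words_over A \<inter> env_ideal B"
  have sub: "words_over A \<subseteq> words_over B" by (rule words_over_mono[OF assms])
  have "ideal ?I (free_ring A)"
  proof (rule idealI[OF ring_free_ring])
    show "subgroup ?I (add_monoid (free_ring A))"
    proof
      fix x assume x: "x \<in> ?I"
      then have "- x \<in> ?I"
        using I.I_l_closed[of x "- 1"] words_over_uminus[of 1 B] by (auto intro: words_over_uminus)
      then show "inv\<^bsub>add_monoid (free_ring A)\<^esub> x \<in> ?I"
        using free_ring_minus[of x A] x unfolding a_inv_def by auto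
    next
      fix x y assume "x \<in> ?I" "y \<in> ?I"
      then show "x \<otimes>\<^bsub>add_monoid (free_ring A)\<^esub> y \<in> ?I"
        using I.add.m_closed additive_subgroup.a_closed[OF I.is_additive_subgroup, of x y] by (auto intro: words_over_add)
    next
      show "\<one>\<^bsub>add_monoid (free_ring A)\<^esub> \<in> ?I"
        using additive_subgroup.zero_closed[OF I.is_additive_subgroup] by simp
    qed auto
  next
    fix a x assume "a \<in> ?I" "x \<in> words_over A"
    then show "x \<otimes>\<^bsub>free_ring A\<^esub> a \<in> ?I" "a \<otimes>\<^bsub>free_ring A\<^esub> x \<in> ?I"
      using I.I_l_closed[of a x] I.I_r_closed[of a x] sub by (auto intro: words_over_mult)
  qed
  moreover have "gl_relations A \<subseteq> ?I"
  proof
    fix x assume x: "x \<in> gl_relations A"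
    then obtain a b c d where "a \<in> A" "b \<in> A" "c \<in> A" "d \<in> A"
      "x = gen a b * gen c d - gl_sign a b c d * (gen c d * gen a b) - gl_bracket a b c d"
      unfolding gl_relations_def by blast
    then have "x \<in> env_ideal B"
      using gl_relation_in_env_ideal[of a B b c d] assms by auto
    then show "x \<in> ?I" using x gl_relations_words_over by blast
  qed
  ultimately have "env_ideal A \<subseteq> ?I"
    unfolding env_ideal_def[of A] by (intro ring.genideal_minimal[OF ring_free_ring]) auto
  then show ?thesis by blast
qed

text \<open>The smaller ideal is absorbed by the larger one, so the canonical map keeps
  representatives.\<close>

lemma env_incl_coset:
  "env_incl m0 m1 n (coset (proper_symbols n) r) = coset (symbols m0 m1 n) r"
proof -
  let ?A = "symbols m0 m1 n" and ?B = "proper_symbols n"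
  interpret I: ideal "env_ideal ?A" "free_ring ?A" by (rule env_ideal_ideal)
  have sub: "env_ideal ?B \<subseteq> env_ideal ?A"
    by (rule env_ideal_mono[OF proper_subset_symbols])
  have "x \<in> env_incl m0 m1 n (coset ?B r) \<longleftrightarrow> (\<exists>i\<in>env_ideal ?A. \<exists>q\<in>coset ?B r. x = i + q)" for x
    unfolding env_incl_def set_add_def set_mult_def by auto
  then have "x \<in> env_incl m0 m1 n (coset ?B r) \<longleftrightarrow> (\<exists>i\<in>env_ideal ?A. \<exists>j\<in>env_ideal ?B. x = i + (j + r))" for x
    unfolding Bex_def mem_coset by blast
  moreover have "(\<exists>i\<in>env_ideal ?A. \<exists>j\<in>env_ideal ?B. x = i + (j + r)) \<longleftrightarrow> (\<exists>i\<in>env_ideal ?A. x = i + r)" for x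
  proof
    assume "\<exists>i\<in>env_ideal ?A. \<exists>j\<in>env_ideal ?B. x = i + (j + r)"
    then obtain i j where "i \<in> env_ideal ?A" "j \<in> env_ideal ?B" "x = i + (j + r)" by blast
    then show "\<exists>i\<in>env_ideal ?A. x = i + r"
      using additive_subgroup.a_closed[OF I.is_additive_subgroup, of i j] sub by (intro bexI[of _ "i + j"]) (auto simp: add.assoc)
  next
    assume "\<exists>i\<in>env_ideal ?A. x = i + r"
    moreover have "0 \<in> env_ideal ?B"
      using additive_subgroup.zero_closed[OF ideal.axioms(1)[OF env_ideal_ideal], of ?B] by simp
    ultimately show "\<exists>i\<in>env_ideal ?A. \<exists>j\<in>env_ideal ?B. x = i + (j + r)" by force
  qed
  ultimately show ?thesis by (auto simp: mem_coset)
qed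

section \<open>The left ideal Irr, lifted to the free algebra, and straightening modulo it\<close>

definition irr_polys :: "nat \<Rightarrow> nat \<Rightarrow> nat \<Rightarrow> free_alg set" where
  "irr_polys m0 m1 n = {p \<in> words_over (symbols m0 m1 n). coset (symbols m0 m1 n) p \<in> Irr m0 m1 n}"

context
  fixes m0 m1 n :: nat and A B :: "sym set" and L :: "free_alg set"
  defines "A \<equiv> symbols m0 m1 n" and "B \<equiv> proper_symbols n" and "L \<equiv> irr_polys m0 m1 n"
begin

lemma proper_subset: "B \<subseteq> A"
  unfolding A_def B_def by (rule proper_subset_symbols)

lemma irr_polys_words: "p \<in> L \<Longrightarrow> p \<in> words_over A"
  by (simp add: L_def A_def irr_polys_def)

lemma irr_polys_iff: "p \<in> words_over A \<Longrightarrow>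
    p \<in> L \<longleftrightarrow> (\<forall>I. additive_subgroup I (env A) \<and> (\<forall>x\<in>carrier (env A). \<forall>a\<in>I. x \<otimes>\<^bsub>env A\<^esub> a \<in> I)
      \<and> {env_monomial A w |w. set w \<subseteq> A \<times> A \<and> irregular w} \<subseteq> I \<longrightarrow> coset A p \<in> I)"
  unfolding L_def irr_polys_def Irr_def left_ideal_gen_def A_def[symmetric] by blast

lemma irr_polys_add:
  assumes "p \<in> L" "q \<in> L"
  shows "p + q \<in> L"
proof -
  note w = irr_polys_words[OF assms(1)] irr_polys_words[OF assms(2)]
  show ?thesis
    using assms unfolding irr_polys_iff[OF w(1)] irr_polys_iff[OF w(2)] irr_polys_iff[OF words_over_add[OF w]] coset_add[OF w, symmetric]
    by (meson additive_subgroup.a_closed)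
qed

lemma irr_polys_mult:
  assumes "x \<in> words_over A" "p \<in> L"
  shows "x * p \<in> L"
proof -
  note w = assms(1) irr_polys_words[OF assms(2)]
  show ?thesis
    using assms(2) coset_carrier[OF assms(1)]
    unfolding irr_polys_iff[OF w(2)] irr_polys_iff[OF words_over_mult[OF w]] coset_mult[OF w, symmetric]
    by blast
qed

lemma irr_polys_env: "p \<in> words_over A \<Longrightarrow> q \<in> L \<Longrightarrow> p - q \<in> env_ideal A \<Longrightarrow> p \<in> L"
  using irr_polys_words[of q] coset_eqI[of p A q] unfolding L_def irr_polys_def A_def by simp

lemma irr_polys_irregular:
  assumes "set w \<subseteq> A \<times> A" "irregular w"
  shows "word_poly w \<in> L"
proof -
  have "word_poly w \<in> words_over A" using assms by (intro words_over_single) simp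
  then show ?thesis
    using assms by (subst irr_polys_iff) (auto simp: env_monomial_coset)
qed

lemma irr_polys_zero: "0 \<in> L"
  unfolding irr_polys_iff[OF words_over_zero] using additive_subgroup.zero_closed by (auto simp: coset_zero)

text \<open>The only letter removes \<open>g\<close>, and nothing to its right has created
  it.\<close>

lemma irr_polys_virtual:
  assumes "c \<in> A" "g \<in> A" "virtual g"
  shows "gen c g \<in> L"
proof -
  have "irregular [(c, g)]"
    unfolding irregular_def using assms(3)
    by (intro exI[of _ 0] conjI exI[of _ g]) (auto simp: card_gt_0_iff)
  then show ?thesis using irr_polys_irregular[of "[(c, g)]"] assms unfolding gen_def by simp
qed

text \<open>A normal form modulo Irr: a virtual symbol may stand in the first place of a letter but
  not in the second. The weight is recorded so that weight zero can later exclude virtual symbols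
  from the first place as well.\<close>

definition straight :: "(sym \<Rightarrow> int) \<Rightarrow> free_alg \<Rightarrow> bool" where
  "straight \<theta> p \<longleftrightarrow> p \<in> words_over A \<and>
     (\<exists>r. p - r \<in> L \<and> (\<forall>w\<in>Poly_Mapping.keys r. set (letters w) \<subseteq> A \<times> B \<and> wt (letters w) = \<theta>))"

lemma straight_add: "straight \<theta> p \<Longrightarrow> straight \<theta> q \<Longrightarrow> straight \<theta> (p + q)"
proof -
  assume p: "straight \<theta> p" and q: "straight \<theta> q"
  obtain r where r: "p - r \<in> L" "\<And>w. w\<in>Poly_Mapping.keys r \<Longrightarrow> set (letters w) \<subseteq> A \<times> B \<and> wt (letters w) = \<theta>"
    using p unfolding straight_def by blast
  obtain s where s: "q - s \<in> L" "\<And>w. w\<in>Poly_Mapping.keys s \<Longrightarrow> set (letters w) \<subseteq> A \<times> B \<and> wt (letters w) = \<theta>"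
    using q unfolding straight_def by blast
  have "p + q - (r + s) \<in> L" using irr_polys_add[OF r(1) s(1)] by (simp add: algebra_simps)
  moreover have "w\<in>Poly_Mapping.keys (r + s) \<Longrightarrow> set (letters w) \<subseteq> A \<times> B \<and> wt (letters w) = \<theta>" for w
    using Poly_Mapping.keys_add[of r s] r(2) s(2) by blast
  ultimately show ?thesis using p q words_over_add unfolding straight_def by blast
qed

lemma straight_L: "p \<in> L \<Longrightarrow> straight \<theta> p"
  unfolding straight_def using irr_polys_words by (intro conjI exI[of _ 0]) auto

lemma straight_zero: "straight \<theta> 0"
  by (rule straight_L[OF irr_polys_zero])

lemma straight_sum: "(\<And>i. i \<in> I \<Longrightarrow> straight \<theta> (f i)) \<Longrightarrow> straight \<theta> (sum f I)"
  by (induction I rule: infinite_finite_induct) (auto intro: straight_add straight_zero)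

lemma straight_env: "p \<in> words_over A \<Longrightarrow> straight \<theta> q \<Longrightarrow> p - q \<in> env_ideal A \<Longrightarrow> straight \<theta> p"
proof -
  assume p: "p \<in> words_over A" and q: "straight \<theta> q" and pq: "p - q \<in> env_ideal A"
  obtain r where r: "q - r \<in> L" "\<And>w. w\<in>Poly_Mapping.keys r \<Longrightarrow> set (letters w) \<subseteq> A \<times> B \<and> wt (letters w) = \<theta>"
    using q unfolding straight_def by blast
  have "r \<in> words_over A" using r(2) proper_subset unfolding words_over_iff by blast
  then have "p - r \<in> L"
    using irr_polys_env[OF _ r(1), of "p - r"] p pq words_over_diff by simp
  then show ?thesis using p r(2) unfolding straight_def by blast
qed

lemma straight_word: "set w \<subseteq> A \<times> B \<Longrightarrow> straight (wt w) (Poly_Mapping.single (Word w) c)"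
  unfolding straight_def using proper_subset irr_polys_zero
  by (intro conjI exI[of _ "Poly_Mapping.single (Word w) c"] words_over_single) auto

text \<open>Irr is a left ideal, so \<open>x\<close> times the error term stays in it. What remains
  are products of one monomial of \<open>x\<close> with one normal word.\<close>

lemma straight_mult:
  assumes x: "x \<in> words_over A" and p: "straight \<theta> p"
    and w: "\<And>u w. u \<in> Poly_Mapping.keys x \<Longrightarrow> set w \<subseteq> A \<times> B \<Longrightarrow> wt w = \<theta> \<Longrightarrow> straight \<theta>' (Poly_Mapping.single u 1 * word_poly w)"
  shows "straight \<theta>' (x * p)"
proof -
  have S: "straight \<theta>' (Poly_Mapping.single 0 k * q)" if q: "straight \<theta>' q" for k q
  proof -
    obtain r where r: "q - r \<in> L" "\<And>w. w\<in>Poly_Mapping.keys r \<Longrightarrow> set (letters w) \<subseteq> A \<times> B \<and> wt (letters w) = \<theta>'"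
      using q unfolding straight_def by blast
    have k: "Poly_Mapping.single 0 k \<in> words_over A" by (rule words_over_single) simp
    have "Poly_Mapping.single 0 k * q - Poly_Mapping.single 0 k * r \<in> L"
      using irr_polys_mult[OF k r(1)] by (simp add: algebra_simps)
    moreover have "Poly_Mapping.keys (Poly_Mapping.single 0 k * r) \<subseteq> Poly_Mapping.keys r"
      using keys_mult[of "Poly_Mapping.single 0 k" r] by (auto split: if_splits)
    ultimately show ?thesis
      using r(2) k q words_over_mult unfolding straight_def by blast
  qed
  obtain r where r: "p - r \<in> L" "\<And>w. w\<in>Poly_Mapping.keys r \<Longrightarrow> set (letters w) \<subseteq> A \<times> B \<and> wt (letters w) = \<theta>"
    using p unfolding straight_def by blast
  have "straight \<theta>' (x * r)"
  proof -
    have "x * r = (\<Sum>u\<in>Poly_Mapping.keys x. \<Sum>v\<in>Poly_Mapping.keys r.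
        Poly_Mapping.single 0 (Poly_Mapping.lookup x u * Poly_Mapping.lookup r v) * (Poly_Mapping.single u 1 * Poly_Mapping.single v 1))"
      by (subst (1) poly_mapping_sum_singles[of x], subst (1) poly_mapping_sum_singles[of r])
        (simp add: sum_product mult_single)
    moreover have "straight \<theta>' (Poly_Mapping.single u 1 * Poly_Mapping.single v 1)"
      if "u \<in> Poly_Mapping.keys x" "v \<in> Poly_Mapping.keys r" for u v
      using w[OF that(1), of "letters v"] r(2)[OF that(2)] by simp
    ultimately show ?thesis by (auto intro!: straight_sum S)
  qed
  moreover have "straight \<theta>' (x * (p - r))"
    by (rule straight_L[OF irr_polys_mult[OF x r(1)]])
  ultimately have "straight \<theta>' (x * r + x * (p - r))" by (rule straight_add)
  then show ?thesis by (simp add: algebra_simps)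
qed

lemma straight_scalar: "straight \<theta> p \<Longrightarrow> straight \<theta> (Poly_Mapping.single 0 k * p)"
  by (rule straight_mult[OF words_over_single]) (auto split: if_splits dest: straight_word[of _ 1])

lemma straight_gen_proper:
  assumes "a \<in> A" "b \<in> B" "straight \<theta> p" "\<theta>' = (\<lambda>g. of_bool (a = g) - of_bool (b = g) + \<theta> g)"
  shows "straight \<theta>' (gen a b * p)"
proof (rule straight_mult[OF words_over_gen assms(3)])
  fix u w assume uw: "u \<in> Poly_Mapping.keys (gen a b)" "set w \<subseteq> A \<times> B" "wt w = \<theta>"
  then have "Poly_Mapping.single u 1 * word_poly w = word_poly ((a, b) # w)"
    by (auto simp: gen_def mult_single plus_word_def)
  moreover have "wt ((a, b) # w) = \<theta>'"
    using uw assms(4) by auto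
  ultimately show "straight \<theta>' (Poly_Mapping.single u 1 * word_poly w)"
    using straight_word[of "(a, b) # w" 1] assms(1,2) uw by simp
qed (use assms proper_subset in auto)

lemma word_poly_Cons: "word_poly ((a, b) # w) = gen a b * word_poly w"
  by (simp add: gen_def mult_single plus_word_def)

text \<open>The letter \<open>(c, d)\<close> is commuted to the right. The swapped term starts with
  a letter whose second symbol is proper, and the bracket terms are again one letter in front of a
  shorter word, hence the induction over all \<open>c\<close> and \<open>d\<close>. At the right end
  a letter with virtual \<open>d\<close> is irregular.\<close>

lemma straight_gen_word:
  assumes "c \<in> A" "d \<in> A" "set w \<subseteq> A \<times> B"
  shows "straight (wt ((c, d) # w)) (gen c d * word_poly w)"
  using assms
proof (induction w arbitrary: c d)
  case Nil
  show ?case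
  proof (cases "d \<in> B")
    case True
    then show ?thesis using straight_word[of "[(c, d)]" 1] Nil by (simp add: gen_def mult_single plus_word_def del: wt_Cons)
  next
    case False
    then have "virtual d" using Nil virtual_iff_not_proper unfolding A_def B_def by blast
    then have "gen c d \<in> L" using irr_polys_virtual Nil by blast
    then show ?thesis using straight_L by (simp flip: zero_word_def)
  qed
next
  case (Cons x w)
  obtain a b where x: "x = (a, b)" by force
  have ab: "a \<in> A" "b \<in> B" "b \<in> A" and w: "set w \<subseteq> A \<times> B" using Cons.prems x proper_subset by auto
  have "set w \<subseteq> A \<times> A" using w proper_subset by auto
  then have mw: "word_poly w \<in> words_over A" by (intro words_over_single) simp
  let ?\<theta> = "wt ((c, d) # x # w)"
  let ?s = "gl_sign c d a b"
  let ?q = "?s * (gen a b * (gen c d * word_poly w)) + gl_bracket c d a b * word_poly w"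
  have s: "?s = Poly_Mapping.single 0 ((-1) ^ ((parity c + parity d) * (parity a + parity b)))"
    by (rule gl_sign_single)
  have 1: "straight ?\<theta> (?s * (gen a b * (gen c d * word_poly w)))"
    unfolding s
    by (rule straight_scalar, rule straight_gen_proper[OF ab(1,2) Cons.IH[OF Cons.prems(1,2) w]]) (auto simp: x)
  have 2: "straight ?\<theta> ((if d = a then gen c b else 0) * word_poly w)"
  proof (cases "d = a")
    case True
    have "wt ((c, b) # w) = ?\<theta>" using True x by auto
    then show ?thesis using True Cons.IH[OF Cons.prems(1) ab(3) w] by (simp del: wt_Cons)
  qed (simp add: straight_zero)
  have 3: "straight ?\<theta> (?s * ((if c = b then gen a d else 0) * word_poly w))"
  proof (cases "c = b")
    case True
    have "wt ((a, d) # w) = ?\<theta>" using True x by auto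
    then show ?thesis using True Cons.IH[OF ab(1) Cons.prems(2) w] s straight_scalar by (simp del: wt_Cons)
  qed (simp add: straight_zero)
  have 4: "straight ?\<theta> (- (?s * ((if c = b then gen a d else 0) * word_poly w)))"
    using straight_scalar[OF 3, of "-1"] by (simp add: single_uminus)
  have "?q = ?s * (gen a b * (gen c d * word_poly w)) + ((if d = a then gen c b else 0) * word_poly w
      + - (?s * ((if c = b then gen a d else 0) * word_poly w)))"
    unfolding gl_bracket_def by (simp add: algebra_simps)
  then have q: "straight ?\<theta> ?q"
    using straight_add[OF 1 straight_add[OF 2 4]] by simp
  have "(gen c d * gen a b - ?s * (gen a b * gen c d) - gl_bracket c d a b) * word_poly w \<in> env_ideal A"
    using ideal.I_r_closed[OF env_ideal_ideal gl_relation_in_env_ideal[OF Cons.prems(1,2) ab(1,3)] mw] by simp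
  then have "gen c d * word_poly (x # w) - ?q \<in> env_ideal A"
    unfolding x word_poly_Cons by (simp add: algebra_simps)
  then show ?case
    using straight_env[OF _ q] ab Cons.prems mw x
    by (simp add: word_poly_Cons words_over_mult words_over_gen del: wt_Cons)
qed

lemma straight_mono:
  assumes "set w \<subseteq> A \<times> A"
  shows "straight (wt w) (word_poly w)"
  using assms
proof (induction w)
  case Nil
  then show ?case using straight_word[of "[]" 1] by (simp del: wt_Nil)
next
  case (Cons x w)
  obtain c d where x: "x = (c, d)" by force
  have cd: "c \<in> A" "d \<in> A" using Cons.prems x by auto
  have "straight (wt (x # w)) (gen c d * word_poly w)"
  proof (rule straight_mult[OF words_over_gen[OF cd] Cons.IH])
    fix u w' assume *: "u \<in> Poly_Mapping.keys (gen c d)" "set w' \<subseteq> A \<times> B" "wt w' = wt w"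
    then have "Poly_Mapping.single u 1 = gen c d" by (simp add: gen_def)
    moreover have "wt (x # w) = wt ((c, d) # w')" using * x by auto
    ultimately show "straight (wt (x # w)) (Poly_Mapping.single u 1 * word_poly w')"
      using straight_gen_word[OF cd *(2)] by simp
  qed (use Cons.prems in auto)
  then show ?case by (simp add: x word_poly_Cons del: wt_Cons)
qed

text \<open>In a normal word no letter annihilates a virtual symbol, so creations alone make up its
  virtual weights; weight zero leaves none. This shows that the word lies in the sum of U(gl(n)) and
  Irr.\<close>

lemma weight_zero_virt:
  assumes "set w \<subseteq> A \<times> A" "\<And>g. virtual g \<Longrightarrow> wt w g = 0"
  obtains r where "r \<in> words_over B" "word_poly w - r \<in> L"
proof -
  obtain r where r: "word_poly w - r \<in> L"
    "\<And>u. u \<in> Poly_Mapping.keys r \<Longrightarrow> set (letters u) \<subseteq> A \<times> B \<and> wt (letters u) = wt w"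
    using straight_mono[OF assms(1)] unfolding straight_def by blast
  have "set (letters u) \<subseteq> B \<times> B" if u: "u \<in> Poly_Mapping.keys r" for u
  proof
    fix x assume x: "x \<in> set (letters u)"
    have "fst x \<noteq> g" if g: "virtual g" for g
    proof (rule wt_zero_fst[OF _ _ x])
      show "wt (letters u) g = 0" using r(2)[OF u] assms(2)[OF g] by simp
      show "\<And>x. x \<in> set (letters u) \<Longrightarrow> snd x \<noteq> g"
        using r(2)[OF u] g unfolding B_def proper_symbols_def by auto
    qed
    then show "x \<in> B \<times> B"
      using r(2)[OF u] x virtual_iff_not_proper[of "fst x" m0 m1 n] unfolding A_def B_def by (cases x) auto
  qed
  then have "r \<in> words_over B" unfolding words_over_iff by blast
  then show ?thesis using that r(1) by blast
qed

text \<open>Existence of a component makes the choice in \<open>virt_proj\<close> admissible; the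
  only thing retained about the chosen coset is that it is congruent to the word modulo Irr.\<close>

lemma virt_proj_mono:
  assumes "set w \<subseteq> A \<times> A" "\<And>g. virtual g \<Longrightarrow> wt w g = 0"
  obtains r where "r \<in> words_over B" "virt_proj m0 m1 n (coset A (word_poly w)) = coset B r" "word_poly w - r \<in> L"
proof -
  let ?P = "\<lambda>y. y \<in> carrier (U_gl n) \<and> coset A (word_poly w) \<ominus>\<^bsub>U_super m0 m1 n\<^esub> env_incl m0 m1 n y \<in> Irr m0 m1 n"
  have mw: "word_poly w \<in> words_over A" using assms by (intro words_over_single) simp
  have P: "?P (coset B r) \<longleftrightarrow> word_poly w - r \<in> L" if "r \<in> words_over B" for r
  proof -
    have rA: "r \<in> words_over A" using that words_over_mono[OF proper_subset] by blast
    have "coset B r \<in> carrier (U_gl n)" using coset_carrier[OF that] unfolding B_def .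
    then show ?thesis
      using coset_diff[OF mw rA] words_over_diff[OF mw rA]
      unfolding L_def irr_polys_def A_def[symmetric] B_def env_incl_coset by simp
  qed
  obtain r0 where "r0 \<in> words_over B" "word_poly w - r0 \<in> L"
    using weight_zero_virt[OF assms] by blast
  then have "?P (coset B r0)" using P by simp
  then have *: "?P (virt_proj m0 m1 n (coset A (word_poly w)))"
    unfolding virt_proj_def by (rule someI)
  then obtain r where "r \<in> words_over B" "virt_proj m0 m1 n (coset A (word_poly w)) = coset B r"
    using carrier_env_coset unfolding B_def by metis
  then show ?thesis using that * P by metis
qed

end


section \<open>Highest weight vectors\<close>

text \<open>Phrased with symbols so that it covers the Fock space, the given module and the product
  of the two.\<close>

locale gl_hw = gl_rep scale "proper_symbols n" E
  for scale :: "complex \<Rightarrow> 'v::ab_group_add \<Rightarrow> 'v" and n :: nat and E :: "sym \<Rightarrow> sym \<Rightarrow> 'v \<Rightarrow> 'v" +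
  fixes h :: "nat \<Rightarrow> nat" and z :: 'v
  assumes raising: "1 \<le> i \<Longrightarrow> i < j \<Longrightarrow> j \<le> n \<Longrightarrow> E (Prop i) (Prop j) z = 0"
    and weight: "1 \<le> i \<Longrightarrow> i \<le> n \<Longrightarrow> E (Prop i) (Prop i) z = scale (of_nat (h i)) z"
begin

lemma Prop_mem [simp]: "Prop i \<in> proper_symbols n \<longleftrightarrow> 1 \<le> i \<and> i \<le> n"
  by (auto simp: proper_symbols_def)

lemma rel: 
  assumes "a \<in> proper_symbols n" "b \<in> proper_symbols n" "c \<in> proper_symbols n" "d \<in> proper_symbols n"
  shows "E a b (E c d y) = E c d (E a b y) + (if b = c then E a d y else 0) - (if a = d then E c b y else 0)"
proof -
  have "sgn_gl a b c d = 1"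
    using assms by (auto simp: sgn_gl_def proper_symbols_def)
  then show ?thesis using E_rel[OF assms, of y] by simp
qed

definition low :: "(sym \<times> sym) set" where
  "low = {(Prop i, Prop j) |i j. 1 \<le> j \<and> j < i \<and> i \<le> n}"

text \<open>The space U(n_-) \<open>z\<close>, where n_- is spanned by the strictly lower triangular
  letters.\<close>

definition lowered :: "'v set" where
  "lowered = span {word_act E w z |w. set w \<subseteq> low}"

lemma low_sub: "low \<subseteq> proper_symbols n \<times> proper_symbols n"
  by (auto simp: low_def)

lemma word_act_lowered: "set w \<subseteq> low \<Longrightarrow> word_act E w z \<in> lowered"
  unfolding lowered_def by (rule span_base) blast

lemma E_low_lowered:
  assumes "(a, b) \<in> low" "y \<in> lowered"
  shows "E a b y \<in> lowered"
proof -
  have ab: "a \<in> proper_symbols n" "b \<in> proper_symbols n" using assms(1) low_sub by auto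
  show ?thesis
    using assms(2) unfolding lowered_def
  proof (induction rule: span_induct_alt)
    case base
    then show ?case using ab by (simp add: span_zero)
  next
    case (step c x y)
    then obtain w where w: "x = word_act E w z" "set w \<subseteq> low" by blast
    have "E a b x \<in> span {word_act E w z |w. set w \<subseteq> low}"
      using w assms(1) by (intro span_base CollectI exI[of _ "(a, b) # w"]) auto
    then show ?case using step(2) ab by (simp add: E_add E_scale span_add span_scale)
  qed
qed

text \<open>Passing \<open>(a, b)\<close> over the first letter leaves commutators that are single
  letters acting on a shorter word. On \<open>z\<close> itself the letter annihilates, multiplies by
  the weight, or lowers.\<close>

lemma E_word_lowered:
  assumes "set w \<subseteq> low" "a \<in> proper_symbols n" "b \<in> proper_symbols n"
  shows "E a b (word_act E w z) \<in> lowered"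
  using assms
proof (induction w arbitrary: a b)
  case Nil
  obtain i j where ij: "a = Prop i" "b = Prop j" "1 \<le> i" "i \<le> n" "1 \<le> j" "j \<le> n"
    using Nil by (auto simp: proper_symbols_def)
  have zl: "z \<in> lowered" using word_act_lowered[of "[]"] by simp
  consider "i < j" | "i = j" | "j < i" by linarith
  then show ?case
  proof cases
    case 1
    then show ?thesis using ij raising[of i j] by (simp add: lowered_def span_zero)
  next
    case 2
    then show ?thesis using ij weight[of i] zl by (simp add: lowered_def span_scale)
  next
    case 3
    then have "(a, b) \<in> low" using ij by (auto simp: low_def)
    then show ?thesis using E_low_lowered zl by simp
  qed
next
  case (Cons x w)
  obtain c d where x: "x = (c, d)" by force
  have cd: "(c, d) \<in> low" "c \<in> proper_symbols n" "d \<in> proper_symbols n"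
    using Cons.prems(1) low_sub x by auto
  have w: "set w \<subseteq> low" using Cons.prems(1) by simp
  have "E a b (word_act E (x # w) z) = E c d (E a b (word_act E w z))
      + (if b = c then E a d (word_act E w z) else 0) - (if a = d then E c b (word_act E w z) else 0)"
    using rel[OF Cons.prems(2,3) cd(2,3)] by (simp add: x)
  also have "\<dots> \<in> lowered"
    using E_low_lowered[OF cd(1) Cons.IH[OF w Cons.prems(2,3)]]
      Cons.IH[OF w Cons.prems(2) cd(3)] Cons.IH[OF w cd(2) Cons.prems(3)]
    unfolding lowered_def by (auto intro: span_add span_diff)
  finally show ?case .
qed

lemma E_lowered:
  assumes "y \<in> lowered" "a \<in> proper_symbols n" "b \<in> proper_symbols n"
  shows "E a b y \<in> lowered"
  using assms(1) unfolding lowered_def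
proof (induction rule: span_induct_alt)
  case base
  then show ?case using assms by (simp add: span_zero)
next
  case (step c x y)
  then have "E a b x \<in> span {word_act E w z |w. set w \<subseteq> low}"
    using E_word_lowered assms unfolding lowered_def by blast
  then show ?case using step(2) assms by (simp add: E_add E_scale span_add span_scale)
qed

lemma poly_act_lowered:
  assumes "p \<in> words_over (proper_symbols n)"
  shows "poly_act scale E p z \<in> lowered"
proof -
  have "set w \<subseteq> proper_symbols n \<times> proper_symbols n \<Longrightarrow> word_act E w z \<in> lowered" for w
    by (induction w) (use word_act_lowered[of "[]"] in \<open>auto intro: E_lowered\<close>)
  then show ?thesis
    using assms unfolding poly_act_def words_over_iff lowered_def
    by (intro span_sum span_scale) auto
qed

section \<open>A grading operator that separates the highest weight line\<close>

definition T :: "'v \<Rightarrow> 'v" where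
  "T y = (\<Sum>i=1..n. scale (of_nat i) (E (Prop i) (Prop i) y))"

definition t0 :: complex where
  "t0 = (\<Sum>i=1..n. of_nat i * of_nat (h i))"

lemma T_add: "T (x + y) = T x + T y"
  unfolding T_def sum.distrib[symmetric] by (intro sum.cong) (auto simp: E_add scale_right_distrib)

lemma T_scale: "T (scale c x) = scale c (T x)"
  unfolding T_def scale_sum_right by (intro sum.cong) (auto simp: E_scale scale_left_commute)

lemma T_zero [simp]: "T 0 = 0"
  using T_scale[of 0 0] by simp

lemma T_diff: "T (x - y) = T x - T y"
  using T_add[of "x - y" y] by (simp add: algebra_simps)

lemma T_z: "T z = scale t0 z"
  unfolding T_def t0_def scale_sum_left by (intro sum.cong) (auto simp: weight)

text \<open>The commutator of \<open>T\<close> with \<open>e_{k,l}\<close> is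
  \<open>(k - l) e_{k,l}\<close>. The coefficients \<open>i\<close> in \<open>T\<close> increase so
  that this difference is positive for every lowering letter.\<close>

lemma T_E:
  assumes "1 \<le> k" "k \<le> n" "1 \<le> l" "l \<le> n" "T y = scale t y"
  shows "T (E (Prop k) (Prop l) y) = scale (t + of_nat k - of_nat l) (E (Prop k) (Prop l) y)"
proof -
  let ?Y = "E (Prop k) (Prop l)"
  have "T (?Y y) = (\<Sum>i=1..n. ?Y (scale (of_nat i) (E (Prop i) (Prop i) y))
      + (if i = k then scale (of_nat k) (?Y y) else 0) - (if i = l then scale (of_nat l) (?Y y) else 0))"
    unfolding T_def
  proof (intro sum.cong refl)
    fix i assume "i \<in> {1..n}"
    then show "scale (of_nat i) (E (Prop i) (Prop i) (?Y y)) = ?Y (scale (of_nat i) (E (Prop i) (Prop i) y))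
        + (if i = k then scale (of_nat k) (?Y y) else 0) - (if i = l then scale (of_nat l) (?Y y) else 0)"
      using assms rel[of "Prop i" "Prop i" "Prop k" "Prop l" y]
      by (simp add: E_scale scale_right_distrib scale_right_diff_distrib)
  qed
  also have "\<dots> = ?Y (T y) + scale (of_nat k) (?Y y) - scale (of_nat l) (?Y y)"
  proof -
    have "(\<Sum>i\<in>I. ?Y (f i)) = ?Y (sum f I)" for f :: "nat \<Rightarrow> 'v" and I
      using assms by (induction I rule: infinite_finite_induct) (auto simp: E_add)
    then show ?thesis using assms by (simp add: sum.distrib sum_subtractf T_def)
  qed
  finally show ?thesis
    using assms by (simp add: E_scale scale_left_distrib scale_left_diff_distrib)
qed

lemma T_word:
  assumes "set w \<subseteq> low" "w \<noteq> []"
  shows "\<exists>m\<ge>1. T (word_act E w z) = scale (t0 + of_nat m) (word_act E w z)"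
proof -
  \<comment> \<open>Each lowering letter contributes \<open>i - j\<close>, at least 1, so the bound
    by the length survives the induction and gives a positive \<open>m\<close> for nonempty
    words.\<close>
  have "\<exists>m\<ge>length w. T (word_act E w z) = scale (t0 + of_nat m) (word_act E w z)"
    using assms(1)
  proof (induction w)
    case Nil
    then show ?case using T_z by (intro exI[of _ 0]) auto
  next
    case (Cons x w)
    obtain i j where x: "x = (Prop i, Prop j)" "1 \<le> j" "j < i" "i \<le> n"
      using Cons.prems by (auto simp: low_def)
    obtain m where m: "m \<ge> length w" "T (word_act E w z) = scale (t0 + of_nat m) (word_act E w z)"
      using Cons by auto
    have "T (word_act E (x # w) z) = scale (t0 + of_nat m + of_nat i - of_nat j) (word_act E (x # w) z)"
      using T_E[OF _ _ _ _ m(2), of i j] x by simp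
    also have "t0 + of_nat m + of_nat i - of_nat j = t0 + of_nat (m + (i - j))"
      using x by (simp add: of_nat_diff)
    finally show ?case using m(1) x by (intro exI[of _ "m + (i - j)"]) auto
  qed
  then show ?thesis using assms(2) by (metis Suc_le_eq One_nat_def length_greater_0_conv order_trans)
qed

definition strictly_lower :: "'v set" where
  "strictly_lower = span {u. \<exists>m\<ge>1::nat. T u = scale (t0 + of_nat m) u}"

text \<open>The product of the operators \<open>T - t\<close> for \<open>t\<close> in the list, used
  as an annihilating polynomial in \<open>T\<close>.\<close>

definition shifts :: "complex list \<Rightarrow> 'v \<Rightarrow> 'v" where
  "shifts ts y = foldr (\<lambda>t y. T y - scale t y) ts y"

lemma shifts_simps [simp]: "shifts [] y = y" "shifts (t # ts) y = T (shifts ts y) - scale t (shifts ts y)"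
  by (simp_all add: shifts_def)

lemma shifts_add: "shifts ts (x + y) = shifts ts x + shifts ts y"
  by (induction ts) (auto simp: T_add scale_right_distrib)

lemma shifts_scale: "shifts ts (scale c y) = scale c (shifts ts y)"
  by (induction ts) (auto simp: T_scale scale_right_diff_distrib scale_left_commute)

lemma shifts_zero [simp]: "shifts ts 0 = 0"
  using shifts_scale[of ts 0 0] by simp

lemma shifts_T: "shifts ts (T y) = T (shifts ts y)"
  by (induction ts) (auto simp: T_diff T_scale)

lemma shifts_commute: "shifts ts (shifts ss y) = shifts ss (shifts ts y)"
proof (induction ss)
  case (Cons s ss)
  have "shifts ts (shifts (s # ss) y) = shifts ts (T (shifts ss y) + scale (- s) (shifts ss y))"
    by simp
  also have "\<dots> = T (shifts ts (shifts ss y)) + scale (- s) (shifts ts (shifts ss y))"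
    by (simp only: shifts_add shifts_scale shifts_T)
  finally show ?case using Cons by simp
qed simp

text \<open>The factors commute, so one factor per eigenvector kills a linear combination. The roots
  \<open>t0 + m\<close> with \<open>m\<close> positive avoid \<open>t0\<close>.\<close>

lemma strictly_lower_shifts:
  assumes "u \<in> strictly_lower"
  shows "\<exists>ts. t0 \<notin> set ts \<and> shifts ts u = 0"
  using assms unfolding strictly_lower_def
proof (induction rule: span_induct_alt)
  case base
  then show ?case by (intro exI[of _ "[]"]) auto
next
  case (step c x y)
  then obtain m where m: "m \<ge> (1::nat)" "T x = scale (t0 + of_nat m) x" by blast
  obtain ts where ts: "t0 \<notin> set ts" "shifts ts y = 0" using step by blast
  have "shifts ((t0 + of_nat m) # ts) (scale c x + y) = 0"
    using m ts shifts_commute[of "[t0 + of_nat m]" ts x]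
    by (simp add: shifts_add shifts_scale T_add T_scale scale_right_distrib)
  then show ?case using m ts by (intro exI[of _ "(t0 + of_nat m) # ts"]) auto
qed

text \<open>On an eigenvector for \<open>t0\<close> the annihilating product acts as the product of
  the nonzero numbers \<open>t0 - t\<close>.\<close>

lemma strictly_lower_eigen:
  assumes "u \<in> strictly_lower" "T u = scale t0 u"
  shows "u = 0"
proof -
  obtain ts where ts: "t0 \<notin> set ts" "shifts ts u = 0" using strictly_lower_shifts assms by blast
  have "\<exists>c. c \<noteq> 0 \<and> shifts ts u = scale c u" using ts(1)
  proof (induction ts)
    case Nil
    then show ?case by (intro exI[of _ 1]) auto
  next
    case (Cons t ts)
    then obtain c where "c \<noteq> 0" "shifts ts u = scale c u" by auto
    then have "shifts (t # ts) u = scale (c * (t0 - t)) u"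
      using assms(2) by (simp add: T_scale algebra_simps)
    then show ?case using Cons.prems \<open>c \<noteq> 0\<close> by (intro exI[of _ "c * (t0 - t)"]) auto
  qed
  then show ?thesis using ts by auto
qed

lemma lowered_decomp:
  assumes "y \<in> lowered"
  shows "\<exists>c u. u \<in> strictly_lower \<and> y = scale c z + u"
  using assms unfolding lowered_def
proof (induction rule: span_induct_alt)
  case base
  then show ?case by (intro exI[of _ 0]) (auto simp: strictly_lower_def span_zero)
next
  case (step k x y)
  then obtain w where w: "x = word_act E w z" "set w \<subseteq> low" by blast
  obtain c u where u: "u \<in> strictly_lower" "y = scale c z + u" using step by blast
  show ?case
  proof (cases "w = []")
    case True
    then show ?thesis using w u by (intro exI[of _ "k + c"] exI[of _ u]) (auto simp: scale_left_distrib scale_right_distrib add_ac)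
  next
    case False
    then have "x \<in> strictly_lower"
      using T_word[OF w(2)] w(1) unfolding strictly_lower_def by (intro span_base) auto
    then show ?thesis using u unfolding strictly_lower_def
      by (intro exI[of _ c] exI[of _ "scale k x + u"]) (auto simp: scale_right_distrib add_ac intro: span_add span_scale)
  qed
qed

end

section \<open>Comparison of two highest weight modules inside their product\<close>

lemma gl_rep_prod:
  assumes "gl_rep s1 A E1" "gl_rep s2 A E2"
  shows "gl_rep (\<lambda>c (x, y). (s1 c x, s2 c y)) A (\<lambda>a b (x, y). (E1 a b x, E2 a b y))"
    (is "gl_rep ?s A ?E")
proof -
  interpret M: gl_rep s1 A E1 by fact
  interpret N: gl_rep s2 A E2 by fact
  show ?thesis
  proof
    fix a b c d and x :: "'a \<times> 'b"
    assume A: "a \<in> A" "b \<in> A" "c \<in> A" "d \<in> A"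
    show "?E a b (?E c d x) = ?s (sgn_gl a b c d) (?E c d (?E a b x))
        + (if b = c then ?E a d x else 0) - ?s (sgn_gl a b c d) (if a = d then ?E c b x else 0)"
      using M.E_rel[OF A, of "fst x"] N.E_rel[OF A, of "snd x"]
      by (cases x) (auto simp: zero_prod_def)
  qed (auto simp: M.scale_right_distrib N.scale_right_distrib M.scale_left_distrib N.scale_left_distrib
        M.E_add N.E_add M.E_scale N.E_scale)
qed

lemma poly_act_prod:
  "poly_act (\<lambda>c (x, y). (s1 c x, s2 c y)) (\<lambda>a b (x, y). (E1 a b x, E2 a b y)) p (x, y) =
    (poly_act s1 E1 p x, poly_act s2 E2 p y)"
proof -
  have w: "word_act (\<lambda>a b (x, y). (E1 a b x, E2 a b y)) w (x, y) = (word_act E1 w x, word_act E2 w y)" for w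
    by (induction w) auto
  have "(\<Sum>w\<in>K. (f w, g w)) = (sum f K, sum g K)" if "finite K" for K and f :: "word \<Rightarrow> 'a" and g :: "word \<Rightarrow> 'b"
    using that by (induction K) (auto simp: zero_prod_def)
  then show ?thesis unfolding poly_act_def by (simp add: w)
qed

text \<open>The annihilator of \<open>v1\<close>, applied to \<open>v2\<close>, gives a submodule of
  the irreducible second module. It cannot be everything, so it is zero, and \<open>p - c\<close>
  lies in that annihilator.\<close>

lemma eigenvalue_transfer:
  assumes 1: "gl_hw s1 n E1 h v1" "v1 \<noteq> 0"
    and 2: "gl_hw s2 n E2 h v2" "v2 \<noteq> 0"
    and irr: "\<And>W. module.subspace s2 W \<Longrightarrow> (\<And>a b. a \<in> proper_symbols n \<Longrightarrow> b \<in> proper_symbols n \<Longrightarrow> E2 a b ` W \<subseteq> W)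
      \<Longrightarrow> W = {0} \<or> W = UNIV"
    and p: "p \<in> words_over (proper_symbols n)" "poly_act s1 E1 p v1 = s1 c v1"
  shows "poly_act s2 E2 p v2 = s2 c v2"
proof -
  let ?s = "\<lambda>c (x, y). (s1 c x, s2 c y)" and ?E = "\<lambda>a b (x, y). (E1 a b x, E2 a b y)"
  let ?B = "proper_symbols n"
  interpret M: gl_hw s1 n E1 h v1 by fact
  interpret N: gl_hw s2 n E2 h v2 by fact
  interpret P: gl_rep ?s ?B ?E
    by (rule gl_rep_prod) unfold_locales
  interpret P: gl_hw ?s n ?E h "(v1, v2)"
    by unfold_locales (auto simp: M.raising N.raising M.weight N.weight zero_prod_def)
  define K where "K = {poly_act s2 E2 q v2 |q. q \<in> words_over ?B \<and> poly_act s1 E1 q v1 = 0}"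
  have sub: "N.subspace K"
    unfolding N.subspace_def
  proof (intro conjI ballI allI)
    show "0 \<in> K" unfolding K_def by (intro CollectI exI[of _ 0]) auto
  next
    fix x y assume "x \<in> K" "y \<in> K"
    then obtain q r where "q \<in> words_over ?B" "poly_act s1 E1 q v1 = 0" "x = poly_act s2 E2 q v2"
      "r \<in> words_over ?B" "poly_act s1 E1 r v1 = 0" "y = poly_act s2 E2 r v2"
      unfolding K_def by blast
    then show "x + y \<in> K" unfolding K_def
      by (intro CollectI exI[of _ "q + r"]) (auto simp: M.poly_act_add N.poly_act_add words_over_add)
  next
    fix k x assume "x \<in> K"
    then obtain q where q: "q \<in> words_over ?B" "poly_act s1 E1 q v1 = 0" "x = poly_act s2 E2 q v2"
      unfolding K_def by blast
    have "Poly_Mapping.single 0 k \<in> words_over ?B" by (rule words_over_single) simp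
    with q show "s2 k x \<in> K" unfolding K_def
      by (intro CollectI exI[of _ "Poly_Mapping.single 0 k * q"])
        (auto simp: M.poly_act_mult N.poly_act_mult words_over_mult M.poly_act_single N.poly_act_single)
  qed
  have inv: "E2 a b ` K \<subseteq> K" if "a \<in> ?B" "b \<in> ?B" for a b
  proof
    fix x assume "x \<in> E2 a b ` K"
    then obtain q where q: "q \<in> words_over ?B" "poly_act s1 E1 q v1 = 0" "x = E2 a b (poly_act s2 E2 q v2)"
      unfolding K_def by blast
    have "gen a b \<in> words_over ?B" using that by (rule words_over_gen)
    with q that show "x \<in> K" unfolding K_def
      by (intro CollectI exI[of _ "gen a b * q"])
        (auto simp: M.poly_act_mult N.poly_act_mult words_over_mult M.poly_act_gen N.poly_act_gen)
  qed
  have "K \<noteq> UNIV"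
  proof
    assume "K = UNIV"
    then have "v2 \<in> K" by simp
    then obtain q where q: "q \<in> words_over ?B" "poly_act s1 E1 q v1 = 0" "poly_act s2 E2 q v2 = v2"
      unfolding K_def by auto
    \<comment> \<open>The polynomial \<open>q\<close> kills \<open>v1\<close> and fixes
      \<open>v2\<close>, so it sends \<open>(v1, v2)\<close> to \<open>(0, v2)\<close>.\<close>
    have "(0, v2) \<in> P.lowered"
      using P.poly_act_lowered[OF q(1)] q by (simp add: poly_act_prod)
    then obtain k u where u: "u \<in> P.strictly_lower" "(0, v2) = ?s k (v1, v2) + u"
      using P.lowered_decomp by blast
    \<comment> \<open>Both components are eigenvectors of \<open>T\<close> for \<open>t0\<close>, so
      the strictly lower vector \<open>u\<close> must vanish. This would force \<open>k = 0\<close>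
      and \<open>k = 1\<close> at once.\<close>
    have u': "u = (s1 (- k) v1, s2 (1 - k) v2)"
      using u(2) by (cases u) (auto simp: N.scale_left_diff_distrib eq_neg_iff_add_eq_0 eq_diff_eq add.commute)
    have "P.T u = ?s P.t0 u"
    proof -
      have T: "P.T (x, y) = (M.T x, N.T y)" for x y
      proof -
        have "(\<Sum>w\<in>K. (f w, g w)) = (sum f K, sum g K)" if "finite K" for K and f :: "nat \<Rightarrow> 'a" and g :: "nat \<Rightarrow> 'b"
          using that by (induction K) (auto simp: zero_prod_def)
        then show ?thesis unfolding P.T_def M.T_def N.T_def by simp
      qed
      have "P.t0 = M.t0" "P.t0 = N.t0"
        unfolding P.t0_def M.t0_def N.t0_def by simp_all
      then show ?thesis
        unfolding u' T by (simp add: M.T_scale N.T_scale M.T_z N.T_z mult.commute del: M.scale_minus_left N.scale_minus_left)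
    qed
    then have "u = 0" using P.strictly_lower_eigen u(1) by blast
    then have "s1 (- k) v1 = 0" "s2 (1 - k) v2 = 0" unfolding u' by (auto simp: zero_prod_def)
    then show False using 1(2) 2(2) by auto
  qed
  then have K0: "K = {0}" using irr[OF sub inv] by blast
  have k: "Poly_Mapping.single 0 c \<in> words_over ?B" by (rule words_over_single) simp
  have "poly_act s2 E2 (p - Poly_Mapping.single 0 c) v2 \<in> K"
    unfolding K_def using p k
    by (intro CollectI exI[of _ "p - Poly_Mapping.single 0 c"])
      (auto simp: M.poly_act_diff M.poly_act_single words_over_diff)
  then show ?thesis using K0 by (simp add: N.poly_act_diff N.poly_act_single)
qed


section \<open>The Fock space of a list of places\<close>

text \<open>The elements of the enveloping algebra that kill the fixed vector form a left ideal; if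
  it contains the irregular products, it contains Irr.\<close>

lemma (in gl_rep) poly_act_irr_polys:
  assumes A: "A = symbols m0 m1 n"
    and irr: "\<And>w. set w \<subseteq> A \<times> A \<Longrightarrow> irregular w \<Longrightarrow> word_act E w v = 0"
    and p: "p \<in> irr_polys m0 m1 n"
  shows "poly_act scale E p v = 0"
proof -
  let ?I = "{X \<in> carrier (env A). env_act scale E X v = 0}"
  interpret R: ring "env A" by (rule ring_env)
  have add: "additive_subgroup ?I (env A)"
  proof (rule additive_subgroup.intro, rule subgroup.intro)
    show "\<one>\<^bsub>add_monoid (env A)\<^esub> \<in> ?I"
      using env_act_coset[of 0 v] by (simp add: coset_zero)
  next
    fix X assume "X \<in> ?I"
    moreover have "\<ominus>\<^bsub>env A\<^esub> X \<in> carrier (env A)" "X \<in> carrier (env A)" using calculation by auto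
    moreover have "env_act scale E (X \<oplus>\<^bsub>env A\<^esub> \<ominus>\<^bsub>env A\<^esub> X) v = 0"
      using env_act_coset[of 0 v] calculation by (simp add: coset_zero R.r_neg)
    ultimately show "inv\<^bsub>add_monoid (env A)\<^esub> X \<in> ?I"
      using env_act_add[of X "\<ominus>\<^bsub>env A\<^esub> X" v] by (simp add: a_inv_def)
  qed (auto simp: env_act_add)
  have 0: "env_act scale E X 0 = 0" if "X \<in> carrier (env A)" for X
    using that by (metis carrier_env_coset env_act_coset poly_act_zero_right)
  have "{env_monomial A w |w. set w \<subseteq> A \<times> A \<and> irregular w} \<subseteq> ?I"
  proof clarify
    fix w assume "set w \<subseteq> A \<times> A" "irregular w"
    then show "env_monomial A w \<in> carrier (env A) \<and> env_act scale E (env_monomial A w) v = 0"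
      using irr[of w] coset_carrier[of "word_poly w" A] words_over_single[of "Word w" A 1]
      by (simp add: env_monomial_coset env_act_coset poly_act_single)
  qed
  then have "Irr m0 m1 n \<subseteq> ?I"
    unfolding Irr_def left_ideal_gen_def A[symmetric]
    using add 0 by (intro Inter_lower CollectI conjI) (auto simp: env_act_mult)
  then have "coset A p \<in> ?I" using p unfolding irr_polys_def A by blast
  then show ?thesis by (simp add: env_act_coset)
qed

section \<open>Polynomials in even and odd variables\<close>

declare plus_fun_apply [simp del] zero_fun_apply [simp del]

lemmas fun_apply = plus_fun_apply zero_fun_apply

text \<open>The numbering \<open>to_nat\<close> of the variables fixes the order in which odd
  variables are written, hence all reordering signs.\<close>

instance sym :: countable by countable_datatype

type_synonym variable = "sym \<times> nat"
type_synonym monomial = "(variable \<Rightarrow> nat) \<times> variable set"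
text \<open>All coefficient functions are allowed: each coefficient of \<open>cre p f\<close> or
  \<open>ann p f\<close> depends on at most one coefficient of \<open>f\<close>, so no finiteness of
  support has to be carried along.\<close>

type_synonym fock = "monomial \<Rightarrow> complex"

definition odd_var :: "variable \<Rightarrow> bool" where
  "odd_var p \<longleftrightarrow> parity (fst p) = 1"

definition order_sign :: "variable \<Rightarrow> variable set \<Rightarrow> complex" where
  "order_sign p Q = (-1) ^ card {q \<in> Q. to_nat q < to_nat p}"

text \<open>Multiplication by the variable \<open>p\<close>, read off at the result: the coefficient
  at a monomial comes from that monomial divided by \<open>p\<close>.\<close>

definition cre :: "variable \<Rightarrow> fock \<Rightarrow> fock" where
  "cre p f = (\<lambda>(m, Q). if odd_var p then if p \<in> Q then order_sign p Q * f (m, Q - {p}) else 0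
     else if m p = 0 then 0 else f (m(p := m p - 1), Q))"

text \<open>The partial derivative by \<open>p\<close>; the factor \<open>m p + 1\<close> is the
  exponent before differentiation.\<close>

definition ann :: "variable \<Rightarrow> fock \<Rightarrow> fock" where
  "ann p f = (\<lambda>(m, Q). if odd_var p then if p \<in> Q then 0 else order_sign p Q * f (m, insert p Q)
     else of_nat (m p + 1) * f (m(p := m p + 1), Q))"

definition fscale :: "complex \<Rightarrow> fock \<Rightarrow> fock" where
  "fscale c f = (\<lambda>M. c * f M)"

definition vsign :: "variable \<Rightarrow> variable \<Rightarrow> complex" where
  "vsign p q = (if odd_var p \<and> odd_var q then -1 else 1)"

interpretation fock: vector_space fscale
  by unfold_locales (auto simp: fscale_def fun_eq_iff fun_apply algebra_simps)

lemma order_sign_square [simp]: "order_sign p Q * order_sign p Q = 1"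
  by (simp add: order_sign_def flip: power_mult_distrib)

lemma finite_below: "finite {q :: variable. P q \<and> to_nat q < N}"
proof (rule finite_subset)
  show "finite (to_nat -` {..<N} :: variable set)"
    by (rule finite_vimageI) (auto simp: inj_to_nat)
qed auto

lemma order_sign_insert:
  "order_sign p (insert q Q) = (if q \<notin> Q \<and> to_nat q < to_nat p then - order_sign p Q else order_sign p Q)"
proof (cases "q \<notin> Q \<and> to_nat q < to_nat p")
  case True
  then have "{r \<in> insert q Q. to_nat r < to_nat p} = insert q {r \<in> Q. to_nat r < to_nat p}" by auto
  then show ?thesis
    using True finite_below[of "\<lambda>r. r \<in> Q"] by (simp add: order_sign_def)
next
  case False
  then have "{r \<in> insert q Q. to_nat r < to_nat p} = {r \<in> Q. to_nat r < to_nat p}" by auto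
  then show ?thesis using False by (auto simp: order_sign_def)
qed

lemma order_sign_remove:
  "order_sign p (Q - {q}) = (if q \<in> Q \<and> to_nat q < to_nat p then - order_sign p Q else order_sign p Q)"
  using order_sign_insert[of p q "Q - {q}"] by (cases "q \<in> Q") (auto simp: insert_absorb)

lemma to_nat_neq: "p \<noteq> q \<Longrightarrow> \<not> to_nat (p :: variable) < to_nat q \<Longrightarrow> to_nat q < to_nat p"
  by (metis nat_neq_iff to_nat_split)

lemma sign_assoc [simp]: "order_sign p Q * (order_sign p Q * x) = x"
  by (metis mult.assoc mult_1 order_sign_square)

lemma cre_add: "cre p (f + g) = cre p f + cre p g"
  and ann_add: "ann p (f + g) = ann p f + ann p g"
  and cre_scale: "cre p (fscale c f) = fscale c (cre p f)"
  and ann_scale: "ann p (fscale c f) = fscale c (ann p f)"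
  by (auto simp: cre_def ann_def fscale_def fun_eq_iff fun_apply algebra_simps)

lemma cre_cre: "cre p (cre q f) = fscale (vsign p q) (cre q (cre p f))"
proof (cases "p = q")
  case True
  then show ?thesis by (auto simp: cre_def fscale_def vsign_def fun_eq_iff)
next
  case False
  then show ?thesis
    using to_nat_neq[OF False] 
    by (auto simp: cre_def fscale_def vsign_def fun_eq_iff order_sign_remove fun_upd_twist insert_commute
      Diff_insert2[symmetric] Diff_insert[symmetric])
qed

lemma ann_ann: "ann p (ann q f) = fscale (vsign p q) (ann q (ann p f))"
proof (cases "p = q")
  case True
  then show ?thesis by (auto simp: ann_def fscale_def vsign_def fun_eq_iff)
next
  case False
  then show ?thesis
    using to_nat_neq[OF False] 
    by (auto simp: ann_def fscale_def vsign_def fun_eq_iff order_sign_insert fun_upd_twist insert_commute)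
qed

lemma ann_cre: "ann p (cre q f) = fscale (vsign p q) (cre q (ann p f)) + (if p = q then f else 0)"
proof (cases "p = q")
  case True
  show ?thesis
  proof (cases "odd_var p")
    case odd: True
    show ?thesis unfolding True fun_eq_iff
      using odd True
      by (auto simp: fun_apply cre_def ann_def fscale_def vsign_def order_sign_insert order_sign_remove insert_absorb)
  next
    case False
    then show ?thesis
      using True by (auto simp: cre_def ann_def fscale_def vsign_def fun_eq_iff fun_apply algebra_simps)
  qed
next
  case False
  then show ?thesis
    using to_nat_neq[OF False]
    by (auto simp: cre_def ann_def fscale_def vsign_def fun_eq_iff fun_apply order_sign_insert order_sign_remove
       fun_upd_twist insert_Diff_if)
qed

definition quad :: "variable \<Rightarrow> variable \<Rightarrow> fock \<Rightarrow> fock" where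
  "quad p q f = cre p (ann q f)"

lemma quad_add: "quad p q (f + g) = quad p q f + quad p q g"
  and quad_scale: "quad p q (fscale c f) = fscale c (quad p q f)"
  by (simp_all add: quad_def cre_add ann_add cre_scale ann_scale)

lemma quad_zero [simp]: "quad p q 0 = 0"
  using quad_scale[of p q 0 0] by simp

lemma quad_sum: "quad p q (sum f I) = (\<Sum>i\<in>I. quad p q (f i))"
  by (induction I rule: infinite_finite_induct) (auto simp: quad_add)

definition quad_sign :: "variable \<Rightarrow> variable \<Rightarrow> variable \<Rightarrow> variable \<Rightarrow> complex" where
  "quad_sign p q r t = vsign p r * vsign p t * vsign q r * vsign q t"

text \<open>Both products are rewritten with multiplications to the left of derivatives. Their
  quartic parts agree up to the sign, and the contractions are the remaining terms.\<close>

lemma quad_quad: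
  "quad p q (quad r t f) = fscale (quad_sign p q r t) (quad r t (quad p q f))
     + (if q = r then quad p t f else 0) - fscale (quad_sign p q r t) (if p = t then quad r q f else 0)"
proof -
  have z: "cre u 0 = 0" for u using cre_scale[of u 0 0] by simp
  have 1: "quad u v (quad x y f) = fscale (vsign v x) (cre u (cre x (ann v (ann y f)))) + (if v = x then quad u y f else 0)"
    for u v x y
    unfolding quad_def ann_cre by (simp add: cre_add cre_scale z)
  have 2: "cre p (cre r (ann q (ann t f))) = fscale (vsign p r * vsign q t) (cre r (cre p (ann t (ann q f))))"
    using cre_cre[of p r "ann q (ann t f)"] ann_ann[of q t f] by (simp add: cre_scale)
  have sq: "vsign a b * vsign a b = 1" "vsign a b = vsign b a" for a b by (auto simp: vsign_def)
  have 3: "quad_sign p q r t * vsign t p = vsign q r * (vsign p r * vsign q t)"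
    unfolding quad_sign_def sq(2)[of t p] using sq(1)[of p t] by (simp add: algebra_simps)
  show ?thesis
    unfolding 1[of p q r t] 1[of r t p q] 2
    by (auto simp: fock.scale_right_distrib 3)
qed

definition FE :: "nat \<Rightarrow> sym \<Rightarrow> sym \<Rightarrow> fock \<Rightarrow> fock" where
  "FE l a b f = (\<Sum>j=1..l. quad (a, j) (b, j) f)"

lemma parity_01: "parity a = 0 \<or> parity a = 1"
  by (cases a) auto

text \<open>The four pair signs have exponents \<open>|a||c|\<close>, \<open>|a||d|\<close>,
  \<open>|b||c|\<close>, \<open>|b||d|\<close>, whose sum is
  \<open>(|a|+|b|)(|c|+|d|)\<close>.\<close>

lemma quad_sign_gl: "quad_sign (a, i) (b, j) (c, k) (d, m) = sgn_gl a b c d"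
  using parity_01[of a] parity_01[of b] parity_01[of c] parity_01[of d]
  by (auto simp: quad_sign_def vsign_def odd_var_def sgn_gl_def)

interpretation FE: gl_rep fscale A "FE l" for A l
proof
  fix a b c d k and x y :: fock
  show "FE l a b (x + y) = FE l a b x + FE l a b y"
    by (simp add: FE_def quad_add sum.distrib)
  show "FE l a b (fscale k x) = fscale k (FE l a b x)"
    by (simp add: FE_def quad_scale fock.scale_sum_right)
  let ?s = "sgn_gl a b c d"
  have "FE l a b (FE l c d x) = (\<Sum>i=1..l. \<Sum>j=1..l. quad (a, i) (b, i) (quad (c, j) (d, j) x))"
    by (simp add: FE_def quad_sum)
  \<comment> \<open>Contractions occur only at equal places, so the double sum of bracket terms
    collapses to its diagonal.\<close>
  also have "\<dots> = (\<Sum>i=1..l. \<Sum>j=1..l. fscale ?s (quad (c, j) (d, j) (quad (a, i) (b, i) x)))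
      + (\<Sum>i=1..l. \<Sum>j=1..l. if i = j then (if b = c then quad (a, i) (d, i) x else 0) else 0)
      - (\<Sum>i=1..l. \<Sum>j=1..l. if i = j then fscale ?s (if a = d then quad (c, i) (b, i) x else 0) else 0)"
    unfolding sum.distrib[symmetric] sum_subtractf[symmetric]
  proof (intro sum.cong refl)
    fix i j
    show "quad (a, i) (b, i) (quad (c, j) (d, j) x) = fscale ?s (quad (c, j) (d, j) (quad (a, i) (b, i) x))
      + (if i = j then (if b = c then quad (a, i) (d, i) x else 0) else 0)
      - (if i = j then fscale ?s (if a = d then quad (c, i) (b, i) x else 0) else 0)"
      unfolding quad_quad[of "(a, i)" "(b, i)" "(c, j)" "(d, j)"] quad_sign_gl by auto
  qed
  also have "(\<Sum>i=1..l. \<Sum>j=1..l. fscale ?s (quad (c, j) (d, j) (quad (a, i) (b, i) x))) = fscale ?s (FE l c d (FE l a b x))"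
    by (subst sum.swap) (simp add: FE_def quad_sum fock.scale_sum_right)
  also have "(\<Sum>i=1..l. \<Sum>j=1..l. if i = j then (if b = c then quad (a, i) (d, i) x else 0) else 0) = (if b = c then FE l a d x else 0)"
    by (simp add: FE_def)
  also have "(\<Sum>i=1..l. \<Sum>j=1..l. if i = j then fscale ?s (if a = d then quad (c, i) (b, i) x else 0) else 0)
      = fscale ?s (if a = d then FE l c b x else 0)"
    by (simp add: FE_def fock.scale_sum_right)
  finally show "FE l a b (FE l c d x) = fscale ?s (FE l c d (FE l a b x)) + (if b = c then FE l a d x else 0)
      - fscale ?s (if a = d then FE l c b x else 0)" .
qed

section \<open>Operators on the places\<close>

definition place_op :: "sym set \<Rightarrow> nat \<Rightarrow> nat \<Rightarrow> fock \<Rightarrow> fock" where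
  "place_op A j k f = (\<Sum>a\<in>A. quad (a, j) (a, k) f)"

text \<open>Letters \<open>e_{c,c}\<close> are even, so no sign appears. The two contractions, at
  \<open>c = a\<close> and at \<open>c = b\<close>, give the same operator with opposite
  signs.\<close>

lemma place_op_FE:
  assumes "finite A" "a \<in> A" "b \<in> A" "j \<in> {1..l}" "k \<in> {1..l}"
  shows "place_op A j k (FE l a b f) = FE l a b (place_op A j k f)"
proof -
  have s: "sgn_gl c c a b = 1" for c
    using parity_01[of c] by (auto simp: sgn_gl_def)
  have "place_op A j k (FE l a b f) = (\<Sum>c\<in>A. \<Sum>i=1..l. quad (c, j) (c, k) (quad (a, i) (b, i) f))"
    by (simp add: place_op_def FE_def quad_sum)
  also have "\<dots> = (\<Sum>c\<in>A. \<Sum>i=1..l. quad (a, i) (b, i) (quad (c, j) (c, k) f)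
      + (if c = a then if i = k then quad (a, j) (b, k) f else 0 else 0)
      - (if c = b then if i = j then quad (a, j) (b, k) f else 0 else 0))"
    unfolding quad_quad[of "(_, j)" "(_, k)"] quad_sign_gl s
    by (intro sum.cong refl) auto
  also have "\<dots> = (\<Sum>c\<in>A. \<Sum>i=1..l. quad (a, i) (b, i) (quad (c, j) (c, k) f))"
    using assms by (simp add: sum.distrib sum_subtractf sum.If_cases if_distrib[of "sum _"])
  also have "\<dots> = FE l a b (place_op A j k f)"
    by (subst sum.swap) (simp add: place_op_def FE_def quad_sum)
  finally show ?thesis .
qed

lemma place_op_word:
  assumes "finite A" "set w \<subseteq> A \<times> A" "j \<in> {1..l}" "k \<in> {1..l}"
  shows "place_op A j k (word_act (FE l) w f) = word_act (FE l) w (place_op A j k f)"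
  using assms(2) by (induction w) (use assms in \<open>auto simp: place_op_FE\<close>)

section \<open>Supports, symbol counts and place counts\<close>

definition cnt :: "monomial \<Rightarrow> variable \<Rightarrow> nat" where
  "cnt M p = (if odd_var p then of_bool (p \<in> snd M) else fst M p)"

lemma cnt_odd_le: "odd_var p \<Longrightarrow> cnt M p \<le> 1"
  by (simp add: cnt_def)

text \<open>A monomial of the result arises from \<open>M'\<close> by replacing one variable
  \<open>q\<close> by \<open>p\<close>. The indicator terms stand on both sides to avoid subtraction
  of natural numbers.\<close>

lemma quad_support:
  assumes "quad p q f M \<noteq> 0"
  obtains M' where "f M' \<noteq> 0" "1 \<le> cnt M p" "1 \<le> cnt M' q"
    "\<And>r. cnt M' r + of_bool (r = p) = cnt M r + of_bool (r = q)"
proof -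
  have 1: "\<exists>M'. f M' \<noteq> 0 \<and> (\<forall>r. cnt M' r = cnt M r + of_bool (r = q))"
    if "ann q f M \<noteq> 0" for f q M
  proof (cases M)
    case (Pair m Q)
    then show ?thesis using that
      by (intro exI[of _ "if odd_var q then (m, insert q Q) else (m(q := m q + 1), Q)"])
        (auto simp: ann_def cnt_def split: if_splits)
  qed
  have 2: "\<exists>M'. f M' \<noteq> 0 \<and> (\<forall>r. cnt M' r + of_bool (r = p) = cnt M r)"
    if "cre p f M \<noteq> 0" for f p M
  proof (cases M)
    case (Pair m Q)
    then show ?thesis using that
      by (intro exI[of _ "if odd_var p then (m, Q - {p}) else (m(p := m p - 1), Q)"])
        (auto simp: cre_def cnt_def split: if_splits)
  qed
  obtain M1 where M1: "ann q f M1 \<noteq> 0" "\<And>r. cnt M1 r + of_bool (r = p) = cnt M r"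
    using 2 assms unfolding quad_def by blast
  obtain M' where M': "f M' \<noteq> 0" "\<And>r. cnt M' r = cnt M1 r + of_bool (r = q)"
    using 1[OF M1(1)] by blast
  show ?thesis
  proof (rule that)
    show "1 \<le> cnt M p" using M1(2)[of p] by simp
    show "1 \<le> cnt M' q" using M'(2)[of q] by simp
    show "cnt M' r + of_bool (r = p) = cnt M r + of_bool (r = q)" for r
      using M1(2)[of r] M'(2)[of r] by simp
  qed fact
qed

lemma quad_self: "quad p p f M = of_nat (cnt M p) * f M"
proof (cases M)
  case (Pair m Q)
  then show ?thesis
    by (auto simp: quad_def cre_def ann_def cnt_def order_sign_remove insert_absorb)
qed

lemma sum_fun_apply: "sum f I x = (\<Sum>i\<in>I. f i x)"
  by (induction I rule: infinite_finite_induct) (auto simp: fun_apply)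

definition symcount :: "nat \<Rightarrow> monomial \<Rightarrow> sym \<Rightarrow> nat" where
  "symcount l M a = (\<Sum>j=1..l. cnt M (a, j))"

definition placecount :: "sym set \<Rightarrow> monomial \<Rightarrow> nat \<Rightarrow> nat" where
  "placecount A M j = (\<Sum>a\<in>A. cnt M (a, j))"

lemma FE_self: "FE l a a f M = of_nat (symcount l M a) * f M"
  by (simp add: FE_def sum_fun_apply quad_self symcount_def sum_distrib_right)

lemma FE_support:
  assumes "FE l a b f M \<noteq> 0"
  obtains M' j where "j \<in> {1..l}" "f M' \<noteq> 0" "1 \<le> cnt M (a, j)" "1 \<le> cnt M' (b, j)"
    "\<And>r. cnt M' r + of_bool (r = (a, j)) = cnt M r + of_bool (r = (b, j))"
proof -
  obtain j where j: "j \<in> {1..l}" "quad (a, j) (b, j) f M \<noteq> 0"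
    using assms unfolding FE_def sum_fun_apply by (meson sum.not_neutral_contains_not_neutral)
  from quad_support[OF j(2)] show ?thesis using that j(1) by metis
qed

text \<open>The replaced variable keeps its place, so place counts are preserved as soon as both
  symbols belong to the counted set.\<close>

lemma FE_support_counts:
  assumes "FE l a b f M \<noteq> 0"
  obtains M' where "f M' \<noteq> 0" "1 \<le> symcount l M' b"
    "\<And>g. symcount l M' g + of_bool (g = a) = symcount l M g + of_bool (g = b)"
    "\<And>A j. finite A \<Longrightarrow> a \<in> A \<Longrightarrow> b \<in> A \<Longrightarrow> placecount A M' j = placecount A M j"
proof -
  obtain M' j where M': "j \<in> {1..l}" "f M' \<noteq> 0" "1 \<le> cnt M' (b, j)"
    "\<And>r. cnt M' r + of_bool (r = (a, j)) = cnt M r + of_bool (r = (b, j))"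
    using FE_support[OF assms] by metis
  have s: "(\<Sum>i=1..l. of_bool ((g, i) = (c, j))) = (of_bool (g = c) :: nat)" for g c
    using M'(1) by (cases "g = c") (auto simp: of_bool_def)
  have t: "(\<Sum>c\<in>A. of_bool ((c, i) = (d, j))) = (of_bool (i = j) :: nat)"
    if "finite A" "d \<in> A" for A i d
    using that by (cases "i = j") (auto simp: of_bool_def)
  show ?thesis
  proof (rule that[OF M'(2)])
    have "cnt M' (b, j) \<le> symcount l M' b"
      unfolding symcount_def using M'(1) by (intro member_le_sum) auto
    then show "1 \<le> symcount l M' b" using M'(3) by simp
    show "symcount l M' g + of_bool (g = a) = symcount l M g + of_bool (g = b)" for g
    proof -
      have "(\<Sum>i=1..l. cnt M' (g, i) + of_bool ((g, i) = (a, j))) = (\<Sum>i=1..l. cnt M (g, i) + of_bool ((g, i) = (b, j)))"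
        by (intro sum.cong refl M')
      then show ?thesis unfolding sum.distrib s symcount_def .
    qed
    show "placecount A M' i = placecount A M i" if A: "finite A" "a \<in> A" "b \<in> A" for A i
    proof -
      have "(\<Sum>c\<in>A. cnt M' (c, i) + of_bool ((c, i) = (a, j))) = (\<Sum>c\<in>A. cnt M (c, i) + of_bool ((c, i) = (b, j)))"
        by (intro sum.cong refl M')
      then show ?thesis unfolding sum.distrib t[OF A(1,2)] t[OF A(1,3)] placecount_def by simp
    qed
  qed
qed

lemma word_support:
  assumes "word_act (FE l) w f M \<noteq> 0"
  obtains M' where "f M' \<noteq> 0"
    "\<And>g. int (symcount l M g) = int (symcount l M' g) + wt w g"
    "\<And>A j. finite A \<Longrightarrow> set w \<subseteq> A \<times> A \<Longrightarrow> placecount A M j = placecount A M' j"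
  using assms
proof (induction w arbitrary: M thesis)
  case Nil
  then show ?case by simp
next
  case (Cons x w)
  obtain a b where x: "x = (a, b)" by force
  obtain M1 where M1: "word_act (FE l) w f M1 \<noteq> 0"
    "\<And>g. symcount l M1 g + of_bool (g = a) = symcount l M g + of_bool (g = b)"
    "\<And>A j. finite A \<Longrightarrow> a \<in> A \<Longrightarrow> b \<in> A \<Longrightarrow> placecount A M1 j = placecount A M j"
    using FE_support_counts[of l a b "word_act (FE l) w f" M] Cons.prems(2) x by (metis word_act_simps(2))
  obtain M' where M': "f M' \<noteq> 0"
    "\<And>g. int (symcount l M1 g) = int (symcount l M' g) + wt w g"
    "\<And>A j. finite A \<Longrightarrow> set w \<subseteq> A \<times> A \<Longrightarrow> placecount A M1 j = placecount A M' j"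
    using Cons.IH[OF _ M1(1)] by metis
  show ?case
  proof (rule Cons.prems(1)[OF M'(1)])
    show "int (symcount l M g) = int (symcount l M' g) + wt (x # w) g" for g
      using M1(2)[of g] M'(2)[of g] x by (auto simp: of_bool_def split: if_splits)
    show "placecount A M j = placecount A M' j" if "finite A" "set (x # w) \<subseteq> A \<times> A" for A j
      using M1(3)[of A j] M'(3)[of A j] that x by auto
  qed
qed

section \<open>The highest weight monomial of a diagram\<close>

definition hw_monomial :: "nat list \<Rightarrow> monomial" where
  "hw_monomial mu = (\<lambda>_. 0, {(Prop i, j) |i j. (j, i) \<in> diagram mu})"

definition hw_fock :: "nat list \<Rightarrow> fock" where
  "hw_fock mu = (\<lambda>M. of_bool (M = hw_monomial mu))"

lemma hw_fock_support: "hw_fock mu M \<noteq> 0 \<longleftrightarrow> M = hw_monomial mu"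
  by (simp add: hw_fock_def)

lemma hw_fock_nonzero: "hw_fock mu \<noteq> 0"
  using hw_fock_support[of mu "hw_monomial mu"] by (auto simp: fun_apply)

lemma cnt_hw: "cnt (hw_monomial mu) (a, j) = of_bool (\<exists>i. a = Prop i \<and> (j, i) \<in> diagram mu)"
  by (cases a) (auto simp: cnt_def hw_monomial_def odd_var_def)

lemma part_antimono:
  assumes "is_partition mu" "1 \<le> i" "i \<le> j"
  shows "part mu j \<le> part mu i"
proof (cases "i < j \<and> j \<le> length mu")
  case True
  then show ?thesis
    using assms sorted_wrt_nth_less[of "(\<ge>)" mu "i - 1" "j - 1"]
    by (auto simp: is_partition_def Defs.part_def)
next
  case False
  then show ?thesis using assms by (cases "i = j") (auto simp: Defs.part_def)
qed

lemma diagram_down: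
  assumes "is_partition mu" "(i, j) \<in> diagram mu" "1 \<le> i'" "i' \<le> i" "1 \<le> j'" "j' \<le> j"
  shows "(i', j') \<in> diagram mu"
  using assms part_antimono[of mu i' i] by (auto simp: diagram_def)

lemma diagram_length: "(i, j) \<in> diagram mu \<Longrightarrow> i \<le> length mu"
  by (auto simp: diagram_def Defs.part_def split: if_splits)

lemma symcount_hw:
  "symcount l (hw_monomial mu) a = (case a of Prop i \<Rightarrow> card {j \<in> {1..l}. (j, i) \<in> diagram mu} | _ \<Rightarrow> 0)"
  by (cases a) (simp_all add: symcount_def cnt_hw of_bool_def sum.If_cases Int_def)

lemma symcount_hw_Prop:
  assumes "length mu \<le> l"
  shows "symcount l (hw_monomial mu) (Prop i) = conj_part mu i"
proof -
  have "{j \<in> {1..l}. (j, i) \<in> diagram mu} = {j. (j, i) \<in> diagram mu}"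
    using assms diagram_length[of _ i mu] by (fastforce simp: diagram_def)
  then show ?thesis by (simp add: symcount_hw conj_part_def)
qed

lemma symcount_hw_virtual: "virtual a \<Longrightarrow> symcount l (hw_monomial mu) a = 0"
  by (cases a) (simp_all add: symcount_hw)

text \<open>Any place containing the symbol \<open>k\<close> already contains the smaller
  \<open>i\<close>, because the rows of a diagram have no gaps; the replacement would square an odd
  variable.\<close>

lemma hw_fock_raising:
  assumes "is_partition mu" "1 \<le> i" "i < k"
  shows "FE l (Prop i) (Prop k) (hw_fock mu) = 0"
proof (rule ext, rule ccontr)
  fix M assume "FE l (Prop i) (Prop k) (hw_fock mu) M \<noteq> 0 M"
  then have "FE l (Prop i) (Prop k) (hw_fock mu) M \<noteq> 0" by (simp add: fun_apply)
  then obtain M' j where M': "hw_fock mu M' \<noteq> 0" "1 \<le> cnt M' (Prop k, j)"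
    "\<And>r. cnt M' r + of_bool (r = (Prop i, j)) = cnt M r + of_bool (r = (Prop k, j))"
    using FE_support by metis
  have "(j, k) \<in> diagram mu" using M'(1,2) by (auto simp: hw_fock_support cnt_hw of_bool_def split: if_splits)
  then have "(j, i) \<in> diagram mu" using diagram_down[OF assms(1), of j k j i] assms by (auto simp: diagram_def)
  then have "cnt M' (Prop i, j) = 1" using M'(1) by (simp add: hw_fock_support cnt_hw)
  then have "cnt M (Prop i, j) = 2" using M'(3)[of "(Prop i, j)"] assms by simp
  then show False using cnt_odd_le[of "(Prop i, j)" M] by (simp add: odd_var_def)
qed

text \<open>The same squaring of an odd variable, now along columns: a symbol at place
  \<open>k\<close> also occurs at the earlier place \<open>j\<close>.\<close>

lemma hw_fock_place_op:
  assumes "is_partition mu" "1 \<le> j" "j < k"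
  shows "place_op A j k (hw_fock mu) = 0"
proof -
  have "quad (a, j) (a, k) (hw_fock mu) = 0" for a
  proof (rule ext, rule ccontr)
    fix M assume "quad (a, j) (a, k) (hw_fock mu) M \<noteq> 0 M"
    then have "quad (a, j) (a, k) (hw_fock mu) M \<noteq> 0" by (simp add: fun_apply)
    then obtain M' where M': "hw_fock mu M' \<noteq> 0" "1 \<le> cnt M' (a, k)"
      "\<And>r. cnt M' r + of_bool (r = (a, j)) = cnt M r + of_bool (r = (a, k))"
      using quad_support by metis
    obtain i where i: "a = Prop i" "(k, i) \<in> diagram mu"
      using M'(1,2) by (auto simp: hw_fock_support cnt_hw of_bool_def split: if_splits)
    then have "(j, i) \<in> diagram mu" using diagram_down[OF assms(1), of k i j i] assms by (auto simp: diagram_def)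
    then have "cnt M' (a, j) = 1" using M'(1) i by (simp add: hw_fock_support cnt_hw)
    then have "cnt M (a, j) = 2" using M'(3)[of "(a, j)"] assms by simp
    then show False using cnt_odd_le[of "(a, j)" M] i by (simp add: odd_var_def)
  qed
  then show ?thesis by (simp add: place_op_def)
qed

lemma hw_fock_weight:
  assumes "length mu \<le> l"
  shows "FE l (Prop i) (Prop i) (hw_fock mu) = fscale (of_nat (conj_part mu i)) (hw_fock mu)"
  using symcount_hw_Prop[OF assms]
  by (auto simp: fun_eq_iff FE_self fscale_def hw_fock_def)

lemma gl_hw_fock:
  assumes "is_partition mu" "length mu \<le> l"
  shows "gl_hw fscale n (FE l) (conj_part mu) (hw_fock mu)"
  using assms by unfold_locales (auto simp: hw_fock_raising hw_fock_weight)

lemma card_take_filter: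
  assumes "i \<le> length r"
  shows "(\<Sum>x\<leftarrow>take i r. of_bool (P x) :: int) = int (card {j. j < i \<and> P (r ! j)})"
  using assms
proof (induction i)
  case (Suc i)
  have "{j. j < Suc i \<and> P (r ! j)} = (if P (r ! i) then insert i {j. j < i \<and> P (r ! j)} else {j. j < i \<and> P (r ! j)})"
    by (auto simp: less_Suc_eq)
  then show ?case using Suc by (simp add: take_Suc_conv_app_nth)
qed simp

text \<open>The monomial has no virtual symbols, so after the letters of \<open>t\<close> the number
  of symbols \<open>g\<close> is exactly \<open>wt t g\<close>.\<close>

lemma irregular_hw_fock:
  assumes "irregular w"
  shows "word_act (FE l) w (hw_fock mu) = 0"
proof -
  let ?r = "rev w"
  obtain i g where i: "i < length w" "virtual g"
    "card {j. j \<le> i \<and> snd (?r ! j) = g} > card {j. j < i \<and> fst (?r ! j) = g}"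
    using assms unfolding irregular_def by blast
  define t where "t = rev (take i ?r)"
  obtain a b where ab: "?r ! i = (a, b)" by force
  have "?r = take i ?r @ [(a, b)] @ drop (Suc i) ?r"
    using i(1) ab id_take_nth_drop[of i ?r] by simp
  then have w: "w = rev (drop (Suc i) ?r) @ [(a, b)] @ t"
    unfolding t_def by (metis append.assoc rev_append rev_rev_ident rev_singleton_conv rev.simps)
  have "{j. j \<le> i \<and> snd (?r ! j) = g} = (if b = g then insert i {j. j < i \<and> snd (?r ! j) = g} else {j. j < i \<and> snd (?r ! j) = g})"
    using ab by (auto simp: le_less)
  then have "card {j. j < i \<and> snd (?r ! j) = g} + of_bool (b = g) > card {j. j < i \<and> fst (?r ! j) = g}"
    using i(3) by (auto split: if_splits)
  moreover have "wt t g = int (card {j. j < i \<and> fst (?r ! j) = g}) - int (card {j. j < i \<and> snd (?r ! j) = g})"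
    using i(1) card_take_filter[of i ?r "\<lambda>x. fst x = g"] card_take_filter[of i ?r "\<lambda>x. snd x = g"]
    unfolding wt_def t_def rev_map[symmetric] sum_list_rev sum_list_subtractf by simp
  \<comment> \<open>If \<open>b = g\<close>, no \<open>g\<close> is left for the next letter to
    remove. Otherwise the number of symbols \<open>g\<close> would be negative.\<close>
  ultimately have wt: "wt t g < of_bool (b = g)" by auto
  have "FE l a b (word_act (FE l) t (hw_fock mu)) = 0"
  proof (rule ext, rule ccontr)
    fix M assume "FE l a b (word_act (FE l) t (hw_fock mu)) M \<noteq> 0 M"
    then have "FE l a b (word_act (FE l) t (hw_fock mu)) M \<noteq> 0" by (simp add: fun_apply)
    then obtain M1 where M1: "word_act (FE l) t (hw_fock mu) M1 \<noteq> 0" "1 \<le> symcount l M1 b"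
      using FE_support_counts by metis
    obtain M' where "hw_fock mu M' \<noteq> 0" "int (symcount l M1 g) = int (symcount l M' g) + wt t g"
      using word_support[OF M1(1)] by metis
    then have "int (symcount l M1 g) = wt t g"
      using symcount_hw_virtual[OF i(2)] by (simp add: hw_fock_support)
    then show False using wt M1(2) by (cases "b = g") auto
  qed
  then show ?thesis
    by (subst w) (simp add: FE.word_act_zero[of _ UNIV])
qed

lemma irr_polys_hw_fock:
  assumes "p \<in> irr_polys m0 m1 n"
  shows "poly_act fscale (FE l) p (hw_fock mu) = 0"
  using FE.poly_act_irr_polys[OF refl irregular_hw_fock assms] .


section \<open>Vanishing\<close>

definition tab_word :: "nat list \<Rightarrow> sym tableau \<Rightarrow> sym tableau \<Rightarrow> (sym \<times> sym) list" where
  "tab_word lam S T = map (\<lambda>c. (S c, T c)) (cells lam)"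

lemma set_cells: "set (cells lam) = diagram lam"
proof -
  have "set (cells lam) = (\<Union>i\<in>{1..length lam}. Pair i ` {1..part lam i})"
    by (simp add: cells_def atLeastLessThanSuc_atLeastAtMost del: upt_Suc)
  also have "\<dots> = diagram lam"
    by (auto simp: diagram_def Defs.part_def split: if_splits)
  finally show ?thesis .
qed

lemma finite_diagram [simp]: "finite (diagram lam)"
  by (metis set_cells List.finite_set)

lemma distinct_cells: "distinct (cells lam)"
proof -
  have "distinct (concat (map (\<lambda>i. map (\<lambda>j. (i, j)) (f i)) xs))"
    if "distinct xs" "\<And>i. distinct (f i)" for xs :: "nat list" and f :: "nat \<Rightarrow> nat list"
    using that by (induction xs) (auto simp: distinct_map inj_on_def)
  then show ?thesis unfolding cells_def by simp
qed

lemma wt_tab_word: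
  "wt (tab_word lam S T) g = int (card {c \<in> diagram lam. S c = g}) - int (card {c \<in> diagram lam. T c = g})"
proof -
  have "wt (tab_word lam S T) g = (\<Sum>c\<in>diagram lam. of_bool (S c = g) - of_bool (T c = g))"
    unfolding wt_def tab_word_def
    by (simp add: comp_def sum_list_distinct_conv_sum_set distinct_cells set_cells)
  also have "\<dots> = int (card {c \<in> diagram lam. S c = g}) - int (card {c \<in> diagram lam. T c = g})"
    by (simp add: sum_subtractf of_bool_def sum.If_cases Int_def)
  finally show ?thesis .
qed

lemma card_Cstar: "1 \<le> i \<Longrightarrow> card {c \<in> diagram lam. Cstar c = Alpha i} = part lam i"
proof -
  assume "1 \<le> i"
  then have "{c \<in> diagram lam. Cstar c = Alpha i} = Pair i ` {1..part lam i}"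
    by (auto simp: Cstar_def diagram_def)
  then show ?thesis by (simp add: card_image inj_on_def)
qed

lemma card_Dstar: "card {c \<in> diagram lam. Dstar c = Beta j} = conj_part lam j"
proof -
  have "{c \<in> diagram lam. Dstar c = Beta j} = (\<lambda>i. (i, j)) ` {i. (i, j) \<in> diagram lam}"
    by (auto simp: Dstar_def)
  then show ?thesis by (simp add: card_image inj_on_def conj_part_def)
qed

lemma Cstar_neq [simp]: "Cstar c \<noteq> Beta j" "Cstar c \<noteq> Prop j" "Dstar c \<noteq> Alpha j" "Dstar c \<noteq> Prop j"
  by (auto simp: Cstar_def Dstar_def split: prod.splits)

lemma column_eq:
  assumes "is_partition lam" "1 \<le> k"
  shows "{i. (i, k) \<in> diagram lam} = {1..conj_part lam k}"
proof -
  let ?S = "{i. (i, k) \<in> diagram lam}"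
  have fin: "finite ?S" by (rule finite_subset[of _ "{1..length lam}"]) (use diagram_length in \<open>auto simp: diagram_def\<close>)
  show ?thesis
  proof (cases "?S = {}")
    case True
    then show ?thesis by (simp add: conj_part_def)
  next
    case False
    have "?S = {1..Max ?S}"
    proof (intro equalityI subsetI)
      fix i assume "i \<in> ?S"
      then show "i \<in> {1..Max ?S}" using fin by (auto simp: diagram_def)
    next
      fix i assume i: "i \<in> {1..Max ?S}"
      have "Max ?S \<in> ?S" using fin False by (rule Max_in)
      then show "i \<in> ?S" using i diagram_down[OF assms(1), of "Max ?S" k i k] assms(2) by simp
    qed
    then show ?thesis unfolding conj_part_def by (metis card_atLeastAtMost diff_Suc_1)
  qed
qed

lemma conj_part_one:
  assumes "is_partition lam"
  shows "conj_part lam 1 = length lam"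
proof -
  have "{i. (i, 1) \<in> diagram lam} = {1..length lam}"
    using assms by (auto simp: diagram_def Defs.part_def is_partition_def Suc_le_eq split: if_splits)
  then show ?thesis by (simp add: conj_part_def)
qed

text \<open>The minimum counts the cells of column \<open>k\<close> in the first \<open>r\<close>
  rows; the double count is then done by rows.\<close>

lemma sum_min_conj_part:
  assumes "is_partition lam"
  shows "(\<Sum>k=1..m. min r (conj_part lam k)) \<le> (\<Sum>i=1..r. part lam i)"
proof -
  have "(\<Sum>k=1..m. min r (conj_part lam k)) = (\<Sum>k=1..m. card {i \<in> {1..r}. (i, k) \<in> diagram lam})"
  proof (intro sum.cong refl)
    fix k assume "k \<in> {1..m}"
    then have "{i \<in> {1..r}. (i, k) \<in> diagram lam} = {1..r} \<inter> {1..conj_part lam k}"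
      using column_eq[OF assms, of k] by auto
    also have "\<dots> = {1..min r (conj_part lam k)}" by auto
    finally show "min r (conj_part lam k) = card {i \<in> {1..r}. (i, k) \<in> diagram lam}" by simp
  qed
  also have "\<dots> = (\<Sum>k=1..m. \<Sum>i=1..r. of_bool ((i, k) \<in> diagram lam))"
    by (simp add: of_bool_def sum.If_cases Int_def)
  also have "\<dots> = (\<Sum>i=1..r. \<Sum>k=1..m. of_bool ((i, k) \<in> diagram lam))"
    by (rule sum.swap)
  also have "\<dots> \<le> (\<Sum>i=1..r. part lam i)"
  proof (intro sum_mono)
    fix i
    have "(\<Sum>k=1..m. of_bool ((i, k) \<in> diagram lam)) = card {k \<in> {1..m}. (i, k) \<in> diagram lam}"
      by (simp add: of_bool_def sum.If_cases Int_def)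
    also have "\<dots> \<le> card {1..part lam i}"
      by (intro card_mono) (auto simp: diagram_def)
    finally show "(\<Sum>k=1..m. of_bool ((i, k) \<in> diagram lam)) \<le> part lam i" by simp
  qed
  finally show ?thesis .
qed

text \<open>
  The operator moving place \<open>k\<close> to place \<open>i\<close> is the sum of \<open>x\<^sub>i\<^sub>i \<partial>/\<partial>x\<^sub>i\<^sub>k\<close>, which lowers the degree
  in the variables \<open>x\<^sub>i\<^sub>k\<close>, \<open>k > i\<close>, and of terms that preserve it. Hence the part of lowest degree
  does not involve these variables.
\<close>

lemma triangular_monomial:
  assumes "finite A" "\<And>i. 1 \<le> i \<Longrightarrow> i \<le> r \<Longrightarrow> Alpha i \<in> A" "r \<le> l"
    and "\<And>j k. 1 \<le> j \<Longrightarrow> j < k \<Longrightarrow> k \<le> l \<Longrightarrow> place_op A j k f = 0"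
    and "f \<noteq> 0"
  shows "\<exists>M. f M \<noteq> 0 \<and> (\<forall>i\<in>{1..r}. \<forall>k\<in>{i<..l}. cnt M (Alpha i, k) = 0)"
  using assms(2,3)
proof (induction r)
  case 0
  then show ?case using assms(5) by (auto simp: fun_eq_iff fun_apply)
next
  case (Suc r)
  define i where "i = Suc r"
  define P where "P M \<longleftrightarrow> f M \<noteq> 0 \<and> (\<forall>i\<in>{1..r}. \<forall>k\<in>{i<..l}. cnt M (Alpha i, k) = 0)" for M
  define d where "d M = (\<Sum>k\<in>{i<..l}. cnt M (Alpha i, k))" for M
  have "\<exists>M. P M" using Suc.IH Suc.prems unfolding P_def by simp
  \<comment> \<open>A monomial of least degree in the variables to be removed; a positive degree
    will produce a smaller one.\<close>
  then obtain M where M: "P M" "\<And>M'. P M' \<Longrightarrow> d M \<le> d M'"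
    using ex_has_least_nat[of P _ d] by blast
  have "d M = 0"
  proof (rule ccontr)
    assume "d M \<noteq> 0"
    then obtain k where k: "k \<in> {i<..l}" "cnt M (Alpha i, k) \<noteq> 0"
      unfolding d_def by (meson sum.neutral)
    obtain m Q where mQ: "M = (m, Q)" by force
    let ?p = "(Alpha i, i)" and ?q = "(Alpha i, k)"
    \<comment> \<open>One factor moves from place \<open>k\<close> to place \<open>i\<close>. The
      term of the place operator for \<open>Alpha i\<close> has at \<open>M'\<close> the coefficient
      of \<open>M\<close> times a positive exponent.\<close>
    define M' where "M' = (m(?q := m ?q - 1, ?p := m ?p + 1), Q)"
    have even: "\<not> odd_var ?p" "\<not> odd_var ?q" by (auto simp: odd_var_def)
    have pq: "?p \<noteq> ?q" using k by auto
    have mq: "m ?q \<noteq> 0" using k(2) even mQ by (simp add: cnt_def)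
    have cntM': "cnt M' v = (if v = ?p then cnt M v + 1 else if v = ?q then cnt M v - 1 else cnt M v)" for v
      using even mQ by (auto simp: M'_def cnt_def)
    have "(m(?q := m ?q - 1, ?p := m ?p + 1))(?p := m ?p, ?q := Suc (m ?q - 1)) = m"
      using mq pq by (auto simp: fun_eq_iff)
    then have "quad ?p ?q f M' = of_nat (m ?q) * f M"
      using even mq pq mQ by (simp add: quad_def cre_def ann_def M'_def)
    then have nz: "quad ?p ?q f M' \<noteq> 0" using mq M(1) by (simp add: P_def)
    have "(\<Sum>a\<in>A. quad (a, i) (a, k) f M') = 0"
    proof -
      have "place_op A i k f M' = 0" using assms(4)[of i k] k(1) by (simp add: i_def fun_apply)
      then show ?thesis unfolding place_op_def sum_fun_apply .
    qed
    moreover have "Alpha i \<in> A" using Suc.prems(1) i_def by simp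
    \<comment> \<open>The total coefficient is zero, so another symbol must compensate. Its source
      monomial \<open>M''\<close> has one factor of \<open>Alpha i\<close> less at place
      \<open>k\<close>, against the choice of \<open>M\<close>.\<close>
    ultimately have "(\<Sum>a\<in>A - {Alpha i}. quad (a, i) (a, k) f M') \<noteq> 0"
      using nz assms(1) by (auto simp: sum.remove[of A "Alpha i"])
    then obtain a where a: "a \<in> A - {Alpha i}" "quad (a, i) (a, k) f M' \<noteq> 0"
      by (meson sum.neutral)
    obtain M'' where M'': "f M'' \<noteq> 0" "1 \<le> cnt M' (a, i)"
      "\<And>v. cnt M'' v + of_bool (v = (a, i)) = cnt M' v + of_bool (v = (a, k))"
      using quad_support[OF a(2)] by metis
    \<comment> \<open>Such a symbol would have to occur at place \<open>i\<close>, beyond its own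
      index, which \<open>P M\<close> excludes. Hence the rows already treated stay triangular in
      \<open>M''\<close>.\<close>
    have aa: "a \<noteq> Alpha i'" if "i' \<in> {1..r}" for i'
    proof
      assume "a = Alpha i'"
      then have "cnt M' (a, i) = cnt M (Alpha i', i)" using that cntM' i_def by simp
      also have "\<dots> = 0" using M(1) that k(1) unfolding P_def i_def by simp
      finally show False using M''(2) by simp
    qed
    have "cnt M'' (Alpha i', k') = cnt M (Alpha i', k')" if "i' \<in> {1..r}" for i' k'
      using M''(3)[of "(Alpha i', k')"] aa[OF that] cntM'[of "(Alpha i', k')"] that i_def by auto
    then have "P M''" using M''(1) M(1) unfolding P_def by simp
    moreover have "d M'' < d M"
      unfolding d_def
    proof (rule sum_strict_mono_ex1)
      have c: "cnt M'' (Alpha i, k') = cnt M (Alpha i, k') - of_bool (k' = k)" if "k' \<in> {i<..l}" for k'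
        using M''(3)[of "(Alpha i, k')"] a cntM'[of "(Alpha i, k')"] that by auto
      then show "\<forall>k\<in>{i<..l}. cnt M'' (Alpha i, k) \<le> cnt M (Alpha i, k)" by simp
      show "\<exists>k\<in>{i<..l}. cnt M'' (Alpha i, k) < cnt M (Alpha i, k)"
        using c k by (intro bexI[of _ k]) auto
    qed simp
    ultimately show False using M(2)[of M''] by simp
  qed
  then have "\<forall>k\<in>{i<..l}. cnt M (Alpha i, k) = 0" unfolding d_def by simp
  then show ?case using M(1) unfolding P_def i_def by (intro exI[of _ M]) (auto simp: le_Suc_eq)
qed

lemma finite_symbols [simp]: "finite (symbols m0 m1 n)"
  by (simp add: symbols_def proper_symbols_def)

lemma tab_word_subset:
  "set (tab_word lam S T) \<subseteq> X \<times> Y \<longleftrightarrow> (\<forall>c\<in>diagram lam. S c \<in> X \<and> T c \<in> Y)"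
  by (auto simp: tab_word_def set_cells)

lemma Cstar_symbols:
  assumes "is_partition lam" "conj_part lam 1 \<le> m0" "c \<in> diagram lam"
  shows "Cstar c \<in> Alpha ` {1..m0}"
  using assms conj_part_one[OF assms(1)] diagram_length by (fastforce simp: Cstar_def diagram_def)

lemma Dstar_symbols:
  assumes "is_partition lam" "part lam 1 \<le> m1" "c \<in> diagram lam"
  shows "Dstar c \<in> Beta ` {1..m1}"
proof -
  obtain i j where c: "c = (i, j)" by force
  have "j \<le> part lam i" "1 \<le> i" "1 \<le> j" using assms(3) c by (auto simp: diagram_def)
  then have "j \<le> m1" using part_antimono[OF assms(1), of 1 i] assms(2) by simp
  then show ?thesis using c \<open>1 \<le> j\<close> by (auto simp: Dstar_def)
qed

text \<open>The leftmost factor of the summand is left out: the other three already kill the vector,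
  for any entries of \<open>S\<close>.\<close>

lemma vanishing:
  assumes lam: "is_partition lam" and mu: "is_partition mu"
    and m0: "conj_part lam 1 \<le> m0" and m1: "part lam 1 \<le> m1"
    and S: "\<And>c. c \<in> diagram lam \<Longrightarrow> S c \<in> {1..n}"
    and l: "length lam + length mu \<le> l"
    and nsub: "\<not> diagram lam \<subseteq> diagram mu"
  shows "word_act (FE l) (tab_word lam Cstar Dstar @ tab_word lam Dstar Cstar @ tab_word lam Cstar (\<lambda>c. Prop (S c))) (hw_fock mu) = 0"
proof (rule ccontr)
  let ?A = "symbols m0 m1 n" and ?V = "Alpha ` {1..m0} \<union> Beta ` {1..m1}"
  let ?w1 = "tab_word lam Cstar Dstar"
  let ?w2 = "tab_word lam Dstar Cstar @ tab_word lam Cstar (\<lambda>c. Prop (S c))"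
  define u where "u = word_act (FE l) ?w2 (hw_fock mu)"
  define f where "f = word_act (FE l) ?w1 u"
  assume "\<not> ?thesis"
  then have f0: "f \<noteq> 0" by (simp add: f_def u_def)
  have C: "c \<in> diagram lam \<Longrightarrow> Cstar c \<in> Alpha ` {1..m0}" for c using Cstar_symbols[OF lam m0] .
  have D: "c \<in> diagram lam \<Longrightarrow> Dstar c \<in> Beta ` {1..m1}" for c using Dstar_symbols[OF lam m1] .
  have w1: "set ?w1 \<subseteq> ?V \<times> ?V" using C D unfolding tab_word_subset by blast
  have w: "set (?w1 @ ?w2) \<subseteq> ?A \<times> ?A"
    using C D S unfolding set_append Un_subset_iff tab_word_subset by (auto simp: symbols_def proper_symbols_def)
  have fw: "f = word_act (FE l) (?w1 @ ?w2) (hw_fock mu)" by (simp add: f_def u_def)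
  have pl: "place_op ?A j k f = 0" if "1 \<le> j" "j < k" "k \<le> l" for j k
  proof -
    have jk: "j \<in> {1..l}" "k \<in> {1..l}" using that by auto
    show ?thesis
      unfolding fw place_op_word[OF finite_symbols w jk] hw_fock_place_op[OF mu that(1,2)]
      by (rule FE.word_act_zero[OF w])
  qed
  have len: "length lam \<le> m0" using conj_part_one[OF lam] m0 by simp
  obtain M where M: "f M \<noteq> 0" "\<And>i k. i \<in> {1..length lam} \<Longrightarrow> k \<in> {i<..l} \<Longrightarrow> cnt M (Alpha i, k) = 0"
    using triangular_monomial[of ?A "length lam" l f] pl f0 l len by (auto simp: symbols_def proper_symbols_def)
  define nu where "nu j = (\<Sum>i=1..m0. cnt M (Alpha i, j))" for j
  have card0: "card {c \<in> diagram lam. T c = g} = 0" if "\<And>c. T c \<noteq> g" for T :: "nat \<times> nat \<Rightarrow> sym" and g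
    using that by simp
  \<comment> \<open>The word \<open>?w1\<close> exchanges virtual symbols among themselves, so the
    virtual content of each place is inherited from \<open>u\<close>. There it consists of odd betas
    only, at most one \<open>Beta k\<close> per place and \<open>conj_part lam k\<close> of them in
    all.\<close>
  have upper: "(\<Sum>j=1..r. nu j) \<le> (\<Sum>i=1..r. part lam i)" if r: "r \<le> length lam" for r
  proof -
    obtain M' where M': "u M' \<noteq> 0" "\<And>j. placecount ?V M j = placecount ?V M' j"
      using word_support[of l ?w1 u M] M(1) w1 unfolding f_def by (metis finite_UnI finite_atLeastAtMost finite_imageI)
    have sc: "int (symcount l M' g) = int (symcount l (hw_monomial mu) g) + wt ?w2 g" for g
      using word_support[of l ?w2 "hw_fock mu" M'] M'(1) unfolding u_def hw_fock_support by metis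
    have "symcount l M' (Alpha i) = 0" for i
      using sc[of "Alpha i"] by (simp add: wt_tab_word symcount_hw)
    then have alpha: "cnt M' (Alpha i, j) = 0" if "j \<in> {1..l}" for i j
      using that unfolding symcount_def by simp
    have beta: "symcount l M' (Beta k) = conj_part lam k" for k
      using sc[of "Beta k"] by (simp add: wt_tab_word symcount_hw card_Dstar)
    have rl: "r \<le> l" using r l by simp
    have "(\<Sum>j=1..r. nu j) \<le> (\<Sum>j=1..r. placecount ?V M j)"
    proof (intro sum_mono)
      fix j
      have "nu j = (\<Sum>a\<in>Alpha ` {1..m0}. cnt M (a, j))"
        unfolding nu_def by (subst sum.reindex) (auto simp: inj_on_def)
      also have "\<dots> \<le> placecount ?V M j" unfolding placecount_def by (intro sum_mono2) auto
      finally show "nu j \<le> placecount ?V M j" .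
    qed
    also have "\<dots> = (\<Sum>j=1..r. \<Sum>k=1..m1. cnt M' (Beta k, j))"
    proof (intro sum.cong refl)
      fix j assume "j \<in> {1..r}"
      then have "placecount ?V M' j = (\<Sum>a\<in>Beta ` {1..m1}. cnt M' (a, j))"
        unfolding placecount_def using alpha rl by (intro sum.mono_neutral_right) auto
      also have "\<dots> = (\<Sum>k=1..m1. cnt M' (Beta k, j))"
        by (subst sum.reindex) (auto simp: inj_on_def)
      finally show "placecount ?V M j = (\<Sum>k=1..m1. cnt M' (Beta k, j))" using M'(2) by simp
    qed
    also have "\<dots> = (\<Sum>k=1..m1. \<Sum>j=1..r. cnt M' (Beta k, j))" by (rule sum.swap)
    also have "\<dots> \<le> (\<Sum>k=1..m1. min r (conj_part lam k))"
    proof (intro sum_mono min.boundedI)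
      fix k
      have "(\<Sum>j=1..r. cnt M' (Beta k, j)) \<le> (\<Sum>j=1..r. 1)"
        by (intro sum_mono cnt_odd_le) (simp add: odd_var_def)
      then show "(\<Sum>j=1..r. cnt M' (Beta k, j)) \<le> r" by simp
      show "(\<Sum>j=1..r. cnt M' (Beta k, j)) \<le> conj_part lam k"
        unfolding beta[symmetric] symcount_def using rl by (intro sum_mono2) auto
    qed
    also have "\<dots> \<le> (\<Sum>i=1..r. part lam i)" by (rule sum_min_conj_part[OF lam])
    finally show ?thesis .
  qed
  have part: "part lam i = (\<Sum>j=1..l. cnt M (Alpha i, j))" if "1 \<le> i" for i
  proof -
    have "int (symcount l M (Alpha i)) = int (symcount l (hw_monomial mu) (Alpha i)) + wt (?w1 @ ?w2) (Alpha i)"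
      using word_support[of l "?w1 @ ?w2" "hw_fock mu" M] M(1) unfolding fw hw_fock_support by metis
    then have "symcount l M (Alpha i) = part lam i"
      using that by (simp add: wt_tab_word symcount_hw card_Cstar)
    then show ?thesis by (simp add: symcount_def)
  qed
  \<comment> \<open>By triangularity all copies of \<open>Alpha i\<close> with \<open>i\<close> at
    most \<open>r\<close> sit in the first \<open>r\<close> places.\<close>
  have lower: "(\<Sum>i=1..r. part lam i) \<le> (\<Sum>j=1..r. nu j)" if r: "r \<le> length lam" for r
  proof -
    have "(\<Sum>i=1..r. part lam i) = (\<Sum>i=1..r. \<Sum>j=1..r. cnt M (Alpha i, j))"
    proof (intro sum.cong refl)
      fix i assume i: "i \<in> {1..r}"
      have "(\<Sum>j=1..l. cnt M (Alpha i, j)) = (\<Sum>j=1..r. cnt M (Alpha i, j))"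
        using M(2)[of i] i r l by (intro sum.mono_neutral_right) auto
      then show "part lam i = (\<Sum>j=1..r. cnt M (Alpha i, j))" using part i by simp
    qed
    also have "\<dots> = (\<Sum>j=1..r. \<Sum>i=1..r. cnt M (Alpha i, j))" by (rule sum.swap)
    also have "\<dots> \<le> (\<Sum>j=1..r. nu j)"
      unfolding nu_def using r len by (intro sum_mono sum_mono2) auto
    finally show ?thesis .
  qed
  have eq: "(\<Sum>j=1..r. nu j) = (\<Sum>i=1..r. part lam i)" if "r \<le> length lam" for r
    using upper[OF that] lower[OF that] by simp
  have "part lam i \<le> part mu i" if i: "1 \<le> i" "i \<le> length lam" for i
  proof -
    have "{1..i} = insert i {1..i - 1}" using i by auto
    then have "nu i = part lam i"
      using eq[of i] eq[of "i - 1"] i by simp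
    moreover have "nu i = (\<Sum>a\<in>Alpha ` {1..m0}. cnt M (a, i))"
      unfolding nu_def by (subst sum.reindex) (auto simp: inj_on_def)
    then have "nu i \<le> placecount ?A M i"
      unfolding placecount_def by (auto intro!: sum_mono2 simp: symbols_def proper_symbols_def)
    \<comment> \<open>The whole word preserves place contents, so place \<open>i\<close> offers only
      the \<open>part mu i\<close> variables present at the start.\<close>
    moreover have "placecount ?A M i = placecount ?A (hw_monomial mu) i"
      using word_support[of l "?w1 @ ?w2" "hw_fock mu" M] M(1) w unfolding fw hw_fock_support
      by (metis finite_symbols)
    moreover have "placecount ?A (hw_monomial mu) i \<le> part mu i"
    proof -
      have "placecount ?A (hw_monomial mu) i = card {a \<in> ?A. \<exists>k. a = Prop k \<and> (i, k) \<in> diagram mu}"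
        unfolding placecount_def cnt_hw by (simp add: of_bool_def sum.If_cases Int_def)
      also have "\<dots> \<le> card (Prop ` {1..part mu i})"
        by (intro card_mono) (auto simp: diagram_def)
      also have "\<dots> \<le> part mu i" using card_image_le[of "{1..part mu i}" Prop] by simp
      finally show ?thesis .
    qed
    ultimately show ?thesis by simp
  qed
  then have "diagram lam \<subseteq> diagram mu"
    using diagram_length[of _ _ lam] by (fastforce simp: diagram_def)
  then show False using nsub by simp
qed


section \<open>Hook lengths\<close>

text \<open>The letter \<open>e_{g,g}\<close> is even and passes each letter without a sign, picking
  up its weight.\<close>

lemma (in gl_rep) E_word_weight:
  assumes "set w \<subseteq> A \<times> A" "g \<in> A" "E g g x = scale c x"
  shows "E g g (word_act E w x) = scale (c + of_int (wt w g)) (word_act E w x)"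
  using assms(1)
proof (induction w)
  case Nil
  then show ?case using assms(3) by simp
next
  case (Cons y w)
  obtain a b where y: "y = (a, b)" by force
  have ab: "a \<in> A" "b \<in> A" and w: "set w \<subseteq> A \<times> A" using Cons.prems y by auto
  have s: "sgn_gl g g a b = 1" by (cases g) (simp_all add: sgn_gl_def)
  have "E g g (word_act E (y # w) x) = scale (c + of_int (wt w g)) (E a b (word_act E w x))
     + (if g = a then E a b (word_act E w x) else 0) - (if g = b then E a b (word_act E w x) else 0)"
    using E_rel[OF assms(2,2) ab, of "word_act E w x"] Cons.IH[OF w] ab by (auto simp: y s E_scale)
  also have "\<dots> = scale (c + of_int (wt (y # w) g)) (word_act E (y # w) x)"
    by (auto simp: y of_bool_def scale_left_distrib scale_left_diff_distrib add_ac)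
  finally show ?case .
qed

section \<open>Signs from reordering anticommuting letters\<close>

locale gl_full = gl_rep scale UNIV E
  for scale :: "complex \<Rightarrow> 'v::ab_group_add \<Rightarrow> 'v" and E :: "sym \<Rightarrow> sym \<Rightarrow> 'v \<Rightarrow> 'v"
begin

lemma scale_self_neg:
  assumes "x = - x"
  shows "x = (0 :: 'v)"
proof -
  have "scale 2 x = 0" using scale_left_distrib[of 1 1 x] assms by (metis add.right_inverse one_add_one scale_one)
  then show "x = 0" by simp
qed

definition anticommuting :: "('b \<Rightarrow> sym \<times> sym) \<Rightarrow> bool" where
  "anticommuting F \<longleftrightarrow> (\<forall>c d x. E (fst (F c)) (snd (F c)) (E (fst (F d)) (snd (F d)) x)
     = - E (fst (F d)) (snd (F d)) (E (fst (F c)) (snd (F c)) x))"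

lemma word_act_Cons: "word_act E (y # w) x = E (fst y) (snd y) (word_act E w x)"
  by (cases y) simp

lemma anticommuting_move:
  assumes "anticommuting F"
  shows "word_act E (map F (P @ c # Q)) x = scale ((-1) ^ length P) (word_act E (map F (c # P @ Q)) x)"
proof (induction P)
  case (Cons p P)
  have "E (fst (F p)) (snd (F p)) (E (fst (F c)) (snd (F c)) y) = - E (fst (F c)) (snd (F c)) (E (fst (F p)) (snd (F p)) y)" for y
    using assms unfolding anticommuting_def by blast
  then show ?case using Cons by (simp add: word_act_Cons E_scale del: word_act_simps(2,3))
qed simp

text \<open>The sign is quantified before the family \<open>F\<close>: it depends on the two lists
  of cells alone, so proper and beta letters receive the same one.\<close>

lemma anticommuting_permute:
  assumes "mset Z = mset Z'"
  shows "\<exists>s. s * s = 1 \<and> (\<forall>F x. anticommuting F \<longrightarrow> word_act E (map F Z') x = scale s (word_act E (map F Z) x))"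
  using assms
proof (induction Z arbitrary: Z')
  case Nil
  then have "Z' = []" by simp
  then show ?case by (intro exI[of _ 1]) auto
next
  case (Cons c Z)
  then have "c \<in> set Z'" by (metis list.set_intros(1) set_mset_mset)
  then obtain P Q where PQ: "Z' = P @ c # Q" by (meson split_list)
  then have "mset Z = mset (P @ Q)" using Cons.prems by simp
  then obtain s where s: "s * s = 1" "\<And>F x. anticommuting F \<Longrightarrow> word_act E (map F (P @ Q)) x = scale s (word_act E (map F Z) x)"
    using Cons.IH by blast
  have "word_act E (map F Z') x = scale ((-1) ^ length P * s) (word_act E (map F (c # Z)) x)"
    if F: "anticommuting F" for F x
    unfolding PQ anticommuting_move[OF F]
    using s(2)[OF F, of x] by (simp add: word_act_Cons E_scale del: word_act_simps(2,3) map_append)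
  moreover have "((-1) ^ length P * s) * ((-1) ^ length P * s) = 1"
    using s(1) by (simp add: mult.commute mult.left_commute flip: power_mult_distrib mult.assoc)
  ultimately show ?case by blast
qed

end

section \<open>Cells in column order\<close>

definition raise_letter :: "(nat \<Rightarrow> sym) \<Rightarrow> nat \<times> nat \<Rightarrow> sym \<times> sym" where
  "raise_letter b c = (Alpha (fst c), b (snd c))"

definition lower_letter :: "(nat \<Rightarrow> sym) \<Rightarrow> nat \<times> nat \<Rightarrow> sym \<times> sym" where
  "lower_letter b c = (b (snd c), Alpha (fst c))"

text \<open>Columns from left to right, each from bottom to top.\<close>

definition before :: "nat \<times> nat \<Rightarrow> nat \<times> nat \<Rightarrow> bool" where
  "before c d \<longleftrightarrow> snd c < snd d \<or> snd c = snd d \<and> fst d < fst c"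

text \<open>The list is a final segment of this order: what follows a cell is exactly the set of all
  later cells of the diagram.\<close>

fun chain :: "nat list \<Rightarrow> (nat \<times> nat) list \<Rightarrow> bool" where
  "chain lam [] \<longleftrightarrow> True"
| "chain lam (c # Z) \<longleftrightarrow> c \<in> diagram lam \<and> set Z = {d \<in> diagram lam. before c d} \<and> chain lam Z"

lemma chain_distinct: "chain lam Z \<Longrightarrow> distinct Z"
  by (induction Z) (auto simp: before_def)

lemma chain_exists: "\<exists>Z. chain lam Z \<and> set Z = diagram lam"
proof -
  define N where "N = length lam"
  \<comment> \<open>The second term lies below \<open>N\<close> on the diagram, so the column
    decides first and lower cells of a column come earlier.\<close>
  define f where "f c = snd c * N + (N - fst c)" for c :: "nat \<times> nat"
  define L where "L = sort_key f (cells lam)"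
  have row: "1 \<le> fst c" "fst c \<le> N" if "c \<in> diagram lam" for c
    using that diagram_length[of "fst c" "snd c" lam] unfolding N_def by (auto simp: diagram_def)
  have f: "before c d \<Longrightarrow> f c < f d" if "c \<in> diagram lam" "d \<in> diagram lam" for c d
  proof -
    assume b: "before c d"
    show "f c < f d"
    proof (cases "snd c < snd d")
      case True
      have "f c < Suc (snd c) * N" using row[OF that(1)] by (simp add: f_def)
      also have "\<dots> \<le> snd d * N" using True by (intro mult_le_mono1) simp
      finally show ?thesis by (simp add: f_def)
    next
      case False
      then show ?thesis using b row[OF that(1)] row[OF that(2)] by (auto simp: before_def f_def)
    qed
  qed
  have tot: "c = d \<or> before c d \<or> before d c" for c d
    by (cases c; cases d) (auto simp: before_def)
  have L: "set L = diagram lam" "distinct L" "sorted (map f L)"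
    by (simp_all add: L_def set_cells distinct_cells)
  have "chain lam Z" if "L = P @ Z" for P Z
    using that
  proof (induction Z arbitrary: P)
    case (Cons c Z)
    have c: "c \<in> diagram lam" using Cons.prems L(1) by auto
    have "d \<in> set Z \<longleftrightarrow> d \<in> diagram lam \<and> before c d" for d
    proof
      assume d: "d \<in> set Z"
      then have dd: "d \<in> diagram lam" "d \<noteq> c" "f c \<le> f d"
        using Cons.prems L by (auto simp: sorted_append)
      then have "\<not> before d c" using f[OF dd(1) c] by auto
      then show "d \<in> diagram lam \<and> before c d" using tot[of c d] dd by auto
    next
      assume d: "d \<in> diagram lam \<and> before c d"
      have "d \<notin> set P"
      proof
        assume "d \<in> set P"
        then have "f d \<le> f c" using L(3) Cons.prems by (auto simp: sorted_append)
        then show False using f[OF c] d by fastforce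
      qed
      then show "d \<in> set Z" using d Cons.prems L(1) by (auto simp: before_def)
    qed
    then show ?case using Cons.IH[of "P @ [c]"] Cons.prems c by auto
  qed simp
  then show ?thesis using L(1) by (intro exI[of _ L]) simp
qed

text \<open>The vector \<open>v\<close> contains no alphas and is a highest weight vector for the
  odd symbols \<open>b 1, b 2, ...\<close> with the column lengths as weight. It is used with proper
  symbols and with betas.\<close>

locale gl_columns = gl_full scale E
  for scale :: "complex \<Rightarrow> 'v::ab_group_add \<Rightarrow> 'v" and E :: "sym \<Rightarrow> sym \<Rightarrow> 'v \<Rightarrow> 'v" +
  fixes lam :: "nat list" and b :: "nat \<Rightarrow> sym" and v :: 'v
  assumes partition: "is_partition lam"
    and inj_b: "inj b" and odd_b: "parity (b k) = 1"
    and alpha_free: "E a (Alpha i) v = 0"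
    and raising: "1 \<le> j \<Longrightarrow> j < k \<Longrightarrow> E (b j) (b k) v = 0"
    and weight: "1 \<le> k \<Longrightarrow> E (b k) (b k) v = scale (of_nat (conj_part lam k)) v"
begin

abbreviation ups :: "(nat \<times> nat) list \<Rightarrow> 'v" where
  "ups Z \<equiv> word_act E (map (raise_letter b) Z) v"

lemma b_neq [simp]: "b k \<noteq> Alpha i" "Alpha i \<noteq> b k"
  by (metis odd_b parity.simps(1) zero_neq_one)+

lemma b_eq [simp]: "b j = b k \<longleftrightarrow> j = k"
  using inj_b by (auto dest: injD)

lemma letter_simps [simp]:
  "raise_letter b (i, k) = (Alpha i, b k)" "lower_letter b (i, k) = (b k, Alpha i)"
  by (simp_all add: raise_letter_def lower_letter_def)

lemma up_up: "E (Alpha i) (b j) (E (Alpha k) (b l) x) = - E (Alpha k) (b l) (E (Alpha i) (b j) x)"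
  using E_rel[of "Alpha i" "b j" "Alpha k" "b l" x] by (simp add: sgn_gl_def odd_b)

lemma down_down: "E (b j) (Alpha i) (E (b l) (Alpha k) x) = - E (b l) (Alpha k) (E (b j) (Alpha i) x)"
  using E_rel[of "b j" "Alpha i" "b l" "Alpha k" x] by (simp add: sgn_gl_def odd_b)

lemma down_up: "E (b k) (Alpha i) (E (Alpha l) (b j) x) = - E (Alpha l) (b j) (E (b k) (Alpha i) x)
    + (if i = l then E (b k) (b j) x else 0) + (if k = j then E (Alpha l) (Alpha i) x else 0)"
  using E_rel[of "b k" "Alpha i" "Alpha l" "b j" x] by (simp add: sgn_gl_def odd_b)

lemma bb_up: "E (b k) (b j) (E (Alpha l) (b m) x) = E (Alpha l) (b m) (E (b k) (b j) x)
    - (if k = m then E (Alpha l) (b j) x else 0)"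
  using E_rel[of "b k" "b j" "Alpha l" "b m" x] by (simp add: sgn_gl_def odd_b)

lemma aa_up: "E (Alpha l) (Alpha i) (E (Alpha m) (b j) x) = E (Alpha m) (b j) (E (Alpha l) (Alpha i) x)
    + (if i = m then E (Alpha l) (b j) x else 0)"
  using E_rel[of "Alpha l" "Alpha i" "Alpha m" "b j" x] by (simp add: sgn_gl_def odd_b)

lemma anticommuting_letters: "anticommuting (raise_letter b)" "anticommuting (lower_letter b)"
  unfolding anticommuting_def raise_letter_def lower_letter_def fst_conv snd_conv
  by (intro allI up_up down_down)+

lemma ups_repeated: "(i, k) \<in> set Z \<Longrightarrow> E (Alpha i) (b k) (ups Z) = 0"
proof (induction Z)
  case (Cons c Z)
  obtain l j where c: "c = (l, j)" by force
  show ?case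
  proof (cases "(i, k) = (l, j)")
    case True
    then show ?thesis using scale_self_neg[OF up_up[of i k i k "ups Z"]] c by simp
  next
    case False
    then have "E (Alpha i) (b k) (ups Z) = 0" using Cons c by auto
    then show ?thesis using c up_up[of i k l j "ups Z"] by simp
  qed
qed simp

text \<open>Commuting with the letter of a cell in row \<open>i\<close> moves that cell up to row
  \<open>l\<close> in its column. The cell above comes later in the chain, so its odd letter is
  repeated.\<close>

lemma aa_ups:
  assumes "chain lam Z" "1 \<le> l" "l < i"
  shows "E (Alpha l) (Alpha i) (ups Z) = 0"
  using assms(1)
proof (induction Z)
  case Nil
  then show ?case by (simp add: alpha_free)
next
  case (Cons c Z)
  obtain m j where c: "c = (m, j)" by force
  have "E (Alpha l) (b j) (ups Z) = 0" if "i = m"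
  proof (rule ups_repeated)
    have "(l, j) \<in> diagram lam"
      using Cons.prems c that assms diagram_down[OF partition, of m j l j] by (auto simp: diagram_def)
    then show "(l, j) \<in> set Z" using Cons.prems c that assms(3) by (simp add: before_def)
  qed
  then show ?case using Cons c aa_up[of l i m j "ups Z"] by simp
qed

lemma bb_ups:
  assumes "1 \<le> k" "k < j" "\<And>c. c \<in> set Z \<Longrightarrow> k < snd c"
  shows "E (b k) (b j) (ups Z) = 0"
  using assms(3)
proof (induction Z)
  case Nil
  then show ?case using assms by (simp add: raising)
next
  case (Cons c Z)
  obtain l m where c: "c = (l, m)" by force
  have "k \<noteq> m" using Cons.prems[of c] c by simp
  then show ?case using Cons c bb_up[of k j l m "ups Z"] by simp
qed

text \<open>A contraction in the same row leaves \<open>e_{b_k,b_j}\<close> with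
  \<open>k < j\<close>, one in the same column leaves \<open>e_{alpha_l,alpha_i}\<close> with
  \<open>l < i\<close>. Both kill the rest of the chain.\<close>

lemma down_ups:
  assumes "chain lam Z" "1 \<le> k" "\<And>c. c \<in> set Z \<Longrightarrow> before (i, k) c"
  shows "E (b k) (Alpha i) (ups Z) = 0"
  using assms(1,3)
proof (induction Z)
  case Nil
  then show ?case by (simp add: alpha_free)
next
  case (Cons c Z)
  obtain l j where c: "c = (l, j)" by force
  have lj: "before (i, k) (l, j)" using Cons.prems(2)[of c] c by simp
  have "E (b k) (b j) (ups Z) = 0" if "i = l"
  proof (rule bb_ups[OF assms(2)])
    show "k < j" using lj that by (simp add: before_def)
    then show "k < snd d" if "d \<in> set Z" for d
      using Cons.prems(1) that c by (auto simp: before_def)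
  qed
  moreover have "E (Alpha l) (Alpha i) (ups Z) = 0" if "k = j"
    using Cons.prems(1) c lj that by (intro aa_ups) (auto simp: before_def diagram_def)
  moreover have "E (b k) (Alpha i) (ups Z) = 0" using Cons by simp
  ultimately show ?case using c down_up[of k i l j "ups Z"] by simp
qed

lemma wt_ups:
  assumes "distinct Z"
  shows "wt (map (raise_letter b) Z) g = int (card {c \<in> set Z. Alpha (fst c) = g}) - int (card {c \<in> set Z. b (snd c) = g})"
proof -
  have "wt (map (raise_letter b) Z) g = (\<Sum>c\<in>set Z. of_bool (Alpha (fst c) = g) - of_bool (b (snd c) = g))"
    unfolding wt_def raise_letter_def using assms
    by (simp add: comp_def sum_list_distinct_conv_sum_set)
  then show ?thesis
    by (simp add: sum_subtractf of_bool_def sum.If_cases Int_def)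
qed

text \<open>The alpha count is the number of later cells in the row, which is the arm. The count of
  \<open>b k\<close> is the column length minus the \<open>i - 1\<close> cells above, which is the
  leg plus one.\<close>

lemma down_up_hook:
  assumes "chain lam (c # Z)"
  shows "E (b (snd c)) (Alpha (fst c)) (ups (c # Z)) = scale (of_nat (hook_length lam c)) (ups Z)"
proof -
  obtain i k where c: "c = (i, k)" by force
  have ik: "(i, k) \<in> diagram lam" "1 \<le> i" "1 \<le> k" "k \<le> part lam i"
    and Z: "set Z = {d \<in> diagram lam. before c d}" "chain lam Z" "distinct Z"
    using assms c chain_distinct[OF assms] by (auto simp: diagram_def)
  have 0: "E (b k) (Alpha i) (ups Z) = 0"
    using Z ik c by (intro down_ups) auto
  have col: "{i. (i, k) \<in> diagram lam} = {1..conj_part lam k}" using column_eq[OF partition ik(3)] .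
  then have colD: "(i', k) \<in> diagram lam \<longleftrightarrow> i' \<in> {1..conj_part lam k}" for i' by blast
  have ic: "i \<le> conj_part lam k" using ik(1) colD by simp
  have "{d \<in> set Z. Alpha (fst d) = Alpha i} = Pair i ` {k<..part lam i}"
    using ik unfolding Z(1) c by (auto simp: before_def diagram_def)
  then have r: "card {d \<in> set Z. Alpha (fst d) = Alpha i} = part lam i - k"
    by (simp add: card_image inj_on_def)
  have "{d \<in> set Z. b (snd d) = b k} = (\<lambda>l. (l, k)) ` {1..<i}"
    unfolding Z(1) c using ik diagram_down[OF partition ik(1), of _ k] by (auto simp: before_def diagram_def)
  then have q: "card {d \<in> set Z. b (snd d) = b k} = i - 1"
    by (simp add: card_image inj_on_def)
  have E0: "{d \<in> set Z. b (snd d) = Alpha i} = {}" "{d \<in> set Z. Alpha (fst d) = b k} = {}" by auto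
  have wa: "E (Alpha i) (Alpha i) (ups Z) = scale (of_nat (part lam i - k)) (ups Z)"
    using E_word_weight[of "map (raise_letter b) Z" "Alpha i" v 0] alpha_free[of "Alpha i" i]
    by (simp add: wt_ups[OF Z(3)] r[simplified])
  have wb: "E (b k) (b k) (ups Z) = scale (of_nat (conj_part lam k - (i - 1))) (ups Z)"
    using E_word_weight[of "map (raise_letter b) Z" "b k" v "of_nat (conj_part lam k)"] weight[OF ik(3)] ic
    by (simp add: wt_ups[OF Z(3)] q[simplified] of_nat_diff)
  have "{j'. k < j' \<and> (i, j') \<in> diagram lam} = {k<..part lam i}"
    using ik by (auto simp: diagram_def)
  moreover have "{i'. i < i' \<and> (i', k) \<in> diagram lam} = {i<..conj_part lam k}"
    using ik(2) by (auto simp: colD)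
  ultimately have "hook_length lam c = (conj_part lam k - (i - 1)) + (part lam i - k)"
    using ic ik(2) unfolding hook_length_def c by simp
  then show ?thesis
    using down_up[of k i i k "ups Z"] 0 wa wb c by (simp add: scale_left_distrib)
qed

text \<open>Lowering in reverse order lets the outermost raising letter meet its partner first, so
  the cells are peeled off one at a time.\<close>

lemma down_chain:
  "chain lam Z \<Longrightarrow> word_act E (map (lower_letter b) (rev Z)) (ups Z) = scale (of_nat (\<Prod>c\<in>set Z. hook_length lam c)) v"
proof (induction Z)
  case (Cons c Z)
  have "c \<notin> set Z" using chain_distinct[OF Cons.prems] by simp
  moreover have "word_act E (map (lower_letter b) (rev (c # Z))) (ups (c # Z))
      = word_act E (map (lower_letter b) (rev Z)) (scale (of_nat (hook_length lam c)) (ups Z))"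
    using down_up_hook[OF Cons.prems] by (cases c) simp
  ultimately show ?case using Cons by (simp add: word_act_scale)
qed simp

end

context gl_full
begin

text \<open>The sign combines the reordering of \<open>cells lam\<close> into the chain and into its
  reverse. It is fixed before \<open>b\<close> and \<open>v\<close>, so two uses multiply to
  1.\<close>

lemma hook_eigenvalue:
  "\<exists>s. s * s = 1 \<and> (\<forall>b v. gl_columns scale E lam b v \<longrightarrow>
     word_act E (map (lower_letter b) (cells lam)) (word_act E (map (raise_letter b) (cells lam)) v)
       = scale (s * of_nat (hook_product lam)) v)"
proof -
  obtain Z where Z: "chain lam Z" "set Z = diagram lam" using chain_exists by blast
  have m: "mset Z = mset (cells lam)" "mset (rev Z) = mset (cells lam)"
    using Z(2) chain_distinct[OF Z(1)] distinct_cells[of lam] set_cells[of lam]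
    by (simp_all add: set_eq_iff_mset_eq_distinct[symmetric])
  obtain s where s: "s * s = 1" "\<And>F :: nat \<times> nat \<Rightarrow> _. \<And>x. anticommuting F \<Longrightarrow> word_act E (map F (cells lam)) x = scale s (word_act E (map F Z) x)"
    using anticommuting_permute[OF m(1)] by blast
  obtain t where t: "t * t = 1" "\<And>F :: nat \<times> nat \<Rightarrow> _. \<And>x. anticommuting F \<Longrightarrow> word_act E (map F (cells lam)) x = scale t (word_act E (map F (rev Z)) x)"
    using anticommuting_permute[OF m(2)] by blast
  show ?thesis
  proof (intro exI[of _ "s * t"] conjI allI impI)
    have "s * t * (s * t) = (s * s) * (t * t)" by (simp add: mult_ac)
    then show "s * t * (s * t) = 1" using s(1) t(1) by simp
    fix b v assume "gl_columns scale E lam b v"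
    then interpret gl_columns scale E lam b v .
    show "word_act E (map (lower_letter b) (cells lam)) (word_act E (map (raise_letter b) (cells lam)) v)
       = scale (s * t * of_nat (hook_product lam)) v"
      unfolding s(2)[OF anticommuting_letters(1)] t(2)[OF anticommuting_letters(2)]
      using down_chain[OF Z(1)] Z(2)
      by (simp add: word_act_scale hook_product_def mult_ac)
  qed
qed

end


section \<open>The Schur elements on highest weight vectors\<close>

fun beta_word :: "nat \<Rightarrow> (nat \<Rightarrow> nat) \<Rightarrow> (sym \<times> sym) list" where
  "beta_word 0 n = []"
| "beta_word (Suc K) n = replicate (n (Suc K)) (Beta (Suc K), Prop (Suc K)) @ beta_word K n"

lemma beta_word_cong: "(\<And>k. 1 \<le> k \<Longrightarrow> k \<le> K \<Longrightarrow> n k = n' k) \<Longrightarrow> beta_word K n = beta_word K n'"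
  by (induction K) auto

lemma beta_word_zero: "(\<And>k. 1 \<le> k \<Longrightarrow> k \<le> K \<Longrightarrow> n k = 0) \<Longrightarrow> beta_word K n = []"
  by (induction K) auto

lemma set_beta_word: "y \<in> set (beta_word K n) \<Longrightarrow> \<exists>m. 1 \<le> m \<and> m \<le> K \<and> y = (Beta m, Prop m)"
  by (induction K) (auto split: if_splits)

lemma wt_replicate: "wt (replicate p y) g = int p * (of_bool (fst y = g) - of_bool (snd y = g))"
  by (induction p) (auto simp: algebra_simps)

lemma wt_beta_word:
  "wt (beta_word K n) (Alpha i) = 0"
  "wt (beta_word K n) (Beta k) = (if 1 \<le> k \<and> k \<le> K then int (n k) else 0)"
  "wt (beta_word K n) (Prop k) = (if 1 \<le> k \<and> k \<le> K then - int (n k) else 0)"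
  by (induction K) (auto simp: wt_replicate of_bool_def le_Suc_eq)

context gl_full
begin

lemma alpha_beta_move: "E (Alpha i) (Beta k) (E (Beta m) (Prop m) x) = E (Beta m) (Prop m) (E (Alpha i) (Beta k) x)
    + (if k = m then E (Alpha i) (Prop m) x else 0)"
  using E_rel[of "Alpha i" "Beta k" "Beta m" "Prop m" x] by (simp add: sgn_gl_def)

lemma alpha_prop_move: "E (Alpha i) (Prop k) (E (Beta m) (Prop m) x) = E (Beta m) (Prop m) (E (Alpha i) (Prop k) x)"
  using E_rel[of "Alpha i" "Prop k" "Beta m" "Prop m" x] by (simp add: sgn_gl_def)

lemma alpha_beta_prop: "E (Alpha i) (Beta k) (E (Alpha j) (Prop m) x) = - E (Alpha j) (Prop m) (E (Alpha i) (Beta k) x)"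
  using E_rel[of "Alpha i" "Beta k" "Alpha j" "Prop m" x] by (simp add: sgn_gl_def)

lemma alpha_prop_word:
  assumes "\<And>y. y \<in> set w \<Longrightarrow> \<exists>m. y = (Beta m, Prop m)"
  shows "E (Alpha i) (Prop k) (word_act E w x) = word_act E w (E (Alpha i) (Prop k) x)"
  using assms
proof (induction w)
  case (Cons y w)
  obtain m where "y = (Beta m, Prop m)" using Cons.prems[of y] by auto
  then show ?case using Cons alpha_prop_move[of i k m "word_act E w x"] by simp
qed simp

lemma alpha_beta_word:
  assumes "\<And>y. y \<in> set w \<Longrightarrow> \<exists>m. m \<noteq> k \<and> y = (Beta m, Prop m)"
  shows "E (Alpha i) (Beta k) (word_act E w x) = word_act E w (E (Alpha i) (Beta k) x)"
  using assms
proof (induction w)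
  case (Cons y w)
  obtain m where "m \<noteq> k" "y = (Beta m, Prop m)" using Cons.prems[of y] by auto
  then show ?case using Cons alpha_beta_move[of i k m "word_act E w x"] by simp
qed simp

text \<open>The Leibniz rule for a power: the commutator with one factor is
  \<open>e_{alpha_i,k}\<close>, which commutes with the remaining factors.\<close>

lemma alpha_beta_replicate:
  "E (Alpha i) (Beta k) (word_act E (replicate p (Beta k, Prop k)) x) =
     word_act E (replicate p (Beta k, Prop k)) (E (Alpha i) (Beta k) x)
     + scale (of_nat p) (word_act E (replicate (p - 1) (Beta k, Prop k)) (E (Alpha i) (Prop k) x))"
proof (induction p)
  case (Suc p)
  let ?R = "\<lambda>p. word_act E (replicate p (Beta k, Prop k))" and ?T = "E (Beta k) (Prop k)"
  have c: "E (Alpha i) (Prop k) (?R p x) = ?R p (E (Alpha i) (Prop k) x)"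
    by (rule alpha_prop_word) auto
  have "?T (scale (of_nat p) (?R (p - 1) (E (Alpha i) (Prop k) x))) = scale (of_nat p) (?R p (E (Alpha i) (Prop k) x))"
    by (cases p) (simp_all add: E_scale)
  then show ?case
    using alpha_beta_move[of i k k "?R p x"] Suc c
    by (simp add: E_add scale_left_distrib add_ac)
qed simp

lemma alpha_beta_beta_word:
  assumes "E (Alpha i) (Beta k) x = 0" "1 \<le> k" "k \<le> K" "n k = Suc p"
  shows "E (Alpha i) (Beta k) (word_act E (beta_word K n) x) =
    scale (of_nat (n k)) (word_act E (beta_word K (n(k := p))) (E (Alpha i) (Prop k) x))"
  using assms(3)
proof (induction K)
  case (Suc K)
  show ?case
  proof (cases "k = Suc K")
    case True
    have ne: "\<exists>m. m \<noteq> k \<and> y = (Beta m, Prop m)" if "y \<in> set (beta_word K n)" for y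
      using set_beta_word[OF that] True by auto
    have 1: "E (Alpha i) (Beta k) (word_act E (beta_word K n) x) = 0"
      using alpha_beta_word[of "beta_word K n" k i x] ne assms(1) word_act_zero by simp
    have 2: "E (Alpha i) (Prop k) (word_act E (beta_word K n) x) = word_act E (beta_word K n) (E (Alpha i) (Prop k) x)"
      using ne by (intro alpha_prop_word) blast
    have 3: "beta_word (Suc K) (n(k := p)) = replicate p (Beta k, Prop k) @ beta_word K n"
      using True beta_word_cong[of K n "n(k := p)"] by simp
    have 4: "beta_word (Suc K) n = replicate (n k) (Beta k, Prop k) @ beta_word K n"
      using True by simp
    show ?thesis
      unfolding 3 4 word_act_simps alpha_beta_replicate 1 2
      using assms(4) by (simp add: word_act_zero del: replicate.simps)
  next
    case False
    have "E (Alpha i) (Beta k) (word_act E (replicate (n (Suc K)) (Beta (Suc K), Prop (Suc K))) y)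
        = word_act E (replicate (n (Suc K)) (Beta (Suc K), Prop (Suc K))) (E (Alpha i) (Beta k) y)" for y
      using False by (intro alpha_beta_word) auto
    then show ?thesis using Suc False by (simp add: word_act_scale)
  qed
qed (use assms in simp)

text \<open>Each letter \<open>e_{alpha_i,beta_k}\<close> consumes one factor
  \<open>e_{beta_k,k}\<close> and becomes \<open>e_{alpha_i,k}\<close>. The scalar collects the
  exponents met on the way, all positive because \<open>n k\<close> is at least the number of cells
  of \<open>Z\<close> in column \<open>k\<close>.\<close>

lemma beta_exchange:
  assumes x: "\<And>i k. E (Alpha i) (Beta k) x = 0"
    and "\<And>c. c \<in> set Z \<Longrightarrow> 1 \<le> snd c \<and> snd c \<le> K"
    and "\<And>k. length (filter (\<lambda>c. snd c = k) Z) \<le> n k"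
  shows "\<exists>\<kappa>. \<kappa> \<noteq> 0 \<and> word_act E (map (raise_letter Beta) Z) (word_act E (beta_word K n) x) =
    scale \<kappa> (word_act E (beta_word K (\<lambda>k. n k - length (filter (\<lambda>c. snd c = k) Z)))
      (word_act E (map (raise_letter Prop) Z) x))"
  using assms(2,3)
proof (induction Z)
  case Nil
  then show ?case by (intro exI[of _ 1]) auto
next
  case (Cons c Z)
  obtain i k where c: "c = (i, k)" by force
  let ?z = "\<lambda>k. length (filter (\<lambda>c. snd c = k) Z)"
  let ?m = "\<lambda>k. n k - ?z k"
  let ?y = "word_act E (map (raise_letter Prop) Z) x"
  have "?z k \<le> n k" for k using Cons.prems(2)[of k] by (auto split: if_splits)
  then obtain \<kappa> where \<kappa>: "\<kappa> \<noteq> 0" "word_act E (map (raise_letter Beta) Z) (word_act E (beta_word K n) x)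
      = scale \<kappa> (word_act E (beta_word K ?m) ?y)"
    using Cons.IH Cons.prems(1) by auto
  have y: "E (Alpha i) (Beta k) ?y = 0" for i k
    by (induction Z) (auto simp: x raise_letter_def alpha_beta_prop)
  have k: "1 \<le> k" "k \<le> K" using Cons.prems(1)[of c] c by auto
  have "Suc (?z k) \<le> n k" using Cons.prems(2)[of k] c by simp
  then have m: "?m k = Suc (?m k - 1)" by simp
  have "word_act E (map (raise_letter Beta) (c # Z)) (word_act E (beta_word K n) x)
      = scale \<kappa> (E (Alpha i) (Beta k) (word_act E (beta_word K ?m) ?y))"
    using \<kappa>(2) c by (simp add: raise_letter_def E_scale)
  also have "\<dots> = scale (\<kappa> * of_nat (?m k)) (word_act E (beta_word K (?m(k := ?m k - 1))) (E (Alpha i) (Prop k) ?y))"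
    using alpha_beta_beta_word[of i k ?y K ?m "?m k - 1", OF y k m] by simp
  also have "?m(k := ?m k - 1) = (\<lambda>k'. n k' - length (filter (\<lambda>c. snd c = k') (c # Z)))"
    using c by (auto simp: fun_eq_iff)
  also have "E (Alpha i) (Prop k) ?y = word_act E (map (raise_letter Prop) (c # Z)) x"
    using c by (simp add: raise_letter_def)
  finally show ?case using \<kappa>(1) m by (intro exI[of _ "\<kappa> * of_nat (?m k)"]) auto
qed

end

interpretation FE_full: gl_full fscale "FE l" for l
  by unfold_locales

lemma hw_fock_virtual:
  assumes "virtual g"
  shows "FE l a g (hw_fock mu) = 0"
proof (rule ext, rule ccontr)
  fix M assume "FE l a g (hw_fock mu) M \<noteq> 0 M"
  then have "FE l a g (hw_fock mu) M \<noteq> 0" by (simp add: fun_apply)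
  then obtain M' where "hw_fock mu M' \<noteq> 0" "1 \<le> symcount l M' g"
    using FE_support_counts by metis
  then show False using symcount_hw_virtual[OF assms, of l mu] by (simp add: hw_fock_support)
qed

lemma gl_columns_Prop:
  assumes "is_partition lam" "length lam \<le> l"
  shows "gl_columns fscale (FE l) lam Prop (hw_fock lam)"
  by unfold_locales
    (use assms in \<open>auto simp: inj_def hw_fock_virtual hw_fock_raising hw_fock_weight\<close>)

text \<open>The twin of the highest weight monomial: the exponents equal the column lengths, so
  every symbol \<open>k\<close> is turned into \<open>beta_k\<close>.\<close>

definition beta_fock :: "nat \<Rightarrow> nat list \<Rightarrow> fock" where
  "beta_fock l lam = word_act (FE l) (beta_word (part lam 1) (conj_part lam)) (hw_fock lam)"

lemma beta_word_support:
  assumes "word_act (FE l) w f M \<noteq> 0" "\<And>y. y \<in> set w \<Longrightarrow> \<exists>m. y = (Beta m, Prop m)"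
  shows "\<exists>M'. f M' \<noteq> 0 \<and> (\<forall>m p. cnt M (Beta m, p) + cnt M (Prop m, p) = cnt M' (Beta m, p) + cnt M' (Prop m, p))"
  using assms
proof (induction w arbitrary: M)
  case (Cons y w)
  obtain k where y: "y = (Beta k, Prop k)" using Cons.prems(2)[of y] by auto
  have "FE l (Beta k) (Prop k) (word_act (FE l) w f) M \<noteq> 0" using Cons.prems(1) y by simp
  then obtain M1 j where M1: "word_act (FE l) w f M1 \<noteq> 0"
    "\<And>r. cnt M1 r + of_bool (r = (Beta k, j)) = cnt M r + of_bool (r = (Prop k, j))"
    using FE_support by metis
  have "cnt M (Beta m, p) + cnt M (Prop m, p) = cnt M1 (Beta m, p) + cnt M1 (Prop m, p)" for m p
    using M1(2)[of "(Beta m, p)"] M1(2)[of "(Prop m, p)"] by (auto simp: of_bool_def split: if_splits)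
  moreover obtain M' where "f M' \<noteq> 0"
    "\<And>m p. cnt M1 (Beta m, p) + cnt M1 (Prop m, p) = cnt M' (Beta m, p) + cnt M' (Prop m, p)"
    using Cons.IH[OF M1(1)] Cons.prems(2) by auto
  ultimately show ?case by (intro exI[of _ M'] conjI allI) simp_all
qed auto

lemma part_le_first:
  assumes "is_partition lam" "(i, j) \<in> diagram lam"
  shows "j \<le> part lam 1"
  using assms part_antimono[of lam 1 i] by (auto simp: diagram_def)

text \<open>The last claim comes from the conserved number of symbols \<open>k\<close> and
  \<open>beta_k\<close> at each place. Together with the absence of \<open>k\<close> it puts
  \<open>beta_k\<close> exactly at the places of column \<open>k\<close>.\<close>

lemma beta_fock_support:
  assumes "is_partition lam" "length lam \<le> l" "beta_fock l lam M \<noteq> 0"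
  shows "symcount l M (Alpha i) = 0"
    and "1 \<le> k \<Longrightarrow> symcount l M (Beta k) = conj_part lam k"
    and "1 \<le> k \<Longrightarrow> symcount l M (Prop k) = 0"
    and "cnt M (Beta k, p) + cnt M (Prop k, p) = of_bool ((p, k) \<in> diagram lam)"
proof -
  have s: "int (symcount l M g) = int (symcount l (hw_monomial lam) g) + wt (beta_word (part lam 1) (conj_part lam)) g" for g
    using word_support[of l "beta_word (part lam 1) (conj_part lam)" "hw_fock lam" M] assms(3)
    unfolding beta_fock_def hw_fock_support by metis
  have z: "conj_part lam k = 0" if "\<not> k \<le> part lam 1" for k
    using part_le_first[OF assms(1), of _ k] that unfolding conj_part_def by (auto simp: card_eq_0_iff)
  show "symcount l M (Alpha i) = 0" using s[of "Alpha i"] by (simp add: symcount_hw wt_beta_word)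
  show "symcount l M (Beta k) = conj_part lam k" if "1 \<le> k"
    using s[of "Beta k"] z[of k] that by (auto simp: symcount_hw wt_beta_word split: if_splits)
  show "symcount l M (Prop k) = 0" if "1 \<le> k"
    using s[of "Prop k"] z[of k] that by (auto simp: symcount_hw_Prop[OF assms(2)] wt_beta_word split: if_splits)
  obtain M' where "hw_fock lam M' \<noteq> 0"
    "\<forall>m p. cnt M (Beta m, p) + cnt M (Prop m, p) = cnt M' (Beta m, p) + cnt M' (Prop m, p)"
    using beta_word_support[of l _ "hw_fock lam" M] assms(3) set_beta_word unfolding beta_fock_def by metis
  then show "cnt M (Beta k, p) + cnt M (Prop k, p) = of_bool ((p, k) \<in> diagram lam)"
    by (simp add: hw_fock_support cnt_hw)
qed

lemma gl_columns_Beta: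
  assumes "is_partition lam" "length lam \<le> l"
  shows "gl_columns fscale (FE l) lam Beta (beta_fock l lam)"
proof
  show "FE l a (Alpha i) (beta_fock l lam) = 0" for a i
  proof (rule ext, rule ccontr)
    fix M assume "FE l a (Alpha i) (beta_fock l lam) M \<noteq> 0 M"
    then have "FE l a (Alpha i) (beta_fock l lam) M \<noteq> 0" by (simp add: fun_apply)
    then obtain M' where "beta_fock l lam M' \<noteq> 0" "1 \<le> symcount l M' (Alpha i)"
      using FE_support_counts by metis
    then show False using beta_fock_support(1)[OF assms] by simp
  qed
  show "FE l (Beta j) (Beta k) (beta_fock l lam) = 0" if jk: "1 \<le> j" "j < k" for j k
  proof (rule ext, rule ccontr)
    fix M assume "FE l (Beta j) (Beta k) (beta_fock l lam) M \<noteq> 0 M"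
    then have "FE l (Beta j) (Beta k) (beta_fock l lam) M \<noteq> 0" by (simp add: fun_apply)
    then obtain M' p where M': "p \<in> {1..l}" "beta_fock l lam M' \<noteq> 0" "1 \<le> cnt M' (Beta k, p)"
      "\<And>r. cnt M' r + of_bool (r = (Beta j, p)) = cnt M r + of_bool (r = (Beta k, p))"
      using FE_support by metis
    note supp = beta_fock_support[OF assms M'(2)]
    have "(p, k) \<in> diagram lam" using supp(4)[of k p] M'(3) by (auto simp: of_bool_def split: if_splits)
    then have "(p, j) \<in> diagram lam" using diagram_down[OF assms(1), of p k p j] jk by (auto simp: diagram_def)
    moreover have "cnt M' (Prop j, p) \<le> symcount l M' (Prop j)"
      unfolding symcount_def using M'(1) by (intro member_le_sum) auto
    ultimately have "cnt M' (Beta j, p) = 1" using supp(3)[OF jk(1)] supp(4)[of j p] by simp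
    then have "cnt M (Beta j, p) = 2" using M'(4)[of "(Beta j, p)"] jk by simp
    then show False using cnt_odd_le[of "(Beta j, p)" M] by (simp add: odd_var_def)
  qed
  show "FE l (Beta k) (Beta k) (beta_fock l lam) = fscale (of_nat (conj_part lam k)) (beta_fock l lam)" if "1 \<le> k" for k
  proof
    fix M
    show "FE l (Beta k) (Beta k) (beta_fock l lam) M = fscale (of_nat (conj_part lam k)) (beta_fock l lam) M"
      using beta_fock_support(2)[OF assms, of M k] that by (cases "beta_fock l lam M = 0") (auto simp: FE_self fscale_def)
  qed
qed (use assms in \<open>auto simp: inj_def\<close>)

section \<open>The summands of the Schur element\<close>

lemma tab_words:
  assumes "\<forall>c\<in>diagram lam. S c = snd c"
  shows "tab_word lam (\<lambda>c. Prop (S c)) Cstar = map (lower_letter Prop) (cells lam)"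
    "tab_word lam Cstar (\<lambda>c. Prop (S c)) = map (raise_letter Prop) (cells lam)"
    "tab_word lam Cstar Dstar = map (raise_letter Beta) (cells lam)"
    "tab_word lam Dstar Cstar = map (lower_letter Beta) (cells lam)"
  using assms by (auto simp: tab_word_def raise_letter_def lower_letter_def Cstar_def Dstar_def set_cells
    split: prod.splits)

lemma canonical_tableau:
  assumes lam: "is_partition lam" and l: "length lam \<le> l" and S: "\<forall>c\<in>diagram lam. S c = snd c"
  shows "word_act (FE l) (tab_word lam (\<lambda>c. Prop (S c)) Cstar @ tab_word lam Cstar Dstar @
      tab_word lam Dstar Cstar @ tab_word lam Cstar (\<lambda>c. Prop (S c))) (hw_fock lam)
    = fscale (of_nat (hook_product lam * hook_product lam)) (hw_fock lam)"
proof -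
  let ?H = "of_nat (hook_product lam) :: complex"
  let ?up = "\<lambda>b. word_act (FE l) (map (raise_letter b) (cells lam))"
  let ?down = "\<lambda>b. word_act (FE l) (map (lower_letter b) (cells lam))"
  obtain s where s: "s * s = 1" "\<And>b v. gl_columns fscale (FE l) lam b v \<Longrightarrow> ?down b (?up b v) = fscale (s * ?H) v"
    using FE_full.hook_eigenvalue[of l lam] by blast
  have len: "length (filter (\<lambda>c. snd c = k) (cells lam)) = conj_part lam k" for k
  proof -
    have "length (filter (\<lambda>c. snd c = k) (cells lam)) = card (set (filter (\<lambda>c. snd c = k) (cells lam)))"
      using distinct_cells[of lam] by (intro distinct_card[symmetric] distinct_filter)
    also have "set (filter (\<lambda>c. snd c = k) (cells lam)) = (\<lambda>i. (i, k)) ` {i. (i, k) \<in> diagram lam}"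
      by (auto simp: set_cells)
    finally show ?thesis by (simp add: card_image inj_on_def conj_part_def)
  qed
  have cols: "1 \<le> snd c \<and> snd c \<le> part lam 1" if "c \<in> set (cells lam)" for c
    using that part_le_first[OF lam, of "fst c" "snd c"] by (auto simp: set_cells diagram_def)
  have fr: "FE l (Alpha i) (Beta k) (hw_fock lam) = 0" for i k
    by (rule hw_fock_virtual) simp
  have "beta_word (part lam 1) (\<lambda>k. conj_part lam k - length (filter (\<lambda>c. snd c = k) (cells lam))) = []"
    by (rule beta_word_zero) (simp add: len)
  \<comment> \<open>Every column has exactly as many cells as its exponent in the beta word, so the
    exchange uses up the whole word.\<close>
  then obtain \<kappa> where \<kappa>: "\<kappa> \<noteq> 0" "?up Beta (beta_fock l lam) = fscale \<kappa> (?up Prop (hw_fock lam))"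
    using FE_full.beta_exchange[of l "hw_fock lam" "cells lam" "part lam 1" "conj_part lam", OF fr cols] len
    unfolding beta_fock_def by auto
  have lin: "word_act (FE l) w (fscale c x) = fscale c (word_act (FE l) w x)" for w c x
    by (rule FE.word_act_scale[of w UNIV]) simp
  \<comment> \<open>The vector \<open>?up Prop (hw_fock lam)\<close> is traded for
    \<open>?up Beta\<close> of the twin, where the hook eigenvalue applies, and then traded
    back.\<close>
  have "fscale \<kappa> (?up Beta (?down Beta (?up Prop (hw_fock lam)))) = ?up Beta (?down Beta (?up Beta (beta_fock l lam)))"
    by (simp add: \<kappa>(2) lin)
  also have "\<dots> = fscale \<kappa> (fscale (s * ?H) (?up Prop (hw_fock lam)))"
    unfolding s(2)[OF gl_columns_Beta[OF lam l]] unfolding lin \<kappa>(2) by (simp add: mult_ac)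
  finally have "fscale \<kappa> (?up Beta (?down Beta (?up Prop (hw_fock lam)))) = fscale \<kappa> (fscale (s * ?H) (?up Prop (hw_fock lam)))" .
  then have 1: "?up Beta (?down Beta (?up Prop (hw_fock lam))) = fscale (s * ?H) (?up Prop (hw_fock lam))"
    using \<kappa>(1) unfolding fock.scale_cancel_left by simp
  have sq: "(s * ?H) * (s * ?H) = of_nat (hook_product lam * hook_product lam)"
    using s(1) by (metis mult.assoc mult.commute mult_1 of_nat_mult)
  show ?thesis
    unfolding tab_words[OF S] word_act_simps 1 lin s(2)[OF gl_columns_Prop[OF lam l]] fock.scale_scale sq ..
qed

text \<open>The word removes as many symbols \<open>k\<close> as \<open>S\<close> contains, so the
  content of \<open>S\<close> is bounded by the column lengths, and equal totals force equality.
  Then the entries of \<open>S\<close> have the same sum as the column indices, while strict rows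
  bound each entry below by its column index.\<close>

lemma noncanonical_tableau:
  assumes lam: "is_partition lam" and l: "length lam \<le> l" and n: "part lam 1 \<le> n"
    and S: "S \<in> row_strict_tableaux n lam" and c: "c \<in> diagram lam" "S c \<noteq> snd c"
  shows "word_act (FE l) (tab_word lam Cstar (\<lambda>c. Prop (S c))) (hw_fock lam) = 0"
proof (rule ext, rule ccontr)
  fix M assume "word_act (FE l) (tab_word lam Cstar (\<lambda>c. Prop (S c))) (hw_fock lam) M \<noteq> 0 M"
  then have M: "word_act (FE l) (tab_word lam Cstar (\<lambda>c. Prop (S c))) (hw_fock lam) M \<noteq> 0"
    by (simp add: fun_apply)
  let ?s = "\<lambda>k. card {c \<in> diagram lam. S c = k}" and ?t = "\<lambda>k. card {c \<in> diagram lam. snd c = k}"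
  have t: "?t k = conj_part lam k" for k
  proof -
    have "{c \<in> diagram lam. snd c = k} = (\<lambda>i. (i, k)) ` {i. (i, k) \<in> diagram lam}" by auto
    then show ?thesis by (simp add: card_image inj_on_def conj_part_def)
  qed
  have le: "?s k \<le> ?t k" for k
  proof -
    have "int (symcount l M (Prop k)) = int (conj_part lam k) + wt (tab_word lam Cstar (\<lambda>c. Prop (S c))) (Prop k)"
      using word_support[OF M] symcount_hw_Prop[OF l, of k] unfolding hw_fock_support by metis
    then show ?thesis unfolding t by (simp add: wt_tab_word)
  qed
  have Sn: "S d \<in> {1..n}" "snd d \<in> {1..n}" if "d \<in> diagram lam" for d
    using that S n part_le_first[OF lam, of "fst d" "snd d"]
    by (auto simp: row_strict_tableaux_def diagram_def PiE_def Pi_def)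
  have sum: "(\<Sum>k=1..n. g k * card {c \<in> diagram lam. f c = k}) = (\<Sum>c\<in>diagram lam. g (f c))"
    if "\<And>d. d \<in> diagram lam \<Longrightarrow> f d \<in> {1..n}" for f g :: "_ \<Rightarrow> nat"
  proof -
    have "(\<Sum>c\<in>diagram lam. g (f c)) = (\<Sum>k=1..n. \<Sum>c\<in>{c \<in> diagram lam. f c = k}. g (f c))"
      using that by (intro sum.group[symmetric]) auto
    also have "\<dots> = (\<Sum>k=1..n. g k * card {c \<in> diagram lam. f c = k})"
      by (intro sum.cong refl) simp
    finally show ?thesis by simp
  qed
  have "(\<Sum>k=1..n. ?s k) = (\<Sum>k=1..n. ?t k)"
    using sum[of S "\<lambda>_. 1"] sum[of snd "\<lambda>_. 1"] Sn by simp
  then have eq: "?s k = ?t k" if "k \<in> {1..n}" for k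
    using sum_mono_inv[of ?s "{1..n}" ?t k] le that by auto
  have "(\<Sum>c\<in>diagram lam. S c) = (\<Sum>k=1..n. k * ?s k)" using sum[of S "\<lambda>k. k"] Sn by simp
  also have "\<dots> = (\<Sum>k=1..n. k * ?t k)" using eq by (intro sum.cong) auto
  also have "\<dots> = (\<Sum>c\<in>diagram lam. snd c)" using sum[of snd "\<lambda>k. k"] Sn by simp
  finally have tot: "(\<Sum>c\<in>diagram lam. snd c) = (\<Sum>c\<in>diagram lam. S c)" by simp
  have "j \<le> S (i, j)" if "(i, j) \<in> diagram lam" for i j
    using that
  proof (induction j)
    case (Suc j)
    show ?case
    proof (cases "j = 0")
      case True
      then show ?thesis using Sn(1)[OF Suc.prems] by simp
    next
      case False
      then have j: "(i, j) \<in> diagram lam" using Suc.prems by (auto simp: diagram_def)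
      then have "S (i, j) < S (i, Suc j)" using S Suc.prems by (auto simp: row_strict_tableaux_def)
      then show ?thesis using Suc.IH[OF j] by simp
    qed
  qed simp
  then have "snd c \<le> S c" if "c \<in> diagram lam" for c using that by (cases c) auto
  then have "snd c = S c" using sum_mono_inv[OF tot] c(1) by simp
  then show False using c(2) by simp
qed

text \<open>The weight vanishes because each tableau occurs once on the creating and once on the
  annihilating side.\<close>

lemma schur_summand_coset:
  assumes "is_partition lam" "conj_part lam 1 \<le> m0" "part lam 1 \<le> m1"
    and "\<forall>c\<in>diagram lam. S c \<in> {1..n}"
  defines "w \<equiv> tab_word lam (\<lambda>c. Prop (S c)) Cstar @ tab_word lam Cstar Dstar @
      tab_word lam Dstar Cstar @ tab_word lam Cstar (\<lambda>c. Prop (S c))"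
  shows "schur_summand m0 m1 n lam S = coset (symbols m0 m1 n) (word_poly w)"
    and "set w \<subseteq> symbols m0 m1 n \<times> symbols m0 m1 n" and "wt w g = 0"
proof -
  let ?A = "symbols m0 m1 n"
  have C: "c \<in> diagram lam \<Longrightarrow> Cstar c \<in> ?A" for c using Cstar_symbols[OF assms(1,2), of c] by (auto simp: symbols_def)
  have D: "c \<in> diagram lam \<Longrightarrow> Dstar c \<in> ?A" for c using Dstar_symbols[OF assms(1,3), of c] by (auto simp: symbols_def)
  have P: "c \<in> diagram lam \<Longrightarrow> Prop (S c) \<in> ?A" for c using assms(4) by (auto simp: symbols_def proper_symbols_def)
  have sub: "set (tab_word lam (\<lambda>c. Prop (S c)) Cstar) \<subseteq> ?A \<times> ?A" "set (tab_word lam Cstar Dstar) \<subseteq> ?A \<times> ?A"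
    "set (tab_word lam Dstar Cstar) \<subseteq> ?A \<times> ?A" "set (tab_word lam Cstar (\<lambda>c. Prop (S c))) \<subseteq> ?A \<times> ?A"
    unfolding tab_word_subset using C D P by auto
  have e: "e_tab ?A lam S T = coset ?A (word_poly (tab_word lam S T))" for S T
    by (simp add: e_tab_def env_monomial_coset tab_word_def)
  have wp: "word_poly u \<in> words_over ?A" if "set u \<subseteq> ?A \<times> ?A" for u
    using that by (intro words_over_single) simp
  show "schur_summand m0 m1 n lam S = coset ?A (word_poly w)"
    unfolding schur_summand_def Let_def e w_def
    by (simp add: coset_mult wp words_over_mult sub word_poly_mult)
  show "set w \<subseteq> ?A \<times> ?A" unfolding w_def using sub by auto
  show "wt w g = 0" unfolding w_def by (simp add: wt_tab_word)
qed

lemma schur_elem_hw_fock: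
  assumes lam: "is_partition lam" "part lam 1 \<le> n" and mu: "is_partition mu"
    and m: "conj_part lam 1 \<le> m0" "part lam 1 \<le> m1"
    and l: "length lam + length mu \<le> l"
  shows "schur_elem m0 m1 n lam \<in> carrier (U_gl n)" (is ?carrier)
    and "\<not> diagram lam \<subseteq> diagram mu \<Longrightarrow> env_act fscale (FE l) (schur_elem m0 m1 n lam) (hw_fock mu) = 0"
    and "mu = lam \<Longrightarrow> env_act fscale (FE l) (schur_elem m0 m1 n lam) (hw_fock mu) = fscale (of_nat (hook_product lam)) (hw_fock mu)"
proof -
  let ?A = "symbols m0 m1 n" and ?B = "proper_symbols n" and ?v = "hw_fock mu"
  let ?R = "row_strict_tableaux n lam"
  let ?w = "\<lambda>S. tab_word lam (\<lambda>c. Prop (S c)) Cstar @ tab_word lam Cstar Dstar @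
      tab_word lam Dstar Cstar @ tab_word lam Cstar (\<lambda>c. Prop (S c))"
  let ?p = "\<lambda>S. virt_proj m0 m1 n (schur_summand m0 m1 n lam S)"
  interpret B: ring "env ?B" by (rule ring_env)
  have fin: "finite ?R"
    unfolding row_strict_tableaux_def by (rule finite_subset[OF _ finite_PiE[of "diagram lam" "\<lambda>_. {1..n}"]]) auto
  have R: "\<forall>c\<in>diagram lam. S c \<in> {1..n}" if "S \<in> ?R" for S
    using that PiE_mem[of S "diagram lam" "\<lambda>_. {1..n}"] by (simp add: row_strict_tableaux_def)
  have p: "?p S \<in> carrier (U_gl n) \<and> env_act fscale (FE l) (?p S) ?v = word_act (FE l) (?w S) ?v" if S: "S \<in> ?R" for S
  proof -
    note ss = schur_summand_coset[OF lam(1) m R[OF S]]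
    obtain r where r: "r \<in> words_over ?B" "?p S = coset ?B r" "word_poly (?w S) - r \<in> irr_polys m0 m1 n"
      using virt_proj_mono[OF ss(2,3)] unfolding ss(1) by metis
    \<comment> \<open>The difference lies in Irr, which kills the highest weight monomial, so the
      projected element acts as the virtual word.\<close>
    have "poly_act fscale (FE l) (word_poly (?w S)) ?v = poly_act fscale (FE l) r ?v"
      using irr_polys_hw_fock[OF r(3), of l mu] by (simp add: FE.poly_act_diff)
    then show ?thesis
      using r coset_carrier[OF r(1)] by (simp add: FE.env_act_coset FE.poly_act_single)
  qed
  let ?h = "1 / of_nat (hook_product lam) :: complex"
  have h: "Poly_Mapping.single 0 ?h \<in> words_over ?B" by (rule words_over_single) simp
  have sc: "env_scalar ?B ?h \<in> carrier (U_gl n)"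
    unfolding env_scalar_coset by (rule coset_carrier[OF h])
  have fs: "finsum (U_gl n) ?p ?R \<in> carrier (U_gl n)"
    using p by (intro B.finsum_closed) auto
  show ?carrier
    unfolding schur_elem_def by (rule B.m_closed[OF sc fs])
  have act: "env_act fscale (FE l) (schur_elem m0 m1 n lam) ?v = fscale ?h (\<Sum>S\<in>?R. word_act (FE l) (?w S) ?v)"
  proof -
    have "env_act fscale (FE l) (schur_elem m0 m1 n lam) ?v
        = env_act fscale (FE l) (env_scalar ?B ?h) (env_act fscale (FE l) (finsum (U_gl n) ?p ?R) ?v)"
      unfolding schur_elem_def by (rule FE.env_act_mult[OF sc fs])
    also have "env_act fscale (FE l) (finsum (U_gl n) ?p ?R) ?v = (\<Sum>S\<in>?R. env_act fscale (FE l) (?p S) ?v)"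
      using p fin by (intro FE.env_act_finsum) auto
    also have "\<dots> = (\<Sum>S\<in>?R. word_act (FE l) (?w S) ?v)" using p by (intro sum.cong) auto
    finally show ?thesis by (simp add: env_scalar_coset FE.env_act_coset FE.poly_act_single)
  qed
  show "env_act fscale (FE l) (schur_elem m0 m1 n lam) ?v = 0" if nsub: "\<not> diagram lam \<subseteq> diagram mu"
  proof -
    have "word_act (FE l) (?w S) ?v = 0" if S: "S \<in> ?R" for S
    proof -
      have "word_act (FE l) (tab_word lam Cstar Dstar @ tab_word lam Dstar Cstar @ tab_word lam Cstar (\<lambda>c. Prop (S c))) ?v = 0"
        using R[OF S] by (intro vanishing[OF lam(1) mu m _ l nsub]) blast
      then show ?thesis by (simp add: FE.word_act_zero[of _ UNIV])
    qed
    then show ?thesis unfolding act by simp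
  qed
  show "env_act fscale (FE l) (schur_elem m0 m1 n lam) ?v = fscale (of_nat (hook_product lam)) ?v" if eq: "mu = lam"
  proof -
    \<comment> \<open>The tableau with constant columns; \<open>restrict\<close> makes it
      extensional, as membership in \<open>row_strict_tableaux\<close> demands.\<close>
    let ?S0 = "restrict snd (diagram lam)"
    have S0: "?S0 \<in> ?R"
      using part_le_first[OF lam(1)] lam(2) by (fastforce simp: row_strict_tableaux_def diagram_def)
    have ll: "length lam \<le> l" using l by simp
    have "word_act (FE l) (?w S) ?v = 0" if S: "S \<in> ?R" "S \<noteq> ?S0" for S
    proof -
      have "\<exists>c\<in>diagram lam. S c \<noteq> snd c"
      proof (rule ccontr)
        assume "\<not> ?thesis"
        then have "S = ?S0"
          using S(1) by (intro ext) (auto simp: row_strict_tableaux_def PiE_def extensional_def restrict_def)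
        then show False using S(2) by simp
      qed
      then show ?thesis
        using noncanonical_tableau[OF lam(1) ll lam(2) S(1)] FE.word_act_zero[of _ UNIV l] eq by auto
    qed
    then have "(\<Sum>S\<in>?R. word_act (FE l) (?w S) ?v) = word_act (FE l) (?w ?S0) ?v"
      using S0 fin by (subst sum.remove[OF fin S0]) (simp add: sum.neutral)
    also have "\<dots> = fscale (of_nat (hook_product lam * hook_product lam)) ?v"
      using canonical_tableau[OF lam(1) ll, of ?S0] eq by simp
    finally have "env_act fscale (FE l) (schur_elem m0 m1 n lam) ?v
        = fscale (?h * of_nat (hook_product lam * hook_product lam)) ?v"
      unfolding act by simp
    moreover have "hook_product lam \<noteq> 0"
      by (auto simp: hook_product_def hook_length_def split: prod.splits)
    ultimately show ?thesis by simp
  qed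
qed

theorem theorem4p50:
  fixes n m0 m1 :: nat
    and lam mu :: "nat list"
    and scale :: "complex \<Rightarrow> 'v::ab_group_add \<Rightarrow> 'v"
    and \<rho> :: "nat \<Rightarrow> nat \<Rightarrow> 'v \<Rightarrow> 'v"
    and v :: 'v
  assumes "1 \<le> n"
    and "is_partition lam" and "part lam 1 \<le> n"
    and "is_partition mu" and "part mu 1 \<le> n"
    and "conj_part lam 1 \<le> m0" and "part lam 1 \<le> m1"
    and "irreducible_gl_module n scale \<rho>"
    and "highest_weight_vector n scale \<rho> (conj_part mu) v"
  shows "(\<not> diagram lam \<subseteq> diagram mu \<longrightarrow>
            U_action scale \<rho> (schur_elem m0 m1 n lam) v = 0) \<and>
         (mu = lam \<longrightarrow>
            U_action scale \<rho> (schur_elem m0 m1 n lam) v = scale (of_nat (hook_product lam)) v)"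
proof -
  let ?E = "\<lambda>a b. \<rho> (index a) (index b)" and ?B = "proper_symbols n"
  \<comment> \<open>Enough places for the rows of both diagrams.\<close>
  define l where "l = length lam + length mu"
  have module: "gl_module n scale \<rho>" using assms(8) by (simp add: irreducible_gl_module_def)
  interpret vector_space scale using module by (simp add: gl_module_def)
  have lin: "Vector_Spaces.linear scale scale (\<rho> i j)" if "i \<in> {1..n}" "j \<in> {1..n}" for i j
    using module that by (simp add: gl_module_def)
  have br: "\<rho> i j (\<rho> k m x) = \<rho> k m (\<rho> i j x) + (if j = k then \<rho> i m x else 0) - (if i = m then \<rho> k j x else 0)"
    if "i \<in> {1..n}" "j \<in> {1..n}" "k \<in> {1..n}" "m \<in> {1..n}" for i j k m x
  proof -
    have "\<rho> i j (\<rho> k m x) - \<rho> k m (\<rho> i j x) = (if j = k then \<rho> i m x else 0) - (if i = m then \<rho> k j x else 0)"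
      using module that unfolding gl_module_def by blast
    then show ?thesis by (simp add: algebra_simps)
  qed
  have B: "\<exists>i\<in>{1..n}. a = Prop i" if "a \<in> ?B" for a using that by (auto simp: proper_symbols_def)
  \<comment> \<open>All proper symbols are odd, so the letters between them are even and the
    superbracket relation is the ordinary one.\<close>
  interpret W: gl_hw scale n ?E "conj_part mu" v
  proof
    fix a b c d k and x y :: 'v
    assume ab: "a \<in> ?B" "b \<in> ?B"
    obtain i j where ij: "a = Prop i" "b = Prop j" "i \<in> {1..n}" "j \<in> {1..n}" using B ab by blast
    interpret L: Vector_Spaces.linear scale scale "\<rho> i j" using lin ij by blast
    show "?E a b (x + y) = ?E a b x + ?E a b y" "?E a b (scale k x) = scale k (?E a b x)"
      using ij by (simp_all add: L.add L.scale)
    assume cd: "c \<in> ?B" "d \<in> ?B"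
    obtain p q where pq: "c = Prop p" "d = Prop q" "p \<in> {1..n}" "q \<in> {1..n}" using B cd by blast
    show "?E a b (?E c d x) = scale (sgn_gl a b c d) (?E c d (?E a b x)) + (if b = c then ?E a d x else 0)
        - scale (sgn_gl a b c d) (if a = d then ?E c b x else 0)"
      using br[OF ij(3,4) pq(3,4), of x] ij pq by (simp add: sgn_gl_def)
  qed (use assms(9) in \<open>auto simp: highest_weight_vector_def\<close>)
  have v: "v \<noteq> 0" using assms(9) by (simp add: highest_weight_vector_def)
  have irr: "W = {0} \<or> W = UNIV" if "subspace W" "\<And>a b. a \<in> ?B \<Longrightarrow> b \<in> ?B \<Longrightarrow> ?E a b ` W \<subseteq> W" for W
  proof -
    have "\<rho> i j ` W \<subseteq> W" if "i \<in> {1..n}" "j \<in> {1..n}" for i j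
      using \<open>\<And>a b. a \<in> ?B \<Longrightarrow> b \<in> ?B \<Longrightarrow> ?E a b ` W \<subseteq> W\<close>[of "Prop i" "Prop j"] that
      by (simp add: proper_symbols_def)
    then show ?thesis using assms(8) that(1) unfolding irreducible_gl_module_def by blast
  qed
  note schur = schur_elem_hw_fock[OF assms(2,3,4,6,7), of l]
  have ll: "length lam + length mu \<le> l" "length mu \<le> l" by (simp_all add: l_def)
  obtain p where p: "p \<in> words_over ?B" "schur_elem m0 m1 n lam = coset ?B p"
    using carrier_env_coset[OF schur(1)[OF ll(1)]] by blast
  have transfer: "U_action scale \<rho> (schur_elem m0 m1 n lam) v = scale c v"
    if "env_act fscale (FE l) (schur_elem m0 m1 n lam) (hw_fock mu) = fscale c (hw_fock mu)" for c
    using eigenvalue_transfer[OF gl_hw_fock[OF assms(4) ll(2)] hw_fock_nonzero W.gl_hw_axioms v irr p(1), of c] that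
    unfolding U_action_env_act p(2) W.env_act_coset FE.env_act_coset by blast
  show ?thesis
    using schur(2)[OF ll(1)] schur(3)[OF ll(1)] transfer[of 0] transfer[of "of_nat (hook_product lam)"]
    by simp
qed


end
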